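(* Let $\langle i_X:\mathcal M X\to\mathcal P X\leftarrow\mathcal M'X:i'_X;\ X\in\mathcal C\rangle$ be a temporal doctrine. (1) Given a map $f:X\to Y$ and a point $y:1\to Y$ in $\mathcal C$, there are isomorphisms in $\mathcal B1$ $$j_1^{-1}(y\cdot\forall_fM)\cong\underline{\rm nat}_X(f\cdot(Y/y),M),\qquad j_1^{-1}(y\cdot\exists_fM)\cong\underline{\rm ten}_X(f'\cdot(y\backslash Y),M)$$ natural in $M\in\mathcal M X$; and dually $${j'_1}^{-1}(y'\cdot\forall'_fN)\cong\underline{\rm nat}'_X(f'\cdot(y\backslash Y),N),\qquad {j'_1}^{-1}(y'\cdot\exists'_fN)\cong\underline{\rm ten}_X(N,f\cdot(Y/y))$$ natural in $N\in\mathcal M'X$. (2) Given a point $x:1\to X$ in $\mathcal C$, there are isomorphisms in $\mathcal B1$ $$j_1^{-1}(x\cdot\Box_XP)\cong\underline{\rm hom}_X(i_X(X/x),P),\qquad j_1^{-1}(x\cdot\Diamond_XP)\cong\underline{\rm meets}_X(i'_X(x\backslash X),P)$$ natural in $P\in\mathcal P X$; and dually $${j'_1}^{-1}(x'\cdot\Box'_XP)\cong\underline{\rm hom}_X(i'_X(x\backslash X),P),\qquad {j'_1}^{-1}(x'\cdot\Diamond'_XP)\cong\underline{\rm meets}_X(P,i_X(X/x))$$ natural in $P\in\mathcal P X$.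
   Context: A temporal doctrine $\langle i_X:\mathcal M X\to\mathcal P X\leftarrow\mathcal M'X:i'_X;\ X\in\mathcal C\rangle$ consists of a category $\mathcal C$, three $\mathcal C$-indexed categories $\mathcal M,\mathcal P,\mathcal M'$ (pseudofunctors $\mathcal C^{op}\to\mathbf{Cat}$), and two indexed functors $i:\mathcal M\to\mathcal P$, $i':\mathcal M'\to\mathcal P$. The substitution functors along $f:X\to Y$ are written $f\cdot(-):\mathcal M Y\to\mathcal M X$, $f'\cdot(-):\mathcal M'Y\to\mathcal M'X$, $f^*:\mathcal P Y\to\mathcal P X$; thus $i_X(f\cdot M)\cong f^*i_Y M$ and $i'_X(f'\cdot N)\cong f^*i'_Y N$, coherently. $\mathcal B X:=\mathcal M X\times_{\mathcal P X}\mathcal M'X$ denotes the indexed pullback of $i$ and $i'$ (equalities up to the coherent isomorphisms), with projections $j_X:\mathcal B X\to\mathcal M X$, $j'_X:\mathcal B X\to\mathcal M'X$, and $b_X:=i_Xj_X=i'_Xj'_X:\mathcal B X\to\mathcal P X$. The axioms are: (A1) $\mathcal C$ has a terminal object $1$. (A2) Each $\mathcal P X$ is cartesian closed, with terminal object $1_X$, products $P\times_X Q$ and exponentials $P\Rightarrow Q$. (A3) Each $f^*$ has left and right adjoints $\Sigma_f\dashv f^*\dashv\Pi_f$. (A4) $i_X$ and $i'_X$ have left and right adjoints: $\Diamond_X\dashv i_X\dashv\Box_X$, $\Diamond'_X\dashv i'_X\dashv\Box'_X$. (A5) (comprehension) The canonical functor $c_X:\mathcal C/X\to\mathcal P X$,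 sending $f:T\to X$ to $\Sigma_f1_T$, has a right adjoint $k_X:\mathcal P X\to\mathcal C/X$. (B1) $i_X$ and $i'_X$ are fully faithful. (B2) (Frobenius law) $\Sigma_fP\times_YQ\cong\Sigma_f(P\times_Xf^*Q)$ canonically, naturally in $P\in\mathcal P X$, $Q\in\mathcal P Y$, for every $f:X\to Y$. (B3) (mixed Frobenius laws) The units of $\Diamond_X\dashv i_X$ and $\Diamond'_X\dashv i'_X$ induce isomorphisms $\Diamond_X(P\times_Xi'_XN)\cong\Diamond_X(i_X\Diamond_XP\times_Xi'_XN)$ and $\Diamond'_X(P\times_Xi_XM)\cong\Diamond'_X(i'_X\Diamond'_XP\times_Xi_XM)$, natural in $P\in\mathcal P X$, $M\in\mathcal M X$, $N\in\mathcal M'X$. (B4) $j_1:\mathcal B1\to\mathcal M1$ and $j'_1:\mathcal B1\to\mathcal M'1$ are isomorphisms. (B5) Each $k_X$ is fully faithful. Derived notation. $\top_X$ and $\top'_X$ are the terminal objects of $\mathcal M X$ and $\mathcal M'X$. For $f:X\to Y$, $f\cdot(-)$ has left adjoint $\exists_f:=\Diamond_Y\Sigma_fi_X$ and right adjoint $\forall_f:=\Box_Y\Pi_fi_X$, and $f'\cdot(-)$ has left adjoint $\exists'_f:=\Diamond'_Y\Sigma_fi'_X$ and right adjoint $\forall'_f:=\Box'_Y\Pi_fi'_X$. The functor $X^*b_1:\mathcal B1\to\mathcal P X$ ($X$ denoting here the map $X\to1$) has a left adjoint $\underline{\rm coend}_X$ and a right adjoint $\underline{\rm end}_X$. For $P,Q\in\mathcal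 P X$, $L,M\in\mathcal M X$, $N,O\in\mathcal M'X$: $\underline{\rm meets}_X(P,Q):=\underline{\rm coend}_X(P\times_XQ)$, $\underline{\rm hom}_X(P,Q):=\underline{\rm end}_X(P\Rightarrow Q)$, $\underline{\rm ten}_X(N,M):=\underline{\rm meets}_X(i'_XN,i_XM)$, $\underline{\rm nat}_X(L,M):=\underline{\rm hom}_X(i_XL,i_XM)$, $\underline{\rm nat}'_X(N,O):=\underline{\rm hom}_X(i'_XN,i'_XO)$, objects of $\mathcal B1$. For a point $x:1\to X$, the left and right slices are $X/x:=\exists_x\top_1\in\mathcal M X$ and $x\backslash X:=\exists'_x\top'_1\in\mathcal M'X$; $x\cdot M\in\mathcal M1$ and $x'\cdot N\in\mathcal M'1$ are the substitutions along $x$. *)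

theory Defs
  imports Main
begin

section \<open>Categories and functors\<close>

record ('o, 'a) cat =
  Obj :: "'o set"
  Arr :: "'a set"
  Dom :: "'a \<Rightarrow> 'o"
  Cod :: "'a \<Rightarrow> 'o"
  Ide :: "'o \<Rightarrow> 'a"
  Comp :: "'a \<Rightarrow> 'a \<Rightarrow> 'a"  (infixr "\<cdot>\<index>" 70)

definition hom :: "('o, 'a) cat \<Rightarrow> 'o \<Rightarrow> 'o \<Rightarrow> 'a set" where
  "hom A a b = {f \<in> Arr A. Dom A f = a \<and> Cod A f = b}"

locale category =
  fixes A :: "('o, 'a) cat" (structure)
  assumes dom_in: "f \<in> Arr A \<Longrightarrow> Dom A f \<in> Obj A"
    and cod_in: "f \<in> Arr A \<Longrightarrow> Cod A f \<in> Obj A"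
    and ide_in: "a \<in> Obj A \<Longrightarrow> Ide A a \<in> hom A a a"
    and comp_in: "\<lbrakk>f \<in> hom A a b; g \<in> hom A b c\<rbrakk> \<Longrightarrow> g \<cdot> f \<in> hom A a c"
    and comp_ide_right: "f \<in> hom A a b \<Longrightarrow> f \<cdot> Ide A a = f"
    and comp_ide_left: "f \<in> hom A a b \<Longrightarrow> Ide A b \<cdot> f = f"
    and comp_assoc: "\<lbrakk>f \<in> hom A a b; g \<in> hom A b c; h \<in> hom A c d\<rbrakk>
      \<Longrightarrow> (h \<cdot> g) \<cdot> f = h \<cdot> (g \<cdot> f)"

definition is_iso :: "('o, 'a) cat \<Rightarrow> 'a \<Rightarrow> bool" where
  "is_iso A f \<longleftrightarrow> f \<in> Arr A \<and>
     (\<exists>g \<in> hom A (Cod A f) (Dom A f).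
        g \<cdot>\<^bsub>A\<^esub> f = Ide A (Dom A f) \<and> f \<cdot>\<^bsub>A\<^esub> g = Ide A (Cod A f))"

definition is_terminal :: "('o, 'a) cat \<Rightarrow> 'o \<Rightarrow> bool" where
  "is_terminal A t \<longleftrightarrow> t \<in> Obj A \<and> (\<forall>a \<in> Obj A. \<exists>!h. h \<in> hom A a t)"

definition the_arrow :: "('o, 'a) cat \<Rightarrow> 'o \<Rightarrow> 'o \<Rightarrow> 'a" where
  "the_arrow A a t = (THE h. h \<in> hom A a t)"

record ('o, 'a, 'p, 'b) fctr =
  onO :: "'o \<Rightarrow> 'p"
  onA :: "'a \<Rightarrow> 'b"

definition is_functor ::
  "('o, 'a) cat \<Rightarrow> ('p, 'b) cat \<Rightarrow> ('o, 'a, 'p, 'b) fctr \<Rightarrow> bool" where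
  "is_functor A B F \<longleftrightarrow> category A \<and> category B \<and>
     (\<forall>a \<in> Obj A. onO F a \<in> Obj B) \<and>
     (\<forall>a b. \<forall>f \<in> hom A a b. onA F f \<in> hom B (onO F a) (onO F b)) \<and>
     (\<forall>a \<in> Obj A. onA F (Ide A a) = Ide B (onO F a)) \<and>
     (\<forall>a b c. \<forall>f \<in> hom A a b. \<forall>g \<in> hom A b c.
        onA F (g \<cdot>\<^bsub>A\<^esub> f) = onA F g \<cdot>\<^bsub>B\<^esub> onA F f)"

definition fid :: "('o, 'a, 'o, 'a) fctr" where
  "fid = \<lparr>onO = (\<lambda>a. a), onA = (\<lambda>f. f)\<rparr>"

definition fcomp ::
  "('p, 'b, 'q, 'c) fctr \<Rightarrow> ('o, 'a, 'p, 'b) fctr \<Rightarrow> ('o, 'a, 'q, 'c) fctr"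
  (infixr "\<odot>" 75) where
  "G \<odot> F = \<lparr>onO = (\<lambda>a. onO G (onO F a)), onA = (\<lambda>f. onA G (onA F f))\<rparr>"

definition fully_faithful ::
  "('o, 'a) cat \<Rightarrow> ('p, 'b) cat \<Rightarrow> ('o, 'a, 'p, 'b) fctr \<Rightarrow> bool" where
  "fully_faithful A B F \<longleftrightarrow>
     (\<forall>a \<in> Obj A. \<forall>b \<in> Obj A. bij_betw (onA F) (hom A a b) (hom B (onO F a) (onO F b)))"

definition nat_transf ::
  "('o, 'a) cat \<Rightarrow> ('p, 'b) cat \<Rightarrow> ('o, 'a, 'p, 'b) fctr \<Rightarrow> ('o, 'a, 'p, 'b) fctr
     \<Rightarrow> ('o \<Rightarrow> 'b) \<Rightarrow> bool" where
  "nat_transf A B F G \<tau> \<longleftrightarrow> is_functor A B F \<and> is_functor A B G \<and>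
     (\<forall>a \<in> Obj A. \<tau> a \<in> hom B (onO F a) (onO G a)) \<and>
     (\<forall>a b. \<forall>f \<in> hom A a b. \<tau> b \<cdot>\<^bsub>B\<^esub> onA F f = onA G f \<cdot>\<^bsub>B\<^esub> \<tau> a)"

definition nat_iso ::
  "('o, 'a) cat \<Rightarrow> ('p, 'b) cat \<Rightarrow> ('o, 'a, 'p, 'b) fctr \<Rightarrow> ('o, 'a, 'p, 'b) fctr
     \<Rightarrow> ('o \<Rightarrow> 'b) \<Rightarrow> bool" where
  "nat_iso A B F G \<tau> \<longleftrightarrow> nat_transf A B F G \<tau> \<and> (\<forall>a \<in> Obj A. is_iso B (\<tau> a))"

definition naturally_isomorphic ::
  "('o, 'a) cat \<Rightarrow> ('p, 'b) cat \<Rightarrow> ('o, 'a, 'p, 'b) fctr \<Rightarrow> ('o, 'a, 'p, 'b) fctr \<Rightarrow> bool" where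
  "naturally_isomorphic A B F G \<longleftrightarrow> (\<exists>\<tau>. nat_iso A B F G \<tau>)"

definition adjunction ::
  "('o, 'a) cat \<Rightarrow> ('p, 'b) cat \<Rightarrow> ('o, 'a, 'p, 'b) fctr \<Rightarrow> ('p, 'b, 'o, 'a) fctr
     \<Rightarrow> ('o \<Rightarrow> 'a) \<Rightarrow> ('p \<Rightarrow> 'b) \<Rightarrow> bool" where
  "adjunction A B F G \<eta> \<epsilon> \<longleftrightarrow> is_functor A B F \<and> is_functor B A G \<and>
     nat_transf A A fid (G \<odot> F) \<eta> \<and> nat_transf B B (F \<odot> G) fid \<epsilon> \<and>
     (\<forall>a \<in> Obj A. \<epsilon> (onO F a) \<cdot>\<^bsub>B\<^esub> onA F (\<eta> a) = Ide B (onO F a)) \<and>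
     (\<forall>b \<in> Obj B. onA G (\<epsilon> b) \<cdot>\<^bsub>A\<^esub> \<eta> (onO G b) = Ide A (onO G b))"

definition adjoint ::
  "('o, 'a) cat \<Rightarrow> ('p, 'b) cat \<Rightarrow> ('o, 'a, 'p, 'b) fctr \<Rightarrow> ('p, 'b, 'o, 'a) fctr \<Rightarrow> bool" where
  "adjoint A B F G \<longleftrightarrow> (\<exists>\<eta> \<epsilon>. adjunction A B F G \<eta> \<epsilon>)"

definition quasi_inverse ::
  "('o, 'a) cat \<Rightarrow> ('p, 'b) cat \<Rightarrow> ('o, 'a, 'p, 'b) fctr \<Rightarrow> ('p, 'b, 'o, 'a) fctr \<Rightarrow> bool" where
  "quasi_inverse A B F G \<longleftrightarrow> is_functor A B F \<and> is_functor B A G \<and>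
     naturally_isomorphic A A (G \<odot> F) fid \<and> naturally_isomorphic B B (F \<odot> G) fid"

definition is_equivalence ::
  "('o, 'a) cat \<Rightarrow> ('p, 'b) cat \<Rightarrow> ('o, 'a, 'p, 'b) fctr \<Rightarrow> bool" where
  "is_equivalence A B F \<longleftrightarrow> (\<exists>G. quasi_inverse A B F G)"

text \<open>The slice over \<open>X\<close>: an object is an arrow \<open>f\<close> with codomain \<open>X\<close>, and an arrow
  \<open>(f, h, g)\<close> from \<open>f\<close> to \<open>g\<close> is a map \<open>h\<close> with \<open>g h = f\<close>.\<close>

definition slice :: "('x, 'c) cat \<Rightarrow> 'x \<Rightarrow> ('c, 'c \<times> 'c \<times> 'c) cat" where
  "slice C X =
     \<lparr>Obj = {f \<in> Arr C. Cod C f = X},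
      Arr = {(f, h, g). f \<in> Arr C \<and> Cod C f = X \<and> g \<in> Arr C \<and> Cod C g = X \<and>
               h \<in> hom C (Dom C f) (Dom C g) \<and> g \<cdot>\<^bsub>C\<^esub> h = f},
      Dom = (\<lambda>(f, h, g). f),
      Cod = (\<lambda>(f, h, g). g),
      Ide = (\<lambda>f. (f, Ide C (Dom C f), f)),
      Comp = (\<lambda>(f', k, g') (f, h, g). (f, k \<cdot>\<^bsub>C\<^esub> h, g'))\<rparr>"

text \<open>The pseudo-pullback (iso-comma category) of \<open>F : A \<rightarrow> P\<close> and \<open>G : B \<rightarrow> P\<close>: an object is a
  triple \<open>(a, b, \<phi>)\<close> with \<open>\<phi> : F a \<cong> G b\<close> in \<open>P\<close>, and an arrow is a pair \<open>(u, v)\<close> compatible with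
  the isomorphisms, recorded together with its domain and codomain.\<close>

definition pseudo_pullback ::
  "('o, 'a) cat \<Rightarrow> ('p, 'b) cat \<Rightarrow> ('q, 'c) cat
     \<Rightarrow> ('o, 'a, 'q, 'c) fctr \<Rightarrow> ('p, 'b, 'q, 'c) fctr
     \<Rightarrow> ('o \<times> 'p \<times> 'c, ('o \<times> 'p \<times> 'c) \<times> ('a \<times> 'b) \<times> ('o \<times> 'p \<times> 'c)) cat" where
  "pseudo_pullback A B P F G =
     (let Ob = {(a, b, \<phi>). a \<in> Obj A \<and> b \<in> Obj B \<and>
                  \<phi> \<in> hom P (onO F a) (onO G b) \<and> is_iso P \<phi>}
      in \<lparr>Obj = Ob,
          Arr = {((a, b, \<phi>), (u, v), (a', b', \<phi>')) | a b \<phi> u v a' b' \<phi>'.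
                   (a, b, \<phi>) \<in> Ob \<and> (a', b', \<phi>') \<in> Ob \<and>
                   u \<in> hom A a a' \<and> v \<in> hom B b b' \<and>
                   \<phi>' \<cdot>\<^bsub>P\<^esub> onA F u = onA G v \<cdot>\<^bsub>P\<^esub> \<phi>},
          Dom = (\<lambda>(s, w, t). s),
          Cod = (\<lambda>(s, w, t). t),
          Ide = (\<lambda>(a, b, \<phi>). ((a, b, \<phi>), (Ide A a, Ide B b), (a, b, \<phi>))),
          Comp = (\<lambda>(s', (u', v'), t') (s, (u, v), t).
                    (s, (u' \<cdot>\<^bsub>A\<^esub> u, v' \<cdot>\<^bsub>B\<^esub> v), t'))\<rparr>)"

definition pb_proj1 ::
  "('o \<times> 'p \<times> 'c, ('o \<times> 'p \<times> 'c) \<times> ('a \<times> 'b) \<times> ('o \<times> 'p \<times> 'c), 'o, 'a) fctr" where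
  "pb_proj1 = \<lparr>onO = (\<lambda>(a, b, \<phi>). a), onA = (\<lambda>(s, (u, v), t). u)\<rparr>"

definition pb_proj2 ::
  "('o \<times> 'p \<times> 'c, ('o \<times> 'p \<times> 'c) \<times> ('a \<times> 'b) \<times> ('o \<times> 'p \<times> 'c), 'p, 'b) fctr" where
  "pb_proj2 = \<lparr>onO = (\<lambda>(a, b, \<phi>). b), onA = (\<lambda>(s, (u, v), t). v)\<rparr>"


section \<open>Cartesian closed categories\<close>

text \<open>Chosen structure: \<open>xpn K a b\<close> is the exponential \<open>a \<Rightarrow> b\<close>, with evaluation
  \<open>evl K a b : (a \<Rightarrow> b) \<times> a \<rightarrow> b\<close>.\<close>

record ('o, 'a) ccc =
  trm :: "'o"
  prd :: "'o \<Rightarrow> 'o \<Rightarrow> 'o"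
  prj1 :: "'o \<Rightarrow> 'o \<Rightarrow> 'a"
  prj2 :: "'o \<Rightarrow> 'o \<Rightarrow> 'a"
  xpn :: "'o \<Rightarrow> 'o \<Rightarrow> 'o"
  evl :: "'o \<Rightarrow> 'o \<Rightarrow> 'a"

definition tuple :: "('o, 'a) cat \<Rightarrow> ('o, 'a) ccc \<Rightarrow> 'a \<Rightarrow> 'a \<Rightarrow> 'a" where
  "tuple A K u v =
     (THE h. h \<in> hom A (Dom A u) (prd K (Cod A u) (Cod A v)) \<and>
             prj1 K (Cod A u) (Cod A v) \<cdot>\<^bsub>A\<^esub> h = u \<and> prj2 K (Cod A u) (Cod A v) \<cdot>\<^bsub>A\<^esub> h = v)"

definition prd_arr :: "('o, 'a) cat \<Rightarrow> ('o, 'a) ccc \<Rightarrow> 'a \<Rightarrow> 'a \<Rightarrow> 'a" where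
  "prd_arr A K u v =
     tuple A K (u \<cdot>\<^bsub>A\<^esub> prj1 K (Dom A u) (Dom A v)) (v \<cdot>\<^bsub>A\<^esub> prj2 K (Dom A u) (Dom A v))"

locale cartesian_closed = category A
  for A :: "('o, 'a) cat" (structure) +
  fixes K :: "('o, 'a) ccc"
  assumes trm_terminal: "is_terminal A (trm K)"
    and prd_in: "\<lbrakk>a \<in> Obj A; b \<in> Obj A\<rbrakk> \<Longrightarrow> prd K a b \<in> Obj A"
    and prj1_in: "\<lbrakk>a \<in> Obj A; b \<in> Obj A\<rbrakk> \<Longrightarrow> prj1 K a b \<in> hom A (prd K a b) a"
    and prj2_in: "\<lbrakk>a \<in> Obj A; b \<in> Obj A\<rbrakk> \<Longrightarrow> prj2 K a b \<in> hom A (prd K a b) b"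
    and prd_universal: "\<lbrakk>u \<in> hom A c a; v \<in> hom A c b\<rbrakk>
      \<Longrightarrow> \<exists>!h. h \<in> hom A c (prd K a b) \<and> prj1 K a b \<cdot> h = u \<and> prj2 K a b \<cdot> h = v"
    and xpn_in: "\<lbrakk>a \<in> Obj A; b \<in> Obj A\<rbrakk> \<Longrightarrow> xpn K a b \<in> Obj A"
    and evl_in: "\<lbrakk>a \<in> Obj A; b \<in> Obj A\<rbrakk> \<Longrightarrow> evl K a b \<in> hom A (prd K (xpn K a b) a) b"
    and xpn_universal: "\<lbrakk>a \<in> Obj A; b \<in> Obj A; c \<in> Obj A; g \<in> hom A (prd K c a) b\<rbrakk>
      \<Longrightarrow> \<exists>!h. h \<in> hom A c (xpn K a b) \<and> evl K a b \<cdot> prd_arr A K h (Ide A a) = g"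

text \<open>The functors \<open>a \<times> (-)\<close>, \<open>(-) \<times> b\<close> and \<open>a \<Rightarrow> (-)\<close>.\<close>

definition prd_left :: "('o, 'a) cat \<Rightarrow> ('o, 'a) ccc \<Rightarrow> 'o \<Rightarrow> ('o, 'a, 'o, 'a) fctr" where
  "prd_left A K a = \<lparr>onO = (\<lambda>b. prd K a b), onA = (\<lambda>v. prd_arr A K (Ide A a) v)\<rparr>"

definition prd_right :: "('o, 'a) cat \<Rightarrow> ('o, 'a) ccc \<Rightarrow> 'o \<Rightarrow> ('o, 'a, 'o, 'a) fctr" where
  "prd_right A K b = \<lparr>onO = (\<lambda>a. prd K a b), onA = (\<lambda>u. prd_arr A K u (Ide A b))\<rparr>"

definition xpn_from :: "('o, 'a) cat \<Rightarrow> ('o, 'a) ccc \<Rightarrow> 'o \<Rightarrow> ('o, 'a, 'o, 'a) fctr" where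
  "xpn_from A K a =
     \<lparr>onO = (\<lambda>b. xpn K a b),
      onA = (\<lambda>v. THE h. h \<in> hom A (xpn K a (Dom A v)) (xpn K a (Cod A v)) \<and>
                    evl K a (Cod A v) \<cdot>\<^bsub>A\<^esub> prd_arr A K h (Ide A a)
                      = v \<cdot>\<^bsub>A\<^esub> evl K a (Dom A v))\<rparr>"


section \<open>Indexed categories\<close>

text \<open>A \<open>C\<close>-indexed category \<open>E\<close> is a pseudofunctor from the opposite of \<open>C\<close> to categories:
  \<open>Sub E f\<close> is substitution \<open>f\<^sup>*\<close> along \<open>f\<close>, and the comparison isomorphisms are
  \<open>UnitI E X a : a \<rightarrow> (id\<^sub>X)\<^sup>* a\<close> and
  \<open>CompI E f g a : f\<^sup>* (g\<^sup>* a) \<rightarrow> (g f)\<^sup>* a\<close>.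
  That all fibres share one type of objects and one type of arrows is no restriction, since
  their carriers are arbitrary subsets.\<close>

record ('x, 'c, 'o, 'a) icat =
  Fib :: "'x \<Rightarrow> ('o, 'a) cat"
  Sub :: "'c \<Rightarrow> ('o, 'a, 'o, 'a) fctr"
  UnitI :: "'x \<Rightarrow> 'o \<Rightarrow> 'a"
  CompI :: "'c \<Rightarrow> 'c \<Rightarrow> 'o \<Rightarrow> 'a"

locale indexed_category = category C
  for C :: "('x, 'c) cat" (structure) +
  fixes E :: "('x, 'c, 'o, 'a) icat"
  assumes fib_category: "X \<in> Obj C \<Longrightarrow> category (Fib E X)"
    and sub_functor: "f \<in> hom C X Y \<Longrightarrow> is_functor (Fib E Y) (Fib E X) (Sub E f)"
    and unit_iso: "X \<in> Obj C
      \<Longrightarrow> nat_iso (Fib E X) (Fib E X) fid (Sub E (Ide C X)) (UnitI E X)"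
    and comp_iso: "\<lbrakk>f \<in> hom C X Y; g \<in> hom C Y Z\<rbrakk>
      \<Longrightarrow> nat_iso (Fib E Z) (Fib E X) (Sub E f \<odot> Sub E g) (Sub E (g \<cdot> f)) (CompI E f g)"
    and coherence_unit_left: "\<lbrakk>f \<in> hom C X Y; a \<in> Obj (Fib E Y)\<rbrakk>
      \<Longrightarrow> CompI E (Ide C X) f a \<cdot>\<^bsub>Fib E X\<^esub> UnitI E X (onO (Sub E f) a)
          = Ide (Fib E X) (onO (Sub E f) a)"
    and coherence_unit_right: "\<lbrakk>f \<in> hom C X Y; a \<in> Obj (Fib E Y)\<rbrakk>
      \<Longrightarrow> CompI E f (Ide C Y) a \<cdot>\<^bsub>Fib E X\<^esub> onA (Sub E f) (UnitI E Y a)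
          = Ide (Fib E X) (onO (Sub E f) a)"
    and coherence_assoc: "\<lbrakk>f \<in> hom C W X; g \<in> hom C X Y; h \<in> hom C Y Z; a \<in> Obj (Fib E Z)\<rbrakk>
      \<Longrightarrow> CompI E (g \<cdot> f) h a \<cdot>\<^bsub>Fib E W\<^esub> CompI E f g (onO (Sub E h) a)
          = CompI E f (h \<cdot> g) a \<cdot>\<^bsub>Fib E W\<^esub> onA (Sub E f) (CompI E g h a)"

text \<open>An indexed functor \<open>J : E \<rightarrow> E'\<close> consists of functors \<open>IFun J X\<close> on the fibres and isomorphisms
  \<open>IIso J f a : J\<^sub>X (f\<^sup>* a) \<rightarrow> f\<^sup>* (J\<^sub>Y a)\<close> for \<open>f : X \<rightarrow> Y\<close>.\<close>

record ('x, 'c, 'o, 'a, 'p, 'b) ifun =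
  IFun :: "'x \<Rightarrow> ('o, 'a, 'p, 'b) fctr"
  IIso :: "'c \<Rightarrow> 'o \<Rightarrow> 'b"

locale indexed_functor = source: indexed_category C E + target: indexed_category C E'
  for C :: "('x, 'c) cat" (structure)
    and E :: "('x, 'c, 'o, 'a) icat" and E' :: "('x, 'c, 'p, 'b) icat" +
  fixes J :: "('x, 'c, 'o, 'a, 'p, 'b) ifun"
  assumes fun_functor: "X \<in> Obj C \<Longrightarrow> is_functor (Fib E X) (Fib E' X) (IFun J X)"
    and fun_iso: "f \<in> hom C X Y
      \<Longrightarrow> nat_iso (Fib E Y) (Fib E' X) (IFun J X \<odot> Sub E f) (Sub E' f \<odot> IFun J Y) (IIso J f)"
    and fun_coherence_unit: "\<lbrakk>X \<in> Obj C; a \<in> Obj (Fib E X)\<rbrakk>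
      \<Longrightarrow> IIso J (Ide C X) a \<cdot>\<^bsub>Fib E' X\<^esub> onA (IFun J X) (UnitI E X a)
          = UnitI E' X (onO (IFun J X) a)"
    and fun_coherence_comp: "\<lbrakk>f \<in> hom C X Y; g \<in> hom C Y Z; a \<in> Obj (Fib E Z)\<rbrakk>
      \<Longrightarrow> IIso J (g \<cdot> f) a \<cdot>\<^bsub>Fib E' X\<^esub> onA (IFun J X) (CompI E f g a)
          = CompI E' f g (onO (IFun J Z) a) \<cdot>\<^bsub>Fib E' X\<^esub>
              (onA (Sub E' f) (IIso J g a) \<cdot>\<^bsub>Fib E' X\<^esub> IIso J f (onO (Sub E g) a))"


section \<open>Temporal doctrines\<close>

text \<open>Adjoints are part of the data as chosen functors. Units and counits are part of the data
  only where an axiom refers to them.\<close>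

record ('x, 'c, 'mo, 'ma, 'po, 'pa, 'no, 'na) doctrine =
  base :: "('x, 'c) cat"
  one :: "'x"
  pcat :: "('x, 'c, 'po, 'pa) icat"
  mcat :: "('x, 'c, 'mo, 'ma) icat"
  mcat' :: "('x, 'c, 'no, 'na) icat"
  incl :: "('x, 'c, 'mo, 'ma, 'po, 'pa) ifun"
  incl' :: "('x, 'c, 'no, 'na, 'po, 'pa) ifun"
  pccc :: "'x \<Rightarrow> ('po, 'pa) ccc"
  Sig :: "'c \<Rightarrow> ('po, 'pa, 'po, 'pa) fctr"
  SigUnit :: "'c \<Rightarrow> 'po \<Rightarrow> 'pa"
  SigCounit :: "'c \<Rightarrow> 'po \<Rightarrow> 'pa"
  Pi :: "'c \<Rightarrow> ('po, 'pa, 'po, 'pa) fctr"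
  Dia :: "'x \<Rightarrow> ('po, 'pa, 'mo, 'ma) fctr"
  DiaUnit :: "'x \<Rightarrow> 'po \<Rightarrow> 'pa"
  DiaCounit :: "'x \<Rightarrow> 'mo \<Rightarrow> 'ma"
  Box :: "'x \<Rightarrow> ('po, 'pa, 'mo, 'ma) fctr"
  Dia' :: "'x \<Rightarrow> ('po, 'pa, 'no, 'na) fctr"
  DiaUnit' :: "'x \<Rightarrow> 'po \<Rightarrow> 'pa"
  DiaCounit' :: "'x \<Rightarrow> 'no \<Rightarrow> 'na"
  Box' :: "'x \<Rightarrow> ('po, 'pa, 'no, 'na) fctr"
  Ext :: "'x \<Rightarrow> ('po, 'pa, 'c, 'c \<times> 'c \<times> 'c) fctr"

abbreviation "PX D X \<equiv> Fib (pcat D) X"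
abbreviation "MX D X \<equiv> Fib (mcat D) X"
abbreviation "MX' D X \<equiv> Fib (mcat' D) X"
abbreviation "ii D X \<equiv> IFun (incl D) X"
abbreviation "ii' D X \<equiv> IFun (incl' D) X"
abbreviation "subP D f \<equiv> Sub (pcat D) f"
abbreviation "subM D f \<equiv> Sub (mcat D) f"
abbreviation "subM' D f \<equiv> Sub (mcat' D) f"

definition BX where
  "BX D X = pseudo_pullback (MX D X) (MX' D X) (PX D X) (ii D X) (ii' D X)"

definition jj ::
  "('x, 'c, 'mo, 'ma, 'po, 'pa, 'no, 'na) doctrine \<Rightarrow> 'x \<Rightarrow>
   ('mo \<times> 'no \<times> 'pa, ('mo \<times> 'no \<times> 'pa) \<times> ('ma \<times> 'na) \<times> ('mo \<times> 'no \<times> 'pa), 'mo, 'ma) fctr" where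
  "jj D X = pb_proj1"

definition jj' ::
  "('x, 'c, 'mo, 'ma, 'po, 'pa, 'no, 'na) doctrine \<Rightarrow> 'x \<Rightarrow>
   ('mo \<times> 'no \<times> 'pa, ('mo \<times> 'no \<times> 'pa) \<times> ('ma \<times> 'na) \<times> ('mo \<times> 'no \<times> 'pa), 'no, 'na) fctr" where
  "jj' D X = pb_proj2"

text \<open>\<open>i j\<close> and \<open>i' j'\<close> agree only up to the isomorphism that is part of an object of \<open>BX D X\<close>.\<close>

definition bb where
  "bb D X = ii D X \<odot> jj D X"

text \<open>The canonical functor from \<open>C/X\<close> to \<open>P X\<close>. Let \<open>h : f \<rightarrow> g\<close> in \<open>C/X\<close>, where
  \<open>f : T \<rightarrow> X\<close> and \<open>g : S \<rightarrow> X\<close>. The image of \<open>h\<close> corresponds under \<open>\<Sigma>\<^sub>f \<stileturn> f\<^sup>*\<close> to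
  \<open>1\<^sub>T \<cong> h\<^sup>* 1\<^sub>S \<rightarrow> h\<^sup>* g\<^sup>* \<Sigma>\<^sub>g 1\<^sub>S \<cong> f\<^sup>* \<Sigma>\<^sub>g 1\<^sub>S\<close>, the middle map
  being \<open>h\<^sup>*\<close> of the unit of \<open>\<Sigma>\<^sub>g \<stileturn> g\<^sup>*\<close>. Substitution, being a right adjoint, preserves
  terminal objects, so the first map is the only one of its type.\<close>

definition compr ::
  "('x, 'c, 'mo, 'ma, 'po, 'pa, 'no, 'na) doctrine \<Rightarrow> 'x
     \<Rightarrow> ('c, 'c \<times> 'c \<times> 'c, 'po, 'pa) fctr" where
  "compr D X =
     \<lparr>onO = (\<lambda>f. onO (Sig D f) (trm (pccc D (Dom (base D) f)))),
      onA = (\<lambda>(f, h, g).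
        let T = Dom (base D) f; S = Dom (base D) g;
            oneT = trm (pccc D T); oneS = trm (pccc D S);
            w = onO (Sig D g) oneS
        in SigCounit D f w \<cdot>\<^bsub>PX D X\<^esub>
             onA (Sig D f)
               (CompI (pcat D) h g w \<cdot>\<^bsub>PX D T\<^esub>
                 (onA (subP D h) (SigUnit D g oneS) \<cdot>\<^bsub>PX D T\<^esub>
                   the_arrow (PX D T) oneT (onO (subP D h) oneS))))\<rparr>"

text \<open>The canonical map \<open>\<Sigma>\<^sub>f (P \<times> f\<^sup>* Q) \<rightarrow> \<Sigma>\<^sub>f P \<times> Q\<close>, for \<open>f : X \<rightarrow> Y\<close>.\<close>

definition frobenius ::
  "('x, 'c, 'mo, 'ma, 'po, 'pa, 'no, 'na) doctrine \<Rightarrow> 'c \<Rightarrow> 'po \<Rightarrow> 'po \<Rightarrow> 'pa" where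
  "frobenius D f P Q =
     (let X = Dom (base D) f; Y = Cod (base D) f; R = onO (subP D f) Q
      in tuple (PX D Y) (pccc D Y)
           (onA (Sig D f) (prj1 (pccc D X) P R))
           (SigCounit D f Q \<cdot>\<^bsub>PX D Y\<^esub> onA (Sig D f) (prj2 (pccc D X) P R)))"

locale temporal_doctrine =
  fixes D :: "('x, 'c, 'mo, 'ma, 'po, 'pa, 'no, 'na) doctrine"
  assumes base_category: "category (base D)"
    and P_indexed: "indexed_category (base D) (pcat D)"
    and M_indexed: "indexed_category (base D) (mcat D)"
    and M'_indexed: "indexed_category (base D) (mcat' D)"
    and i_indexed: "indexed_functor (base D) (mcat D) (pcat D) (incl D)"
    and i'_indexed: "indexed_functor (base D) (mcat' D) (pcat D) (incl' D)"
    and one_terminal: "is_terminal (base D) (one D)"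
    and P_cartesian_closed: "X \<in> Obj (base D) \<Longrightarrow> cartesian_closed (PX D X) (pccc D X)"
    and Sig_adjunction: "f \<in> hom (base D) X Y
      \<Longrightarrow> adjunction (PX D X) (PX D Y) (Sig D f) (subP D f) (SigUnit D f) (SigCounit D f)"
    and Pi_adjoint: "f \<in> hom (base D) X Y
      \<Longrightarrow> adjoint (PX D Y) (PX D X) (subP D f) (Pi D f)"
    and Dia_adjunction: "X \<in> Obj (base D)
      \<Longrightarrow> adjunction (PX D X) (MX D X) (Dia D X) (ii D X) (DiaUnit D X) (DiaCounit D X)"
    and Box_adjoint: "X \<in> Obj (base D) \<Longrightarrow> adjoint (MX D X) (PX D X) (ii D X) (Box D X)"
    and Dia'_adjunction: "X \<in> Obj (base D)
      \<Longrightarrow> adjunction (PX D X) (MX' D X) (Dia' D X) (ii' D X) (DiaUnit' D X) (DiaCounit' D X)"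
    and Box'_adjoint: "X \<in> Obj (base D) \<Longrightarrow> adjoint (MX' D X) (PX D X) (ii' D X) (Box' D X)"
    and comprehension: "X \<in> Obj (base D)
      \<Longrightarrow> adjoint (slice (base D) X) (PX D X) (compr D X) (Ext D X)"
    and i_fully_faithful: "X \<in> Obj (base D) \<Longrightarrow> fully_faithful (MX D X) (PX D X) (ii D X)"
    and i'_fully_faithful: "X \<in> Obj (base D) \<Longrightarrow> fully_faithful (MX' D X) (PX D X) (ii' D X)"
    and frobenius_law: "\<lbrakk>f \<in> hom (base D) X Y; P \<in> Obj (PX D X); Q \<in> Obj (PX D Y)\<rbrakk>
      \<Longrightarrow> is_iso (PX D Y) (frobenius D f P Q)"
    and mixed_frobenius: "\<lbrakk>X \<in> Obj (base D); P \<in> Obj (PX D X); N \<in> Obj (MX' D X)\<rbrakk>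
      \<Longrightarrow> is_iso (MX D X) (onA (Dia D X)
            (prd_arr (PX D X) (pccc D X) (DiaUnit D X P) (Ide (PX D X) (onO (ii' D X) N))))"
    and mixed_frobenius': "\<lbrakk>X \<in> Obj (base D); P \<in> Obj (PX D X); M \<in> Obj (MX D X)\<rbrakk>
      \<Longrightarrow> is_iso (MX' D X) (onA (Dia' D X)
            (prd_arr (PX D X) (pccc D X) (DiaUnit' D X P) (Ide (PX D X) (onO (ii D X) M))))"
    \<comment> \<open>\<open>j\<close> and \<open>j'\<close> are projections of a pseudo-pullback, for which the meaningful sense of
        isomorphism of categories is equivalence.\<close>
    and j_equivalence: "is_equivalence (BX D (one D)) (MX D (one D)) (jj D (one D))"
    and j'_equivalence: "is_equivalence (BX D (one D)) (MX' D (one D)) (jj' D (one D))"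
    and Ext_fully_faithful: "X \<in> Obj (base D)
      \<Longrightarrow> fully_faithful (PX D X) (slice (base D) X) (Ext D X)"


section \<open>Derived notation\<close>

text \<open>Objects and functors that are determined only up to isomorphism, and that exist in every
  temporal doctrine, are fixed by choice.\<close>

definition jinv where
  "jinv D = (SOME G. quasi_inverse (BX D (one D)) (MX D (one D)) (jj D (one D)) G)"

definition jinv' where
  "jinv' D = (SOME G. quasi_inverse (BX D (one D)) (MX' D (one D)) (jj' D (one D)) G)"

definition top_ob :: "('o, 'a) cat \<Rightarrow> 'o" where
  "top_ob A = (SOME t. is_terminal A t)"

definition existsM where
  "existsM D f = Dia D (Cod (base D) f) \<odot> Sig D f \<odot> ii D (Dom (base D) f)"

definition forallM where
  "forallM D f = Box D (Cod (base D) f) \<odot> Pi D f \<odot> ii D (Dom (base D) f)"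

definition existsM' where
  "existsM' D f = Dia' D (Cod (base D) f) \<odot> Sig D f \<odot> ii' D (Dom (base D) f)"

definition forallM' where
  "forallM' D f = Box' D (Cod (base D) f) \<odot> Pi D f \<odot> ii' D (Dom (base D) f)"

text \<open>\<open>const_sub D X\<close> is \<open>X\<^sup>* b\<^sub>1\<close>, where \<open>X\<close> also denotes the map \<open>X \<rightarrow> 1\<close>.\<close>

definition const_sub where
  "const_sub D X = subP D (the_arrow (base D) X (one D)) \<odot> bb D (one D)"

definition coendf where
  "coendf D X = (SOME L. adjoint (PX D X) (BX D (one D)) L (const_sub D X))"

definition endf where
  "endf D X = (SOME R. adjoint (BX D (one D)) (PX D X) (const_sub D X) R)"

text \<open>The bifunctors \<open>meets\<close>, \<open>hom\<close>, \<open>ten\<close>, \<open>nat\<close> and \<open>nat'\<close> with one argument fixed: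
  \<open>meets_left D X P\<close> is \<open>meets\<^sub>X(P, -)\<close>, and \<open>meets_right D X Q\<close> is \<open>meets\<^sub>X(-, Q)\<close>;
  likewise for \<open>ten\<close>.\<close>

definition meets_left where
  "meets_left D X P = coendf D X \<odot> prd_left (PX D X) (pccc D X) P"

definition meets_right where
  "meets_right D X Q = coendf D X \<odot> prd_right (PX D X) (pccc D X) Q"

definition hom_from where
  "hom_from D X P = endf D X \<odot> xpn_from (PX D X) (pccc D X) P"

definition ten_left where
  "ten_left D X N = meets_left D X (onO (ii' D X) N) \<odot> ii D X"

definition ten_right where
  "ten_right D X M = meets_right D X (onO (ii D X) M) \<odot> ii' D X"

definition nat_from where
  "nat_from D X L = hom_from D X (onO (ii D X) L) \<odot> ii D X"

definition nat_from' where
  "nat_from' D X N = hom_from D X (onO (ii' D X) N) \<odot> ii' D X"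

text \<open>The slices \<open>X/x\<close> and \<open>x\X\<close> of a point \<open>x : 1 \<rightarrow> X\<close>.\<close>

definition left_slice where
  "left_slice D x = onO (existsM D x) (top_ob (MX D (one D)))"

definition right_slice where
  "right_slice D x = onO (existsM' D x) (top_ob (MX' D (one D)))"

end

theory Submission
  imports Defs
begin

text \<open>
  Both sides of each isomorphism are, up to composition with one and the same functor, adjoints, so
  that it suffices to compare functors on the other side. For instance
  \<open>j\<^sub>1\<^sup>-\<^sup>1 (x \<cdot> \<box>\<^sub>X -)\<close> and \<open>hom\<^sub>X(X/x, -)\<close> are right adjoint to
  \<open>\<diamond>\<^sub>X \<Sigma>\<^sub>x b\<^sub>1\<close> and to \<open>X\<^sup>* b\<^sub>1 \<times> X/x\<close> respectively. The latter two agree: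
  \<open>\<Sigma>\<^sub>x b\<^sub>1 \<cong> \<Sigma>\<^sub>x 1 \<times> X\<^sup>* b\<^sub>1\<close> by the Frobenius law and \<open>x\<^sup>* X\<^sup>* \<cong> id\<close>; since
  \<open>X\<^sup>* b\<^sub>1\<close> factors through \<open>i'\<^sub>X\<close>, the mixed Frobenius law allows to replace \<open>\<Sigma>\<^sub>x 1\<close> by
  its reflection \<open>X/x\<close> under \<open>\<diamond>\<^sub>X\<close>; and since \<open>X\<^sup>* b\<^sub>1\<close> factors through \<open>i\<^sub>X\<close> too, the
  resulting product already lies in the reflective subcategory.

  For \<open>\<diamond>\<^sub>X\<close>, the two factorizations show that \<open>coend\<^sub>X\<close> inverts whatever \<open>\<diamond>\<^sub>X\<close> or
  \<open>\<diamond>'\<^sub>X\<close> inverts. By the mixed Frobenius laws, \<open>coend\<^sub>X(x\X \<times> P)\<close> then becomes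
  \<open>coend\<^sub>X(\<Sigma>\<^sub>x 1 \<times> \<diamond>\<^sub>X P)\<close>, that is, \<open>coend\<^sub>X(\<Sigma>\<^sub>x (x \<cdot> \<diamond>\<^sub>X P))\<close>, and
  \<open>coend\<^sub>X \<Sigma>\<^sub>x i\<^sub>1\<close> is left adjoint to \<open>j\<^sub>1\<close>. The quantifiers along \<open>f : X \<rightarrow> Y\<close> are
  obtained from the modalities of \<open>Y\<close> by the Frobenius law and the preservation of products by
  \<open>f\<^sup>*\<close>.
\<close>

section \<open>Natural isomorphisms\<close>

text \<open>What shapes the proof is the wish to avoid diagram chases with the coherence
  isomorphisms of three pseudofunctors and of a pseudo-pullback. The results assert that a natural
  isomorphism exists, and it is produced in two ways: by replacing one factor in a string of
  functors, or by uniqueness of adjoints, which is the Yoneda lemma. Explicit arrows are examined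
  only for products, for the Frobenius map and for the units in the mixed laws, whose naturality has
  to be checked before they can be used inside such a string. Truth values need care. The functor
  b_1 is i_1 j_1 by definition, but agrees with i'_1 j'_1 only up to the isomorphism stored in the
  objects of the pullback. Moreover j_1 has a quasi-inverse, not an inverse; being an equivalence,
  it has that functor as adjoint on both sides, which is why the same functor can accompany the
  right adjoints (box, forall) and the left adjoints (diamond, exists). Finally
  \<open>coendf\<close> and \<open>endf\<close> are arbitrary choices, so the formulas are proved
  for any left or right adjoint of X^* b_1.\<close>

lemma hom_iff: "f \<in> hom A a b \<longleftrightarrow> f \<in> Arr A \<and> Dom A f = a \<and> Cod A f = b"
  by (simp add: hom_def)

section \<open>Simplification rules for arrows and isomorphisms\<close>

context category
begin

lemma in_hom: "f \<in> Arr A \<Longrightarrow> f \<in> hom A (Dom A f) (Cod A f)"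
  by (simp add: hom_iff)

text \<open>Typing is phrased with \<open>Arr\<close>, \<open>Dom\<close> and \<open>Cod\<close>
  instead of \<open>hom\<close>: the side conditions are then equations that the simplifier can
  discharge without guessing an intermediate object. Unfolding \<open>hom_iff\<close> passes from
  one form to the other.\<close>

lemma comp_simps [simp]:
  assumes "f \<in> Arr A" "g \<in> Arr A" "Dom A g = Cod A f"
  shows "g \<cdot> f \<in> Arr A" "Dom A (g \<cdot> f) = Dom A f" "Cod A (g \<cdot> f) = Cod A g"
  using comp_in[of f "Dom A f" "Cod A f" g "Cod A g"] assms by (simp_all add: hom_iff)

lemma ide_simps [simp]:
  assumes "a \<in> Obj A"
  shows "Ide A a \<in> Arr A" "Dom A (Ide A a) = a" "Cod A (Ide A a) = a"
  using ide_in[OF assms] by (simp_all add: hom_iff)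

lemma unit_simps [simp]:
  assumes "f \<in> Arr A"
  shows "Dom A f = a \<Longrightarrow> f \<cdot> Ide A a = f" "Cod A f = b \<Longrightarrow> Ide A b \<cdot> f = f"
  using comp_ide_right[OF in_hom[OF assms]] comp_ide_left[OF in_hom[OF assms]] by auto

lemma assoc [simp]:
  assumes "f \<in> Arr A" "g \<in> Arr A" "h \<in> Arr A" "Dom A g = Cod A f" "Dom A h = Cod A g"
  shows "(h \<cdot> g) \<cdot> f = h \<cdot> (g \<cdot> f)"
  using comp_assoc[of f "Dom A f" "Cod A f" g "Cod A g" h "Cod A h"] assms by (simp add: hom_iff)

declare dom_in [simp] cod_in [simp]

lemma hom_obj: "f \<in> hom A a b \<Longrightarrow> a \<in> Obj A" "f \<in> hom A a b \<Longrightarrow> b \<in> Obj A"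
  by (auto simp: hom_iff)

lemma isoI:
  assumes "f \<in> hom A a b" "g \<in> hom A b a" "g \<cdot> f = Ide A a" "f \<cdot> g = Ide A b"
  shows "is_iso A f"
  using assms by (auto simp: is_iso_def hom_iff)

lemma isoE:
  assumes "is_iso A f" "f \<in> hom A a b"
  obtains g where "g \<in> hom A b a" "g \<cdot> f = Ide A a" "f \<cdot> g = Ide A b"
  using assms by (auto simp: is_iso_def hom_iff)

lemma iso_ide: "a \<in> Obj A \<Longrightarrow> is_iso A (Ide A a)"
  by (rule isoI[of _ a a "Ide A a"]) (auto simp: hom_iff)

lemma iso_comp:
  assumes "is_iso A f" "is_iso A g" "f \<in> hom A a b" "g \<in> hom A b c"
  shows "is_iso A (g \<cdot> f)"
proof -
  obtain f' where f': "f' \<in> hom A b a" "f' \<cdot> f = Ide A a" "f \<cdot> f' = Ide A b"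
    using isoE[OF assms(1,3)] .
  obtain g' where g': "g' \<in> hom A c b" "g' \<cdot> g = Ide A b" "g \<cdot> g' = Ide A c"
    using isoE[OF assms(2,4)] .
  have "(f' \<cdot> g') \<cdot> (g \<cdot> f) = f' \<cdot> ((g' \<cdot> g) \<cdot> f)" "(g \<cdot> f) \<cdot> (f' \<cdot> g') = g \<cdot> ((f \<cdot> f') \<cdot> g')"
    using assms(3,4) f'(1) g'(1) by (simp_all add: hom_iff)
  then show ?thesis
    using assms(3,4) f' g' by (intro isoI[of _ a c "f' \<cdot> g'"]) (auto simp: hom_iff)
qed

lemma iso_cancel_left:
  assumes "is_iso A f" "f \<in> hom A b c" "u \<in> hom A a b" "v \<in> hom A a b" "f \<cdot> u = f \<cdot> v"
  shows "u = v"
proof -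
  obtain g where g: "g \<in> hom A c b" "g \<cdot> f = Ide A b" using isoE[OF assms(1,2)] .
  have "w = g \<cdot> (f \<cdot> w)" if "w \<in> hom A a b" for w
    using comp_assoc[OF that assms(2) g(1)] comp_ide_left[OF that] g(2) by simp
  then show ?thesis using assms(3-5) by metis
qed

end

section \<open>Functors\<close>

locale fnctr = dom: category A + cod: category B
  for A :: "('o, 'a) cat" and B :: "('p, 'b) cat" and F :: "('o, 'a, 'p, 'b) fctr" +
  assumes fnctr: "is_functor A B F"
begin

lemma obj [simp]: "a \<in> Obj A \<Longrightarrow> onO F a \<in> Obj B"
  using fnctr by (simp add: is_functor_def)

lemma arr [simp]:
  assumes "f \<in> Arr A"
  shows "onA F f \<in> Arr B" "Dom B (onA F f) = onO F (Dom A f)" "Cod B (onA F f) = onO F (Cod A f)"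
proof -
  have "onA F f \<in> hom B (onO F (Dom A f)) (onO F (Cod A f))"
    using fnctr dom.in_hom[OF assms] unfolding is_functor_def by blast
  then show "onA F f \<in> Arr B" "Dom B (onA F f) = onO F (Dom A f)"
      "Cod B (onA F f) = onO F (Cod A f)"
    by (simp_all add: hom_iff)
qed

lemma pres_ide [simp]: "a \<in> Obj A \<Longrightarrow> onA F (Ide A a) = Ide B (onO F a)"
  using fnctr by (simp add: is_functor_def)

lemma pres_comp [simp]:
  assumes "f \<in> Arr A" "g \<in> Arr A" "Dom A g = Cod A f"
  shows "onA F (g \<cdot>\<^bsub>A\<^esub> f) = onA F g \<cdot>\<^bsub>B\<^esub> onA F f"
proof -
  have "f \<in> hom A (Dom A f) (Cod A f)" "g \<in> hom A (Cod A f) (Cod A g)"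
    using assms by (simp_all add: hom_iff)
  then show ?thesis using fnctr unfolding is_functor_def by blast
qed

lemma pres_hom: "f \<in> hom A a b \<Longrightarrow> onA F f \<in> hom B (onO F a) (onO F b)"
  by (auto simp: hom_iff)

lemma pres_iso:
  assumes "is_iso A f"
  shows "is_iso B (onA F f)"
proof -
  have f: "f \<in> hom A (Dom A f) (Cod A f)" using assms by (simp add: is_iso_def hom_iff)
  then obtain g where g: "g \<in> hom A (Cod A f) (Dom A f)"
      "g \<cdot>\<^bsub>A\<^esub> f = Ide A (Dom A f)" "f \<cdot>\<^bsub>A\<^esub> g = Ide A (Cod A f)"
    using assms dom.isoE by metis
  have "onA F g \<cdot>\<^bsub>B\<^esub> onA F f = onA F (g \<cdot>\<^bsub>A\<^esub> f)" "onA F f \<cdot>\<^bsub>B\<^esub> onA F g = onA F (f \<cdot>\<^bsub>A\<^esub> g)"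
    using f g(1) by (auto simp: hom_iff)
  then show ?thesis using f g
    by (intro cod.isoI[OF pres_hom[OF f] pres_hom[OF g(1)]]) (auto simp: hom_iff)
qed

end

lemma is_functor_fnctr: "is_functor A B F \<Longrightarrow> fnctr A B F"
  by (simp add: fnctr_def fnctr_axioms_def is_functor_def)

lemma is_functorI:
  assumes "category A" "category B"
    and "\<And>a. a \<in> Obj A \<Longrightarrow> onO F a \<in> Obj B"
    and "\<And>f. f \<in> Arr A \<Longrightarrow> onA F f \<in> hom B (onO F (Dom A f)) (onO F (Cod A f))"
    and "\<And>a. a \<in> Obj A \<Longrightarrow> onA F (Ide A a) = Ide B (onO F a)"
    and "\<And>f g. f \<in> Arr A \<Longrightarrow> g \<in> Arr A \<Longrightarrow> Dom A g = Cod A f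
           \<Longrightarrow> onA F (g \<cdot>\<^bsub>A\<^esub> f) = onA F g \<cdot>\<^bsub>B\<^esub> onA F f"
  shows "is_functor A B F"
  using assms by (auto simp: is_functor_def hom_iff)

lemma fcomp_simps [simp]:
  "onO (G \<odot> F) a = onO G (onO F a)" "onA (G \<odot> F) f = onA G (onA F f)"
  by (simp_all add: fcomp_def)

lemma fid_simps [simp]: "onO fid a = a" "onA fid f = f"
  by (simp_all add: fid_def)

lemma fcomp_assoc: "(H \<odot> G) \<odot> F = H \<odot> (G \<odot> F)"
  by (simp add: fcomp_def)

lemma fcomp_fid [simp]: "F \<odot> fid = F" "fid \<odot> F = F"
  by (simp_all add: fcomp_def fid_def)

lemma is_functor_fid: "category A \<Longrightarrow> is_functor A A fid"
  by (simp add: is_functor_def fid_def)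

lemma is_functor_fcomp:
  assumes "is_functor A B F" "is_functor B C G"
  shows "is_functor A C (G \<odot> F)"
proof -
  interpret F: fnctr A B F using assms(1) by (rule is_functor_fnctr)
  interpret G: fnctr B C G using assms(2) by (rule is_functor_fnctr)
  show ?thesis
    by (rule is_functorI) (auto simp: hom_iff F.dom.category_axioms G.cod.category_axioms)
qed

section \<open>Natural transformations and the calculus of natural isomorphisms\<close>

locale ntransf = F: fnctr A B F + G: fnctr A B G for A B F G +
  fixes \<tau>
  assumes ntransf: "nat_transf A B F G \<tau>"
begin

lemma comp_hom: "a \<in> Obj A \<Longrightarrow> \<tau> a \<in> hom B (onO F a) (onO G a)"
  using ntransf by (simp add: nat_transf_def)

lemma component [simp]:
  assumes "a \<in> Obj A"
  shows "\<tau> a \<in> Arr B" "Dom B (\<tau> a) = onO F a" "Cod B (\<tau> a) = onO G a"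
  using comp_hom[OF assms] by (auto simp: hom_iff)

lemma naturality:
  "f \<in> hom A a b \<Longrightarrow> \<tau> b \<cdot>\<^bsub>B\<^esub> onA F f = onA G f \<cdot>\<^bsub>B\<^esub> \<tau> a"
  using ntransf by (simp add: nat_transf_def)

end

lemma nat_transf_ntransf: "nat_transf A B F G \<tau> \<Longrightarrow> ntransf A B F G \<tau>"
  by (simp add: ntransf_def ntransf_axioms_def nat_transf_def is_functor_fnctr)

locale niso = ntransf +
  assumes iso: "a \<in> Obj A \<Longrightarrow> is_iso B (\<tau> a)"

lemma naturally_isomorphicI:
  assumes "is_functor A B F" "is_functor A B G"
    and "\<And>a. a \<in> Obj A \<Longrightarrow> \<tau> a \<in> hom B (onO F a) (onO G a)"
    and "\<And>a b f. f \<in> hom A a b \<Longrightarrow> \<tau> b \<cdot>\<^bsub>B\<^esub> onA F f = onA G f \<cdot>\<^bsub>B\<^esub> \<tau> a"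
    and "\<And>a. a \<in> Obj A \<Longrightarrow> is_iso B (\<tau> a)"
  shows "naturally_isomorphic A B F G"
  using assms unfolding naturally_isomorphic_def nat_iso_def nat_transf_def by blast

lemma naturally_isomorphicE:
  assumes "naturally_isomorphic A B F G"
  obtains \<tau> where "niso A B F G \<tau>"
  using assms nat_transf_ntransf
  unfolding naturally_isomorphic_def nat_iso_def niso_def niso_axioms_def by blast

lemma nat_iso_naturally_isomorphic: "nat_iso A B F G \<tau> \<Longrightarrow> naturally_isomorphic A B F G"
  by (auto simp: naturally_isomorphic_def)

lemma natiso_functors:
  assumes "naturally_isomorphic A B F G"
  shows "is_functor A B F" "is_functor A B G"
  using assms unfolding naturally_isomorphic_def nat_iso_def nat_transf_def by auto

lemma natiso_refl: "is_functor A B F \<Longrightarrow> naturally_isomorphic A B F F"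
proof -
  assume F: "is_functor A B F"
  then interpret fnctr A B F by (rule is_functor_fnctr)
  show ?thesis
    by (rule naturally_isomorphicI[OF F F, of "\<lambda>a. Ide B (onO F a)"])
      (auto simp: hom_iff cod.iso_ide)
qed

lemma natiso_sym:
  assumes "naturally_isomorphic A B F G"
  shows "naturally_isomorphic A B G F"
proof -
  obtain \<tau> where "niso A B F G \<tau>"
    using naturally_isomorphicE[OF assms] .
  then interpret niso A B F G \<tau> .
  have "\<exists>s. s \<in> hom B (onO G a) (onO F a) \<and> s \<cdot>\<^bsub>B\<^esub> \<tau> a = Ide B (onO F a)
      \<and> \<tau> a \<cdot>\<^bsub>B\<^esub> s = Ide B (onO G a)" if "a \<in> Obj A" for a
    using F.cod.isoE[OF iso comp_hom] that by metis
  then obtain \<sigma> where \<sigma>: "\<And>a. a \<in> Obj A \<Longrightarrow> \<sigma> a \<in> hom B (onO G a) (onO F a)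
      \<and> \<sigma> a \<cdot>\<^bsub>B\<^esub> \<tau> a = Ide B (onO F a) \<and> \<tau> a \<cdot>\<^bsub>B\<^esub> \<sigma> a = Ide B (onO G a)"
    by metis
  show ?thesis
  proof (rule naturally_isomorphicI[OF G.fnctr F.fnctr, of \<sigma>])
    fix a b f assume f: "f \<in> hom A a b"
    then have ab: "a \<in> Obj A" "b \<in> Obj A" by (auto dest: F.dom.hom_obj)
    note s = \<sigma>[OF ab(1)] \<sigma>[OF ab(2)]
    have "\<sigma> b \<cdot>\<^bsub>B\<^esub> onA G f = \<sigma> b \<cdot>\<^bsub>B\<^esub> (onA G f \<cdot>\<^bsub>B\<^esub> (\<tau> a \<cdot>\<^bsub>B\<^esub> \<sigma> a))"
      using s f ab by (auto simp: hom_iff)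
    also have "\<dots> = \<sigma> b \<cdot>\<^bsub>B\<^esub> ((\<tau> b \<cdot>\<^bsub>B\<^esub> onA F f) \<cdot>\<^bsub>B\<^esub> \<sigma> a)"
      unfolding naturality[OF f] using s f ab by (auto simp: hom_iff)
    also have "\<dots> = (\<sigma> b \<cdot>\<^bsub>B\<^esub> \<tau> b) \<cdot>\<^bsub>B\<^esub> (onA F f \<cdot>\<^bsub>B\<^esub> \<sigma> a)"
      using conjunct1[OF s(1)] conjunct1[OF s(2)] f ab by (auto simp: hom_iff)
    also have "\<dots> = onA F f \<cdot>\<^bsub>B\<^esub> \<sigma> a"
      using s f ab by (auto simp: hom_iff)
    finally show "\<sigma> b \<cdot>\<^bsub>B\<^esub> onA G f = onA F f \<cdot>\<^bsub>B\<^esub> \<sigma> a" .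
  next
    fix a assume "a \<in> Obj A"
    then show "is_iso B (\<sigma> a)" using \<sigma>[of a] F.cod.isoI comp_hom by metis
  qed (use \<sigma> in auto)
qed

lemma natiso_trans [trans]:
  assumes "naturally_isomorphic A B F G" "naturally_isomorphic A B G H"
  shows "naturally_isomorphic A B F H"
proof -
  obtain \<sigma> where "niso A B F G \<sigma>"
    using naturally_isomorphicE[OF assms(1)] .
  then interpret \<sigma>: niso A B F G \<sigma> .
  obtain \<tau> where "niso A B G H \<tau>"
    using naturally_isomorphicE[OF assms(2)] .
  then interpret \<tau>: niso A B G H \<tau> .
  show ?thesis
  proof (rule naturally_isomorphicI[OF \<sigma>.F.fnctr \<tau>.G.fnctr, of "\<lambda>a. \<tau> a \<cdot>\<^bsub>B\<^esub> \<sigma> a"])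
    fix a b f assume f: "f \<in> hom A a b"
    then have ab: "a \<in> Obj A" "b \<in> Obj A" by (auto dest: \<sigma>.F.dom.hom_obj)
    have "(\<tau> b \<cdot>\<^bsub>B\<^esub> \<sigma> b) \<cdot>\<^bsub>B\<^esub> onA F f = \<tau> b \<cdot>\<^bsub>B\<^esub> (\<sigma> b \<cdot>\<^bsub>B\<^esub> onA F f)"
      using f ab by (auto simp: hom_iff)
    also have "\<dots> = (\<tau> b \<cdot>\<^bsub>B\<^esub> onA G f) \<cdot>\<^bsub>B\<^esub> \<sigma> a"
      unfolding \<sigma>.naturality[OF f] using f ab by (auto simp: hom_iff)
    also have "\<dots> = onA H f \<cdot>\<^bsub>B\<^esub> (\<tau> a \<cdot>\<^bsub>B\<^esub> \<sigma> a)"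
      unfolding \<tau>.naturality[OF f] using f ab by (auto simp: hom_iff)
    finally show "(\<tau> b \<cdot>\<^bsub>B\<^esub> \<sigma> b) \<cdot>\<^bsub>B\<^esub> onA F f = onA H f \<cdot>\<^bsub>B\<^esub> (\<tau> a \<cdot>\<^bsub>B\<^esub> \<sigma> a)" .
  next
    fix a assume "a \<in> Obj A"
    then show "is_iso B (\<tau> a \<cdot>\<^bsub>B\<^esub> \<sigma> a)" "\<tau> a \<cdot>\<^bsub>B\<^esub> \<sigma> a \<in> hom B (onO F a) (onO H a)"
      using \<sigma>.F.cod.iso_comp[OF \<sigma>.iso \<tau>.iso \<sigma>.comp_hom \<tau>.comp_hom] by (auto simp: hom_iff)
  qed
qed

lemma natiso_whisker_left:
  assumes "naturally_isomorphic A B F G" "is_functor B C H"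
  shows "naturally_isomorphic A C (H \<odot> F) (H \<odot> G)"
proof -
  obtain \<tau> where "niso A B F G \<tau>"
    using naturally_isomorphicE[OF assms(1)] .
  then interpret niso A B F G \<tau> .
  interpret H: fnctr B C H using assms(2) by (rule is_functor_fnctr)
  show ?thesis
  proof (rule naturally_isomorphicI[OF is_functor_fcomp[OF F.fnctr assms(2)]
        is_functor_fcomp[OF G.fnctr assms(2)], of "\<lambda>a. onA H (\<tau> a)"])
    fix a b f assume f: "f \<in> hom A a b"
    then have ab: "a \<in> Obj A" "b \<in> Obj A" by (auto dest: F.dom.hom_obj)
    have "onA H (\<tau> b) \<cdot>\<^bsub>C\<^esub> onA H (onA F f) = onA H (\<tau> b \<cdot>\<^bsub>B\<^esub> onA F f)"
      using f ab by (auto simp: hom_iff)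
    also have "\<dots> = onA H (onA G f) \<cdot>\<^bsub>C\<^esub> onA H (\<tau> a)"
      unfolding naturality[OF f] using f ab by (auto simp: hom_iff)
    finally show "onA H (\<tau> b) \<cdot>\<^bsub>C\<^esub> onA (H \<odot> F) f = onA (H \<odot> G) f \<cdot>\<^bsub>C\<^esub> onA H (\<tau> a)"
      by simp
  qed (auto intro: H.pres_iso iso simp: hom_iff)
qed

lemma natiso_whisker_right:
  assumes "naturally_isomorphic B C F G" "is_functor A B H"
  shows "naturally_isomorphic A C (F \<odot> H) (G \<odot> H)"
proof -
  obtain \<tau> where "niso B C F G \<tau>"
    using naturally_isomorphicE[OF assms(1)] .
  then interpret niso B C F G \<tau> .
  interpret H: fnctr A B H using assms(2) by (rule is_functor_fnctr)
  show ?thesis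
    by (rule naturally_isomorphicI[OF is_functor_fcomp[OF assms(2) F.fnctr]
          is_functor_fcomp[OF assms(2) G.fnctr], of "\<lambda>a. \<tau> (onO H a)"])
      (auto intro: iso naturality H.pres_hom simp: hom_iff)
qed

text \<open>This is what makes substitution inside a string of functors mechanical: applied
  repeatedly together with \<open>natiso_refl\<close>, it splits the string into its factors, and
  only the factor that changes uses a nontrivial fact.\<close>

lemma natiso_fcomp:
  assumes "naturally_isomorphic A B F F'" "naturally_isomorphic B C G G'"
  shows "naturally_isomorphic A C (G \<odot> F) (G' \<odot> F')"
  using natiso_trans[OF natiso_whisker_left[OF assms(1) natiso_functors(1)[OF assms(2)]]
      natiso_whisker_right[OF assms(2) natiso_functors(2)[OF assms(1)]]] .

lemma natiso_componentE:
  assumes "naturally_isomorphic A B F G" "a \<in> Obj A"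
  obtains u where "is_iso B u" "u \<in> hom B (onO F a) (onO G a)"
proof -
  obtain \<tau> where "niso A B F G \<tau>" using naturally_isomorphicE[OF assms(1)] .
  then interpret niso A B F G \<tau> .
  show ?thesis using that[OF iso[OF assms(2)] comp_hom[OF assms(2)]] .
qed

section \<open>Adjunctions\<close>

locale adjn = F: fnctr A B F + G: fnctr B A G for A B F G +
  fixes \<eta> \<epsilon>
  assumes adjn: "adjunction A B F G \<eta> \<epsilon>"
begin

sublocale \<eta>: ntransf A A fid "G \<odot> F" \<eta>
  using adjn nat_transf_ntransf by (auto simp: adjunction_def)

sublocale \<epsilon>: ntransf B B "F \<odot> G" fid \<epsilon>
  using adjn nat_transf_ntransf by (auto simp: adjunction_def)

lemma eta_simps [simp]:
  assumes "a \<in> Obj A"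
  shows "\<eta> a \<in> Arr A" "Dom A (\<eta> a) = a" "Cod A (\<eta> a) = onO G (onO F a)"
  using \<eta>.component[OF assms] by auto

lemma eps_simps [simp]:
  assumes "b \<in> Obj B"
  shows "\<epsilon> b \<in> Arr B" "Dom B (\<epsilon> b) = onO F (onO G b)" "Cod B (\<epsilon> b) = b"
  using \<epsilon>.component[OF assms] by auto

lemma eta_nat: "f \<in> hom A a b \<Longrightarrow> \<eta> b \<cdot>\<^bsub>A\<^esub> f = onA G (onA F f) \<cdot>\<^bsub>A\<^esub> \<eta> a"
  using \<eta>.naturality by simp

lemma eps_nat: "f \<in> hom B a b \<Longrightarrow> \<epsilon> b \<cdot>\<^bsub>B\<^esub> onA F (onA G f) = f \<cdot>\<^bsub>B\<^esub> \<epsilon> a"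
  using \<epsilon>.naturality by simp

lemma triangle_left: "a \<in> Obj A \<Longrightarrow> \<epsilon> (onO F a) \<cdot>\<^bsub>B\<^esub> onA F (\<eta> a) = Ide B (onO F a)"
  using adjn by (simp add: adjunction_def)

lemma triangle_right: "b \<in> Obj B \<Longrightarrow> onA G (\<epsilon> b) \<cdot>\<^bsub>A\<^esub> \<eta> (onO G b) = Ide A (onO G b)"
  using adjn by (simp add: adjunction_def)

lemma transpose_inverse_left:
  assumes "a \<in> Obj A" "h \<in> hom B (onO F a) b"
  shows "\<epsilon> b \<cdot>\<^bsub>B\<^esub> onA F (onA G h \<cdot>\<^bsub>A\<^esub> \<eta> a) = h"
proof -
  have "\<epsilon> b \<cdot>\<^bsub>B\<^esub> onA F (onA G h \<cdot>\<^bsub>A\<^esub> \<eta> a) = (\<epsilon> b \<cdot>\<^bsub>B\<^esub> onA F (onA G h)) \<cdot>\<^bsub>B\<^esub> onA F (\<eta> a)"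
    using assms by (auto simp: hom_iff)
  also have "\<dots> = h \<cdot>\<^bsub>B\<^esub> (\<epsilon> (onO F a) \<cdot>\<^bsub>B\<^esub> onA F (\<eta> a))"
    unfolding eps_nat[OF assms(2)] using assms by (auto simp: hom_iff)
  finally show ?thesis
    unfolding triangle_left[OF assms(1)] using assms by (auto simp: hom_iff)
qed

lemma transpose_inverse_right:
  assumes "b \<in> Obj B" "g \<in> hom A a (onO G b)"
  shows "onA G (\<epsilon> b \<cdot>\<^bsub>B\<^esub> onA F g) \<cdot>\<^bsub>A\<^esub> \<eta> a = g"
proof -
  have a: "a \<in> Obj A" using assms(2) by (auto simp: hom_iff)
  have "onA G (\<epsilon> b \<cdot>\<^bsub>B\<^esub> onA F g) \<cdot>\<^bsub>A\<^esub> \<eta> a = onA G (\<epsilon> b) \<cdot>\<^bsub>A\<^esub> (onA G (onA F g) \<cdot>\<^bsub>A\<^esub> \<eta> a)"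
    using assms a by (auto simp: hom_iff)
  also have "\<dots> = (onA G (\<epsilon> b) \<cdot>\<^bsub>A\<^esub> \<eta> (onO G b)) \<cdot>\<^bsub>A\<^esub> g"
    unfolding eta_nat[OF assms(2), symmetric] using assms a by (auto simp: hom_iff)
  finally show ?thesis
    unfolding triangle_right[OF assms(1)] using assms by (auto simp: hom_iff)
qed

lemma transpose_hom:
  "a \<in> Obj A \<Longrightarrow> h \<in> hom B (onO F a) b \<Longrightarrow> onA G h \<cdot>\<^bsub>A\<^esub> \<eta> a \<in> hom A a (onO G b)"
  by (auto simp: hom_iff)

lemma cotranspose_hom:
  "b \<in> Obj B \<Longrightarrow> g \<in> hom A a (onO G b) \<Longrightarrow> \<epsilon> b \<cdot>\<^bsub>B\<^esub> onA F g \<in> hom B (onO F a) b"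
  by (auto simp: hom_iff)

lemma transpose_eqD:
  assumes "a \<in> Obj A" "h \<in> hom B (onO F a) b" "k \<in> hom B (onO F a) b"
    and "onA G h \<cdot>\<^bsub>A\<^esub> \<eta> a = onA G k \<cdot>\<^bsub>A\<^esub> \<eta> a"
  shows "h = k"
  by (rule trans[OF transpose_inverse_left[OF assms(1,2), symmetric]])
    (unfold assms(4), rule transpose_inverse_left[OF assms(1,3)])

end

lemma adjunction_adjn:
  assumes "adjunction A B F G \<eta> \<epsilon>"
  shows "adjn A B F G \<eta> \<epsilon>"
  using assms
  by (auto simp: adjn_def adjn_axioms_def adjunction_def intro: is_functor_fnctr)

text \<open>The hom-set form of an adjunction. Composing adjunctions and comparing adjoints become
  compositions of bijections here, with no triangle identities to chase. Naturality in both
  variables is a single equation; the one for \<psi> follows.\<close>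

locale hom_adjn = F: fnctr A B F + G: fnctr B A G for A B F G +
  fixes \<phi> \<psi>
  assumes phi_hom: "a \<in> Obj A \<Longrightarrow> h \<in> hom B (onO F a) b \<Longrightarrow> \<phi> a b h \<in> hom A a (onO G b)"
    and psi_hom: "b \<in> Obj B \<Longrightarrow> g \<in> hom A a (onO G b) \<Longrightarrow> \<psi> a b g \<in> hom B (onO F a) b"
    and psi_phi: "a \<in> Obj A \<Longrightarrow> h \<in> hom B (onO F a) b \<Longrightarrow> \<psi> a b (\<phi> a b h) = h"
    and phi_psi: "b \<in> Obj B \<Longrightarrow> g \<in> hom A a (onO G b) \<Longrightarrow> \<phi> a b (\<psi> a b g) = g"
    and phi_nat: "u \<in> hom A a' a \<Longrightarrow> k \<in> hom B b b' \<Longrightarrow> h \<in> hom B (onO F a) b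
      \<Longrightarrow> \<phi> a' b' (k \<cdot>\<^bsub>B\<^esub> (h \<cdot>\<^bsub>B\<^esub> onA F u)) = onA G k \<cdot>\<^bsub>A\<^esub> (\<phi> a b h \<cdot>\<^bsub>A\<^esub> u)"
begin

lemma psi_nat:
  assumes "u \<in> hom A a' a" "k \<in> hom B b b'" "g \<in> hom A a (onO G b)"
  shows "\<psi> a' b' (onA G k \<cdot>\<^bsub>A\<^esub> (g \<cdot>\<^bsub>A\<^esub> u)) = k \<cdot>\<^bsub>B\<^esub> (\<psi> a b g \<cdot>\<^bsub>B\<^esub> onA F u)"
proof -
  have b: "b \<in> Obj B" and a': "a' \<in> Obj A" using assms by (auto simp: hom_iff)
  note \<psi> = psi_hom[OF b assms(3)]
  have "onA G k \<cdot>\<^bsub>A\<^esub> (g \<cdot>\<^bsub>A\<^esub> u) = \<phi> a' b' (k \<cdot>\<^bsub>B\<^esub> (\<psi> a b g \<cdot>\<^bsub>B\<^esub> onA F u))"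
    unfolding phi_nat[OF assms(1,2) \<psi>] phi_psi[OF b assms(3)] ..
  moreover have "k \<cdot>\<^bsub>B\<^esub> (\<psi> a b g \<cdot>\<^bsub>B\<^esub> onA F u) \<in> hom B (onO F a') b'"
    using assms \<psi> by (auto simp: hom_iff)
  ultimately show ?thesis using psi_phi[OF a'] by simp
qed

lemma phi_nat_cod:
  assumes "a \<in> Obj A" "k \<in> hom B b b'" "h \<in> hom B (onO F a) b"
  shows "\<phi> a b' (k \<cdot>\<^bsub>B\<^esub> h) = onA G k \<cdot>\<^bsub>A\<^esub> \<phi> a b h"
  using phi_nat[OF F.dom.ide_in[OF assms(1)] assms(2,3)] assms phi_hom[OF assms(1,3)]
  by (auto simp: hom_iff)

lemma phi_nat_dom:
  assumes "u \<in> hom A a' a" "h \<in> hom B (onO F a) b"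
  shows "\<phi> a' b (h \<cdot>\<^bsub>B\<^esub> onA F u) = \<phi> a b h \<cdot>\<^bsub>A\<^esub> u"
proof -
  have ab: "a \<in> Obj A" "b \<in> Obj B" using assms by (auto simp: hom_iff)
  show ?thesis
    using phi_nat[OF assms(1) F.cod.ide_in[OF ab(2)] assms(2)] assms ab phi_hom[OF ab(1) assms(2)]
    by (auto simp: hom_iff)
qed

lemma psi_nat_cod:
  assumes "k \<in> hom B b b'" "g \<in> hom A a (onO G b)"
  shows "\<psi> a b' (onA G k \<cdot>\<^bsub>A\<^esub> g) = k \<cdot>\<^bsub>B\<^esub> \<psi> a b g"
proof -
  have ab: "a \<in> Obj A" "b \<in> Obj B" using assms by (auto simp: hom_iff)
  show ?thesis
    using psi_nat[OF F.dom.ide_in[OF ab(1)] assms] assms ab psi_hom[OF ab(2) assms(2)]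
    by (auto simp: hom_iff)
qed

lemma psi_nat_dom:
  assumes "u \<in> hom A a' a" "b \<in> Obj B" "g \<in> hom A a (onO G b)"
  shows "\<psi> a' b (g \<cdot>\<^bsub>A\<^esub> u) = \<psi> a b g \<cdot>\<^bsub>B\<^esub> onA F u"
  using psi_nat[OF assms(1) F.cod.ide_in[OF assms(2)] assms(3)] assms psi_hom[OF assms(2,3)]
  by (auto simp: hom_iff)

text \<open>The unit and counit are the images of identities under \<phi> and \<psi>. By naturality
  \<phi> and \<psi> are recovered from them, so the triangle identities are just \<psi> \<phi> = id
  and \<phi> \<psi> = id at identities.\<close>

lemma adjoint: "adjoint A B F G"
proof -
  define \<eta> where "\<eta> a = \<phi> a (onO F a) (Ide B (onO F a))" for a
  define \<epsilon> where "\<epsilon> b = \<psi> (onO G b) b (Ide A (onO G b))" for b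
  have \<eta>: "\<eta> a \<in> hom A a (onO G (onO F a))" if "a \<in> Obj A" for a
    unfolding \<eta>_def using that by (intro phi_hom) (auto simp: hom_iff)
  have \<epsilon>: "\<epsilon> b \<in> hom B (onO F (onO G b)) b" if "b \<in> Obj B" for b
    unfolding \<epsilon>_def using that by (intro psi_hom) (auto simp: hom_iff)
  have \<phi>: "\<phi> a b h = onA G h \<cdot>\<^bsub>A\<^esub> \<eta> a" if "a \<in> Obj A" "h \<in> hom B (onO F a) b" for a b h
    using phi_nat_cod[OF that F.cod.ide_in] that unfolding \<eta>_def by (simp add: hom_iff)
  have \<psi>: "\<psi> a b g = \<epsilon> b \<cdot>\<^bsub>B\<^esub> onA F g" if "b \<in> Obj B" "g \<in> hom A a (onO G b)" for a b g
    using psi_nat_dom[OF that(2,1) F.dom.ide_in] that unfolding \<epsilon>_def by (simp add: hom_iff)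
  have "nat_transf A A fid (G \<odot> F) \<eta>"
    unfolding nat_transf_def
  proof (intro conjI allI ballI)
    fix a b u assume u: "u \<in> hom A a b"
    then have ab: "a \<in> Obj A" "b \<in> Obj A" by (auto simp: hom_iff)
    have "\<phi> a (onO F b) (onA F u) = \<eta> b \<cdot>\<^bsub>A\<^esub> u"
      using phi_nat_dom[OF u F.cod.ide_in[of "onO F b"]] u ab unfolding \<eta>_def
      by (simp add: hom_iff)
    then show "\<eta> b \<cdot>\<^bsub>A\<^esub> onA fid u = onA (G \<odot> F) u \<cdot>\<^bsub>A\<^esub> \<eta> a"
      using \<phi>[OF ab(1) F.pres_hom[OF u]] by simp
  qed (use \<eta> in \<open>simp_all add: is_functor_fid is_functor_fcomp[OF F.fnctr G.fnctr]
         F.dom.category_axioms\<close>)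
  moreover have "nat_transf B B (F \<odot> G) fid \<epsilon>"
    unfolding nat_transf_def
  proof (intro conjI allI ballI)
    fix a b u assume u: "u \<in> hom B a b"
    then have ab: "a \<in> Obj B" "b \<in> Obj B" by (auto simp: hom_iff)
    have "\<psi> (onO G a) b (onA G u) = u \<cdot>\<^bsub>B\<^esub> \<epsilon> a"
      using psi_nat_cod[OF u F.dom.ide_in[of "onO G a"]] u ab unfolding \<epsilon>_def
      by (simp add: hom_iff)
    then show "\<epsilon> b \<cdot>\<^bsub>B\<^esub> onA (F \<odot> G) u = onA fid u \<cdot>\<^bsub>B\<^esub> \<epsilon> a"
      using \<psi>[OF ab(2) G.pres_hom[OF u]] by simp
  qed (use \<epsilon> in \<open>simp_all add: is_functor_fid is_functor_fcomp[OF G.fnctr F.fnctr]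
         F.cod.category_axioms\<close>)
  moreover have "\<epsilon> (onO F a) \<cdot>\<^bsub>B\<^esub> onA F (\<eta> a) = Ide B (onO F a)" if "a \<in> Obj A" for a
    using psi_phi[OF that F.cod.ide_in] \<psi>[OF _ \<eta>[OF that]] that by (simp add: \<eta>_def)
  moreover have "onA G (\<epsilon> b) \<cdot>\<^bsub>A\<^esub> \<eta> (onO G b) = Ide A (onO G b)" if "b \<in> Obj B" for b
    using phi_psi[OF that F.dom.ide_in] \<phi>[OF _ \<epsilon>[OF that]] that by (simp add: \<epsilon>_def)
  ultimately have "adjunction A B F G \<eta> \<epsilon>"
    by (simp add: adjunction_def F.fnctr G.fnctr)
  then show ?thesis by (auto simp: adjoint_def)
qed

end

lemma (in adjn) hom_adjn:
  "hom_adjn A B F G (\<lambda>a b h. onA G h \<cdot>\<^bsub>A\<^esub> \<eta> a) (\<lambda>a b g. \<epsilon> b \<cdot>\<^bsub>B\<^esub> onA F g)"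
proof (unfold_locales, goal_cases)
  case (5 u a' a k b b' h)
  then have o: "a \<in> Obj A" "a' \<in> Obj A" by (auto simp: hom_iff)
  have "onA G (k \<cdot>\<^bsub>B\<^esub> (h \<cdot>\<^bsub>B\<^esub> onA F u)) \<cdot>\<^bsub>A\<^esub> \<eta> a'
      = onA G k \<cdot>\<^bsub>A\<^esub> (onA G h \<cdot>\<^bsub>A\<^esub> (onA G (onA F u) \<cdot>\<^bsub>A\<^esub> \<eta> a'))"
    using 5 o by (auto simp: hom_iff)
  then show ?case
    unfolding eta_nat[OF 5(1), symmetric] using 5 o by (auto simp: hom_iff)
qed (auto intro: transpose_hom cotranspose_hom transpose_inverse_left transpose_inverse_right)

lemma adjointE:
  assumes "adjoint A B F G"
  obtains \<phi> \<psi> where "hom_adjn A B F G \<phi> \<psi>"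
  using assms adjn.hom_adjn adjunction_adjn unfolding adjoint_def by blast

lemma adjoint_functors:
  assumes "adjoint A B F G"
  shows "is_functor A B F" "is_functor B A G"
  using assms by (auto simp: adjoint_def adjunction_def)

lemma adjoint_fcomp:
  assumes "adjoint A B F G" "adjoint B C F' G'"
  shows "adjoint A C (F' \<odot> F) (G \<odot> G')"
proof -
  obtain \<phi> \<psi> where "hom_adjn A B F G \<phi> \<psi>" using adjointE[OF assms(1)] .
  then interpret X: hom_adjn A B F G \<phi> \<psi> .
  obtain \<phi>' \<psi>' where "hom_adjn B C F' G' \<phi>' \<psi>'" using adjointE[OF assms(2)] .
  then interpret Y: hom_adjn B C F' G' \<phi>' \<psi>' .
  interpret FF: fnctr A C "F' \<odot> F"
    using is_functor_fcomp[OF X.F.fnctr Y.F.fnctr] by (rule is_functor_fnctr)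
  interpret GG: fnctr C A "G \<odot> G'"
    using is_functor_fcomp[OF Y.G.fnctr X.G.fnctr] by (rule is_functor_fnctr)
  interpret hom_adjn A C "F' \<odot> F" "G \<odot> G'"
      "\<lambda>a c h. \<phi> a (onO G' c) (\<phi>' (onO F a) c h)" "\<lambda>a c g. \<psi>' (onO F a) c (\<psi> a (onO G' c) g)"
  proof (unfold_locales, goal_cases)
    case (5 u a' a k b b' h)
    then have "a \<in> Obj A" by (auto simp: hom_iff)
    then show ?case
      using 5 X.phi_nat[OF 5(1) Y.G.pres_hom[OF 5(2)] Y.phi_hom]
        Y.phi_nat[OF X.F.pres_hom[OF 5(1)] 5(2)] by simp
  qed (simp_all add: X.phi_hom Y.phi_hom X.psi_hom Y.psi_hom X.psi_phi Y.psi_phi X.phi_psi Y.phi_psi)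
  show ?thesis by (rule adjoint)
qed

section \<open>The Yoneda lemma and uniqueness of adjoints\<close>

text \<open>Evaluating \<theta> at the identity of \<open>onO G b\<close> gives the component, and
  naturality turns \<theta> into composition with it. Surjectivity of \<theta> then provides a right
  inverse, and injectivity shows that it is also a left inverse.\<close>

lemma natiso_of_covariant_homs:
  assumes G: "is_functor B A G" and G': "is_functor B A G'"
    and bij: "\<And>a b. a \<in> Obj A \<Longrightarrow> b \<in> Obj B
      \<Longrightarrow> bij_betw (\<theta> a b) (hom A a (onO G b)) (hom A a (onO G' b))"
    and nat: "\<And>a a' b b' u k h. u \<in> hom A a' a \<Longrightarrow> k \<in> hom B b b' \<Longrightarrow> h \<in> hom A a (onO G b)
      \<Longrightarrow> \<theta> a' b' (onA G k \<cdot>\<^bsub>A\<^esub> (h \<cdot>\<^bsub>A\<^esub> u)) = onA G' k \<cdot>\<^bsub>A\<^esub> (\<theta> a b h \<cdot>\<^bsub>A\<^esub> u)"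
  shows "naturally_isomorphic B A G G'"
proof -
  interpret G: fnctr B A G using G by (rule is_functor_fnctr)
  interpret G': fnctr B A G' using G' by (rule is_functor_fnctr)
  define \<tau> where "\<tau> b = \<theta> (onO G b) b (Ide A (onO G b))" for b
  have \<theta>: "\<theta> a b h \<in> hom A a (onO G' b)" if "a \<in> Obj A" "b \<in> Obj B" "h \<in> hom A a (onO G b)" for a b h
    using bij_betwE[OF bij[OF that(1,2)]] that(3) by blast
  have \<tau>: "\<tau> b \<in> hom A (onO G b) (onO G' b)" if "b \<in> Obj B" for b
    unfolding \<tau>_def using that by (intro \<theta>) (auto simp: hom_iff)
  have \<tau>_comp: "\<theta> a b h = \<tau> b \<cdot>\<^bsub>A\<^esub> h" if "b \<in> Obj B" "h \<in> hom A a (onO G b)" for a b h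
    using nat[OF that(2) G.dom.ide_in[OF that(1)] G.cod.ide_in[of "onO G b"]] that \<tau>[OF that(1)]
    by (auto simp: hom_iff \<tau>_def)
  show ?thesis
  proof (rule naturally_isomorphicI[OF G G', of \<tau>])
    fix b assume b: "b \<in> Obj B"
    note t = \<tau>[OF b]
    have o: "onO G b \<in> Obj A" "onO G' b \<in> Obj A" using b by auto
    obtain g where g: "g \<in> hom A (onO G' b) (onO G b)" "\<theta> (onO G' b) b g = Ide A (onO G' b)"
      using bij_betw_imp_surj_on[OF bij[OF o(2) b]] G.cod.ide_in[OF o(2)] by (metis imageE)
    have \<tau>g: "\<tau> b \<cdot>\<^bsub>A\<^esub> g = Ide A (onO G' b)" using \<tau>_comp[OF b g(1)] g(2) by simp
    have gt: "g \<cdot>\<^bsub>A\<^esub> \<tau> b \<in> hom A (onO G b) (onO G b)" using g t by (auto simp: hom_iff)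
    have "\<theta> (onO G b) b (g \<cdot>\<^bsub>A\<^esub> \<tau> b) = (\<tau> b \<cdot>\<^bsub>A\<^esub> g) \<cdot>\<^bsub>A\<^esub> \<tau> b"
      using \<tau>_comp[OF b gt] g(1) t by (auto simp: hom_iff)
    also have "\<dots> = \<theta> (onO G b) b (Ide A (onO G b))"
      unfolding \<tau>g using t by (simp add: hom_iff \<tau>_def)
    finally have "g \<cdot>\<^bsub>A\<^esub> \<tau> b = Ide A (onO G b)"
      using bij_betw_imp_inj_on[OF bij[OF o(1) b]] gt G.cod.ide_in[OF o(1)]
      by (auto dest: inj_onD)
    then show "is_iso A (\<tau> b)" using G.cod.isoI[OF t g(1)] \<tau>g by simp
  next
    fix b b' k assume k: "k \<in> hom B b b'"
    then have b: "b \<in> Obj B" "b' \<in> Obj B" by (auto simp: hom_iff)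
    then have o: "onO G b \<in> Obj A" by simp
    show "\<tau> b' \<cdot>\<^bsub>A\<^esub> onA G k = onA G' k \<cdot>\<^bsub>A\<^esub> \<tau> b"
      using \<tau>_comp[OF b(2) G.pres_hom[OF k]] nat[OF G.cod.ide_in[OF o] k G.cod.ide_in[OF o]]
        k b o \<tau>[OF b(1)] by (auto simp: hom_iff \<tau>_def)
  qed (fact \<tau>)
qed

text \<open>The direction is reversed: \<theta> turns maps out of F a into maps out of F' a, so its
  value at the identity of F a is an arrow from F' a to F a. Hence the order of the functors in the
  conclusion.\<close>

lemma natiso_of_contravariant_homs:
  assumes F: "is_functor A B F" and F': "is_functor A B F'"
    and bij: "\<And>a b. a \<in> Obj A \<Longrightarrow> b \<in> Obj B
      \<Longrightarrow> bij_betw (\<theta> a b) (hom B (onO F a) b) (hom B (onO F' a) b)"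
    and nat: "\<And>a a' b b' u k h. u \<in> hom A a' a \<Longrightarrow> k \<in> hom B b b' \<Longrightarrow> h \<in> hom B (onO F a) b
      \<Longrightarrow> \<theta> a' b' (k \<cdot>\<^bsub>B\<^esub> (h \<cdot>\<^bsub>B\<^esub> onA F u)) = k \<cdot>\<^bsub>B\<^esub> (\<theta> a b h \<cdot>\<^bsub>B\<^esub> onA F' u)"
  shows "naturally_isomorphic A B F' F"
proof -
  interpret F: fnctr A B F using F by (rule is_functor_fnctr)
  interpret F': fnctr A B F' using F' by (rule is_functor_fnctr)
  define \<tau> where "\<tau> a = \<theta> a (onO F a) (Ide B (onO F a))" for a
  have \<theta>: "\<theta> a b h \<in> hom B (onO F' a) b" if "a \<in> Obj A" "b \<in> Obj B" "h \<in> hom B (onO F a) b" for a b h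
    using bij_betwE[OF bij[OF that(1,2)]] that(3) by blast
  have \<tau>: "\<tau> a \<in> hom B (onO F' a) (onO F a)" if "a \<in> Obj A" for a
    unfolding \<tau>_def using that by (intro \<theta>) (auto simp: hom_iff)
  have \<tau>_comp: "\<theta> a b h = h \<cdot>\<^bsub>B\<^esub> \<tau> a" if "a \<in> Obj A" "h \<in> hom B (onO F a) b" for a b h
    using nat[OF F.dom.ide_in[OF that(1)] that(2) F.cod.ide_in[of "onO F a"]] that \<tau>[OF that(1)]
    by (auto simp: hom_iff \<tau>_def)
  show ?thesis
  proof (rule naturally_isomorphicI[OF F' F, of \<tau>])
    fix a assume a: "a \<in> Obj A"
    note t = \<tau>[OF a]
    have o: "onO F a \<in> Obj B" "onO F' a \<in> Obj B" using a by auto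
    obtain g where g: "g \<in> hom B (onO F a) (onO F' a)" "\<theta> a (onO F' a) g = Ide B (onO F' a)"
      using bij_betw_imp_surj_on[OF bij[OF a o(2)]] F.cod.ide_in[OF o(2)] by (metis imageE)
    have \<tau>g: "g \<cdot>\<^bsub>B\<^esub> \<tau> a = Ide B (onO F' a)" using \<tau>_comp[OF a g(1)] g(2) by simp
    have gt: "\<tau> a \<cdot>\<^bsub>B\<^esub> g \<in> hom B (onO F a) (onO F a)" using g t by (auto simp: hom_iff)
    have "\<theta> a (onO F a) (\<tau> a \<cdot>\<^bsub>B\<^esub> g) = \<tau> a \<cdot>\<^bsub>B\<^esub> (g \<cdot>\<^bsub>B\<^esub> \<tau> a)"
      using \<tau>_comp[OF a gt] g(1) t by (auto simp: hom_iff)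
    also have "\<dots> = \<theta> a (onO F a) (Ide B (onO F a))"
      unfolding \<tau>g using t by (simp add: hom_iff \<tau>_def)
    finally have "\<tau> a \<cdot>\<^bsub>B\<^esub> g = Ide B (onO F a)"
      using bij_betw_imp_inj_on[OF bij[OF a o(1)]] gt F.cod.ide_in[OF o(1)]
      by (auto dest: inj_onD)
    then show "is_iso B (\<tau> a)" using F.cod.isoI[OF t g(1)] \<tau>g by simp
  next
    fix a a' u assume u: "u \<in> hom A a a'"
    then have a: "a \<in> Obj A" "a' \<in> Obj A" by (auto simp: hom_iff)
    then have o: "onO F a' \<in> Obj B" by simp
    show "\<tau> a' \<cdot>\<^bsub>B\<^esub> onA F' u = onA F u \<cdot>\<^bsub>B\<^esub> \<tau> a"
      using \<tau>_comp[OF a(1) F.pres_hom[OF u]] nat[OF u F.cod.ide_in[OF o] F.cod.ide_in[OF o]]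
        u a o \<tau>[OF a(2)] by (auto simp: hom_iff \<tau>_def)
  qed (fact \<tau>)
qed

lemma (in hom_adjn) phi_bij:
  assumes "a \<in> Obj A" "b \<in> Obj B"
  shows "bij_betw (\<phi> a b) (hom B (onO F a) b) (hom A a (onO G b))"
  by (rule bij_betw_byWitness[where f' = "\<psi> a b"])
    (use assms in \<open>auto simp: phi_hom psi_hom phi_psi psi_phi\<close>)

lemma (in hom_adjn) psi_bij:
  assumes "a \<in> Obj A" "b \<in> Obj B"
  shows "bij_betw (\<psi> a b) (hom A a (onO G b)) (hom B (onO F a) b)"
  by (rule bij_betw_byWitness[where f' = "\<phi> a b"])
    (use assms in \<open>auto simp: phi_hom psi_hom phi_psi psi_phi\<close>)

lemma (in category) precomp_bij:
  assumes "is_iso A s" "s \<in> hom A a' a"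
  shows "bij_betw (\<lambda>h. h \<cdot> s) (hom A a b) (hom A a' b)"
proof -
  obtain t where t: "t \<in> hom A a a'" "t \<cdot> s = Ide A a'" "s \<cdot> t = Ide A a"
    using isoE[OF assms] .
  have "(h \<cdot> s) \<cdot> t = h" if "h \<in> hom A a b" for h
    using comp_assoc[OF t(1) assms(2) that] comp_ide_right[OF that] t(3) by simp
  moreover have "(h \<cdot> t) \<cdot> s = h" if "h \<in> hom A a' b" for h
    using comp_assoc[OF assms(2) t(1) that] comp_ide_right[OF that] t(2) by simp
  ultimately show ?thesis
    using comp_in[OF assms(2)] comp_in[OF t(1)]
    by (intro bij_betw_byWitness[where f' = "\<lambda>h. h \<cdot> t"]) auto
qed

lemma (in category) postcomp_bij:
  assumes "is_iso A s" "s \<in> hom A b b'"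
  shows "bij_betw (\<lambda>h. s \<cdot> h) (hom A a b) (hom A a b')"
proof -
  obtain t where t: "t \<in> hom A b' b" "t \<cdot> s = Ide A b" "s \<cdot> t = Ide A b'"
    using isoE[OF assms] .
  have "t \<cdot> (s \<cdot> h) = h" if "h \<in> hom A a b" for h
    using comp_assoc[OF that assms(2) t(1)] comp_ide_left[OF that] t(2) by simp
  moreover have "s \<cdot> (t \<cdot> h) = h" if "h \<in> hom A a b'" for h
    using comp_assoc[OF that t(1) assms(2)] comp_ide_left[OF that] t(3) by simp
  ultimately show ?thesis
    using comp_in[OF _ assms(2)] comp_in[OF _ t(1)]
    by (intro bij_betw_byWitness[where f' = "\<lambda>h. t \<cdot> h"]) auto
qed

text \<open>Uniqueness of right adjoints, for left adjoints that are merely isomorphic: hom(a, G b),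
  hom(F a, b), hom(F' a, b) and hom(a, G' b) are in natural bijection. Comparing right adjoints is
  thereby reduced to comparing their left adjoints.\<close>

lemma right_adjoint_natiso:
  assumes "adjoint A B F G" "adjoint A B F' G'" "naturally_isomorphic A B F F'"
  shows "naturally_isomorphic B A G G'"
proof -
  obtain \<phi> \<psi> where "hom_adjn A B F G \<phi> \<psi>" using adjointE[OF assms(1)] .
  then interpret X: hom_adjn A B F G \<phi> \<psi> .
  obtain \<phi>' \<psi>' where "hom_adjn A B F' G' \<phi>' \<psi>'" using adjointE[OF assms(2)] .
  then interpret Y: hom_adjn A B F' G' \<phi>' \<psi>' .
  \<comment> \<open>The isomorphism is inverted because precomposition with it must turn a map out
    of F a into a map out of F' a.\<close>
  obtain \<sigma> where "niso A B F' F \<sigma>"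
    using naturally_isomorphicE[OF natiso_sym[OF assms(3)]] .
  then interpret \<sigma>: niso A B F' F \<sigma> .
  show ?thesis
  proof (rule natiso_of_covariant_homs[OF X.G.fnctr Y.G.fnctr])
    fix a b assume o: "a \<in> Obj A" "b \<in> Obj B"
    show "bij_betw (\<phi>' a b \<circ> ((\<lambda>h. h \<cdot>\<^bsub>B\<^esub> \<sigma> a) \<circ> \<psi> a b)) (hom A a (onO G b)) (hom A a (onO G' b))"
      by (rule bij_betw_trans[OF bij_betw_trans[OF X.psi_bij[OF o]
            X.F.cod.precomp_bij[OF \<sigma>.iso[OF o(1)] \<sigma>.comp_hom[OF o(1)]]] Y.phi_bij[OF o]])
  next
    fix a a' b b' u k h
    assume a: "u \<in> hom A a' a" "k \<in> hom B b b'" "h \<in> hom A a (onO G b)"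
    then have o: "a \<in> Obj A" "a' \<in> Obj A" "b \<in> Obj B" by (auto simp: hom_iff)
    note h = X.psi_hom[OF o(3) a(3)]
    have "\<psi> a' b' (onA G k \<cdot>\<^bsub>A\<^esub> (h \<cdot>\<^bsub>A\<^esub> u)) \<cdot>\<^bsub>B\<^esub> \<sigma> a' = k \<cdot>\<^bsub>B\<^esub> (\<psi> a b h \<cdot>\<^bsub>B\<^esub> (onA F u \<cdot>\<^bsub>B\<^esub> \<sigma> a'))"
      unfolding X.psi_nat[OF a] using a o h by (auto simp: hom_iff)
    also have "\<dots> = k \<cdot>\<^bsub>B\<^esub> ((\<psi> a b h \<cdot>\<^bsub>B\<^esub> \<sigma> a) \<cdot>\<^bsub>B\<^esub> onA F' u)"
      unfolding \<sigma>.naturality[OF a(1), symmetric] using a o h by (auto simp: hom_iff)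
    finally have "\<psi> a' b' (onA G k \<cdot>\<^bsub>A\<^esub> (h \<cdot>\<^bsub>A\<^esub> u)) \<cdot>\<^bsub>B\<^esub> \<sigma> a'
        = k \<cdot>\<^bsub>B\<^esub> ((\<psi> a b h \<cdot>\<^bsub>B\<^esub> \<sigma> a) \<cdot>\<^bsub>B\<^esub> onA F' u)" .
    moreover have "\<psi> a b h \<cdot>\<^bsub>B\<^esub> \<sigma> a \<in> hom B (onO F' a) b"
      using o h by (auto simp: hom_iff)
    ultimately show "(\<phi>' a' b' \<circ> ((\<lambda>h. h \<cdot>\<^bsub>B\<^esub> \<sigma> a') \<circ> \<psi> a' b')) (onA G k \<cdot>\<^bsub>A\<^esub> (h \<cdot>\<^bsub>A\<^esub> u))
        = onA G' k \<cdot>\<^bsub>A\<^esub> ((\<phi>' a b \<circ> ((\<lambda>h. h \<cdot>\<^bsub>B\<^esub> \<sigma> a) \<circ> \<psi> a b)) h \<cdot>\<^bsub>A\<^esub> u)"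
      using Y.phi_nat[OF a(1,2)] by simp
  qed
qed

lemma left_adjoint_natiso:
  assumes "adjoint A B F G" "adjoint A B F' G'" "naturally_isomorphic B A G G'"
  shows "naturally_isomorphic A B F F'"
proof -
  obtain \<phi> \<psi> where "hom_adjn A B F G \<phi> \<psi>" using adjointE[OF assms(1)] .
  then interpret X: hom_adjn A B F G \<phi> \<psi> .
  obtain \<phi>' \<psi>' where "hom_adjn A B F' G' \<phi>' \<psi>'" using adjointE[OF assms(2)] .
  then interpret Y: hom_adjn A B F' G' \<phi>' \<psi>' .
  obtain \<sigma> where "niso B A G' G \<sigma>"
    using naturally_isomorphicE[OF natiso_sym[OF assms(3)]] .
  then interpret \<sigma>: niso B A G' G \<sigma> .
  show ?thesis
  proof (rule natiso_of_contravariant_homs[OF Y.F.fnctr X.F.fnctr])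
    fix a b assume o: "a \<in> Obj A" "b \<in> Obj B"
    show "bij_betw (\<psi> a b \<circ> ((\<lambda>h. \<sigma> b \<cdot>\<^bsub>A\<^esub> h) \<circ> \<phi>' a b)) (hom B (onO F' a) b) (hom B (onO F a) b)"
      by (rule bij_betw_trans[OF bij_betw_trans[OF Y.phi_bij[OF o]
            X.F.dom.postcomp_bij[OF \<sigma>.iso[OF o(2)] \<sigma>.comp_hom[OF o(2)]]] X.psi_bij[OF o]])
  next
    fix a a' b b' u k h
    assume a: "u \<in> hom A a' a" "k \<in> hom B b b'" "h \<in> hom B (onO F' a) b"
    then have o: "a \<in> Obj A" "b' \<in> Obj B" "b \<in> Obj B" by (auto simp: hom_iff)
    note h = Y.phi_hom[OF o(1) a(3)]
    have "\<sigma> b' \<cdot>\<^bsub>A\<^esub> \<phi>' a' b' (k \<cdot>\<^bsub>B\<^esub> (h \<cdot>\<^bsub>B\<^esub> onA F' u)) = (\<sigma> b' \<cdot>\<^bsub>A\<^esub> onA G' k) \<cdot>\<^bsub>A\<^esub> (\<phi>' a b h \<cdot>\<^bsub>A\<^esub> u)"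
      unfolding Y.phi_nat[OF a] using a o h by (auto simp: hom_iff)
    also have "\<dots> = onA G k \<cdot>\<^bsub>A\<^esub> ((\<sigma> b \<cdot>\<^bsub>A\<^esub> \<phi>' a b h) \<cdot>\<^bsub>A\<^esub> u)"
      unfolding \<sigma>.naturality[OF a(2)] using a o h by (auto simp: hom_iff)
    finally have "\<sigma> b' \<cdot>\<^bsub>A\<^esub> \<phi>' a' b' (k \<cdot>\<^bsub>B\<^esub> (h \<cdot>\<^bsub>B\<^esub> onA F' u))
        = onA G k \<cdot>\<^bsub>A\<^esub> ((\<sigma> b \<cdot>\<^bsub>A\<^esub> \<phi>' a b h) \<cdot>\<^bsub>A\<^esub> u)" .
    moreover have "\<sigma> b \<cdot>\<^bsub>A\<^esub> \<phi>' a b h \<in> hom A a (onO G b)"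
      using o h by (auto simp: hom_iff)
    ultimately show "(\<psi> a' b' \<circ> ((\<lambda>h. \<sigma> b' \<cdot>\<^bsub>A\<^esub> h) \<circ> \<phi>' a' b')) (k \<cdot>\<^bsub>B\<^esub> (h \<cdot>\<^bsub>B\<^esub> onA F' u))
        = k \<cdot>\<^bsub>B\<^esub> ((\<psi> a b \<circ> ((\<lambda>h. \<sigma> b \<cdot>\<^bsub>A\<^esub> h) \<circ> \<phi>' a b)) h \<cdot>\<^bsub>B\<^esub> onA F u)"
      using X.psi_nat[OF a(1,2)] by simp
  qed
qed

section \<open>Equivalences and reflective subcategories\<close>

text \<open>One natural family of bijections determines the adjunction; the opposite family is
  obtained with \<open>inv_into\<close>, so no formula for it has to be found.\<close>

lemma adjointI_phi:
  assumes "is_functor A B F" "is_functor B A G"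
    and bij: "\<And>a b. a \<in> Obj A \<Longrightarrow> b \<in> Obj B
      \<Longrightarrow> bij_betw (\<phi> a b) (hom B (onO F a) b) (hom A a (onO G b))"
    and nat: "\<And>a a' b b' u k h. u \<in> hom A a' a \<Longrightarrow> k \<in> hom B b b' \<Longrightarrow> h \<in> hom B (onO F a) b
      \<Longrightarrow> \<phi> a' b' (k \<cdot>\<^bsub>B\<^esub> (h \<cdot>\<^bsub>B\<^esub> onA F u)) = onA G k \<cdot>\<^bsub>A\<^esub> (\<phi> a b h \<cdot>\<^bsub>A\<^esub> u)"
  shows "adjoint A B F G"
proof -
  interpret F: fnctr A B F using assms(1) by (rule is_functor_fnctr)
  interpret G: fnctr B A G using assms(2) by (rule is_functor_fnctr)
  interpret hom_adjn A B F G \<phi> "\<lambda>a b. inv_into (hom B (onO F a) b) (\<phi> a b)"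
  proof (unfold_locales, goal_cases)
    case (1 a h b) then show ?case using bij_betwE[OF bij[of a b]] F.cod.hom_obj by blast
  next
    case (2 b g a) then show ?case
      using bij_betw_imp_surj_on[OF bij[of a b]] F.dom.hom_obj by (metis inv_into_into)
  next
    case (3 a h b) then show ?case
      using bij_betw_imp_inj_on[OF bij[of a b]] F.cod.hom_obj by (simp add: inv_into_f_f)
  next
    case (4 b g a) then show ?case
      using bij_betw_imp_surj_on[OF bij[of a b]] F.dom.hom_obj by (metis f_inv_into_f)
  next
    case 5 then show ?case by (rule nat)
  qed
  show ?thesis by (rule adjoint)
qed

text \<open>Needed for exponentials: evaluation gives an explicit map from right to left, whereas
  currying is known only by unique existence.\<close>

lemma adjointI_psi:
  assumes F: "is_functor A B F" and G: "is_functor B A G"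
    and bij: "\<And>a b. a \<in> Obj A \<Longrightarrow> b \<in> Obj B
      \<Longrightarrow> bij_betw (\<psi> a b) (hom A a (onO G b)) (hom B (onO F a) b)"
    and nat: "\<And>a a' b b' u k g. u \<in> hom A a' a \<Longrightarrow> k \<in> hom B b b' \<Longrightarrow> g \<in> hom A a (onO G b)
      \<Longrightarrow> \<psi> a' b' (onA G k \<cdot>\<^bsub>A\<^esub> (g \<cdot>\<^bsub>A\<^esub> u)) = k \<cdot>\<^bsub>B\<^esub> (\<psi> a b g \<cdot>\<^bsub>B\<^esub> onA F u)"
  shows "adjoint A B F G"
proof (rule adjointI_phi[OF F G, of "\<lambda>a b. inv_into (hom A a (onO G b)) (\<psi> a b)"])
  interpret F: fnctr A B F using F by (rule is_functor_fnctr)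
  interpret G: fnctr B A G using G by (rule is_functor_fnctr)
  fix a a' b b' u k h
  assume a: "u \<in> hom A a' a" "k \<in> hom B b b'" "h \<in> hom B (onO F a) b"
  then have o: "a \<in> Obj A" "b \<in> Obj B" "a' \<in> Obj A" "b' \<in> Obj B" by (auto simp: hom_iff)
  define g where "g = inv_into (hom A a (onO G b)) (\<psi> a b) h"
  have g: "g \<in> hom A a (onO G b)" "\<psi> a b g = h"
    using bij_betw_imp_surj_on[OF bij[OF o(1,2)]] a(3) unfolding g_def
    by (metis inv_into_into, metis f_inv_into_f)
  have "onA G k \<cdot>\<^bsub>A\<^esub> (g \<cdot>\<^bsub>A\<^esub> u) \<in> hom A a' (onO G b')"
    using a g by (auto simp: hom_iff)
  then have "inv_into (hom A a' (onO G b')) (\<psi> a' b') (\<psi> a' b' (onA G k \<cdot>\<^bsub>A\<^esub> (g \<cdot>\<^bsub>A\<^esub> u)))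
      = onA G k \<cdot>\<^bsub>A\<^esub> (g \<cdot>\<^bsub>A\<^esub> u)"
    by (rule inv_into_f_f[OF bij_betw_imp_inj_on[OF bij[OF o(3,4)]]])
  then show "inv_into (hom A a' (onO G b')) (\<psi> a' b') (k \<cdot>\<^bsub>B\<^esub> (h \<cdot>\<^bsub>B\<^esub> onA F u))
      = onA G k \<cdot>\<^bsub>A\<^esub> (inv_into (hom A a (onO G b)) (\<psi> a b) h \<cdot>\<^bsub>A\<^esub> u)"
    unfolding nat[OF a(1,2) g(1)] g(2) by (simp add: g_def)
qed (rule bij_betw_inv_into[OF bij])

section \<open>Quasi-inverses as fully faithful adjoints\<close>

lemma quasi_inverse_sym: "quasi_inverse A B F G \<Longrightarrow> quasi_inverse B A G F"
  by (simp add: quasi_inverse_def)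

text \<open>By naturality of \<tau> from G F to the identity, f composed with \<tau> a depends only
  on F f, and the isomorphism \<tau> a can be cancelled.\<close>

lemma quasi_inverse_faithful:
  assumes "quasi_inverse A B F G" "f \<in> hom A a b" "g \<in> hom A a b" "onA F f = onA F g"
  shows "f = g"
proof -
  obtain \<tau> where "niso A A (G \<odot> F) fid \<tau>"
    using assms(1) naturally_isomorphicE unfolding quasi_inverse_def by blast
  then interpret niso A A "G \<odot> F" fid \<tau> .
  have a: "a \<in> Obj A" using assms(2) by (auto simp: hom_iff)
  have "f \<cdot>\<^bsub>A\<^esub> \<tau> a = g \<cdot>\<^bsub>A\<^esub> \<tau> a"
    using naturality[OF assms(2)] naturality[OF assms(3)] assms(4) by simp
  then show ?thesis
    using bij_betw_imp_inj_on[OF F.dom.precomp_bij[OF iso[OF a], of _ a b]] comp_hom[OF a] assms(2,3)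
    by (auto dest: inj_onD)
qed

lemma quasi_inverse_fully_faithful:
  assumes "quasi_inverse A B F G"
  shows "fully_faithful B A G"
  unfolding fully_faithful_def
proof (intro ballI)
  fix b b' assume b: "b \<in> Obj B" "b' \<in> Obj B"
  obtain \<tau> where "niso B B (F \<odot> G) fid \<tau>"
    using assms naturally_isomorphicE unfolding quasi_inverse_def by blast
  then interpret niso B B "F \<odot> G" fid \<tau> .
  interpret Fu: fnctr A B F using assms is_functor_fnctr unfolding quasi_inverse_def by blast
  interpret Gu: fnctr B A G using assms is_functor_fnctr unfolding quasi_inverse_def by blast
  have "\<exists>h \<in> hom B b b'. onA G h = k" if k: "k \<in> hom A (onO G b) (onO G b')" for k
  proof -
    obtain s where s: "s \<in> hom B b (onO F (onO G b))" "s \<cdot>\<^bsub>B\<^esub> \<tau> b = Ide B (onO F (onO G b))"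
      using F.dom.isoE[OF iso[OF b(1)] comp_hom[OF b(1)]] by (metis fcomp_simps(1) fid_simps(1))
    \<comment> \<open>The preimage of k is F k conjugated by the isomorphism between F G and the
      identity. Naturality yields F (G h) = F k, and faithfulness of F gives G h = k.\<close>
    define h where "h = \<tau> b' \<cdot>\<^bsub>B\<^esub> (onA F k \<cdot>\<^bsub>B\<^esub> s)"
    have h: "h \<in> hom B b b'" unfolding h_def using k s b component[of b'] by (auto simp: hom_iff)
    have "\<tau> b' \<cdot>\<^bsub>B\<^esub> onA F (onA G h) = h \<cdot>\<^bsub>B\<^esub> \<tau> b"
      using naturality[OF h] by simp
    also have "\<dots> = \<tau> b' \<cdot>\<^bsub>B\<^esub> (onA F k \<cdot>\<^bsub>B\<^esub> (s \<cdot>\<^bsub>B\<^esub> \<tau> b))"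
      unfolding h_def using k s(1) b component[of b'] component[of b] by (auto simp: hom_iff)
    also have "\<dots> = \<tau> b' \<cdot>\<^bsub>B\<^esub> onA F k"
      unfolding s(2) using k by (auto simp: hom_iff)
    finally have "onA F (onA G h) = onA F k"
      using F.dom.iso_cancel_left[OF iso[OF b(2)] comp_hom[OF b(2)]] h k
        Fu.pres_hom[OF Gu.pres_hom[OF h]] Fu.pres_hom[OF k] by simp
    then show ?thesis
      using quasi_inverse_faithful[OF assms Gu.pres_hom[OF h] k] h by blast
  qed
  moreover have "inj_on (onA G) (hom B b b')"
    using quasi_inverse_faithful[OF quasi_inverse_sym[OF assms]] by (auto intro!: inj_onI)
  ultimately show "bij_betw (onA G) (hom B b b') (hom A (onO G b) (onO G b'))"
    using Gu.pres_hom by (auto simp: bij_betw_def)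
qed

text \<open>The two isomorphisms of a quasi-inverse may violate the triangle identities, so they do
  not serve directly as unit and counit. The adjunction comes instead from the full faithfulness of
  G, followed by precomposition with s. By symmetry the quasi-inverse is adjoint on both
  sides.\<close>

lemma quasi_inverse_adjoint:
  assumes "quasi_inverse A B F G"
  shows "adjoint A B F G"
proof -
  obtain s where "niso A A fid (G \<odot> F) s"
    using assms naturally_isomorphicE natiso_sym unfolding quasi_inverse_def by metis
  then interpret niso A A fid "G \<odot> F" s .
  interpret Fu: fnctr A B F using assms is_functor_fnctr unfolding quasi_inverse_def by blast
  interpret Gu: fnctr B A G using assms is_functor_fnctr unfolding quasi_inverse_def by blast
  show ?thesis
  proof (rule adjointI_phi[OF Fu.fnctr Gu.fnctr])
    fix a b assume a: "a \<in> Obj A" "b \<in> Obj B"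
    have "bij_betw (onA G) (hom B (onO F a) b) (hom A (onO G (onO F a)) (onO G b))"
      using quasi_inverse_fully_faithful[OF assms] a by (simp add: fully_faithful_def)
    moreover have "bij_betw (\<lambda>h. h \<cdot>\<^bsub>A\<^esub> s a) (hom A (onO G (onO F a)) (onO G b)) (hom A a (onO G b))"
      by (rule F.dom.precomp_bij[OF iso[OF a(1)]]) (use comp_hom[OF a(1)] in simp)
    ultimately show "bij_betw ((\<lambda>h. h \<cdot>\<^bsub>A\<^esub> s a) \<circ> onA G) (hom B (onO F a) b) (hom A a (onO G b))"
      by (rule bij_betw_trans)
  next
    fix a a' b b' u k h
    assume a: "u \<in> hom A a' a" "k \<in> hom B b b'" "h \<in> hom B (onO F a) b"
    then have o: "a \<in> Obj A" "a' \<in> Obj A" by (auto simp: hom_iff)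
    note s = component[OF o(1)] component[OF o(2)]
    have "onA G (k \<cdot>\<^bsub>B\<^esub> (h \<cdot>\<^bsub>B\<^esub> onA F u)) \<cdot>\<^bsub>A\<^esub> s a'
        = onA G k \<cdot>\<^bsub>A\<^esub> (onA G h \<cdot>\<^bsub>A\<^esub> (onA (G \<odot> F) u \<cdot>\<^bsub>A\<^esub> s a'))"
      using a s by (auto simp: hom_iff)
    also have "\<dots> = onA G k \<cdot>\<^bsub>A\<^esub> (onA G h \<cdot>\<^bsub>A\<^esub> s a \<cdot>\<^bsub>A\<^esub> u)"
      unfolding naturality[OF a(1), symmetric] by simp
    finally show "((\<lambda>h. h \<cdot>\<^bsub>A\<^esub> s a') \<circ> onA G) (k \<cdot>\<^bsub>B\<^esub> (h \<cdot>\<^bsub>B\<^esub> onA F u))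
        = onA G k \<cdot>\<^bsub>A\<^esub> (((\<lambda>h. h \<cdot>\<^bsub>A\<^esub> s a) \<circ> onA G) h \<cdot>\<^bsub>A\<^esub> u)"
      using a s by (auto simp: hom_iff)
  qed
qed

text \<open>Yoneda applied to hom(a, b), hom(I a, I b) and hom(a, R (I b)), the first bijection
  being full faithfulness and the second the adjunction.\<close>

lemma coreflection_natiso:
  assumes "adjoint M P I R" "fully_faithful M P I"
  shows "naturally_isomorphic M M (R \<odot> I) fid"
proof -
  obtain \<phi> \<psi> where "hom_adjn M P I R \<phi> \<psi>" using adjointE[OF assms(1)] .
  then interpret hom_adjn M P I R \<phi> \<psi> .
  show ?thesis
  proof (rule natiso_sym, rule natiso_of_covariant_homs)
    fix a b assume o: "a \<in> Obj M" "b \<in> Obj M"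
    then have "bij_betw (onA I) (hom M a b) (hom P (onO I a) (onO I b))"
      using assms(2) by (simp add: fully_faithful_def)
    from bij_betw_trans[OF this phi_bij[of a "onO I b"]] o
    show "bij_betw (\<phi> a (onO I b) \<circ> onA I) (hom M a (onO fid b)) (hom M a (onO (R \<odot> I) b))"
      by simp
  next
    fix a a' b b' u k h
    assume "u \<in> hom M a' a" "k \<in> hom M b b'" "h \<in> hom M a (onO fid b)"
    then show "(\<phi> a' (onO I b') \<circ> onA I) (onA fid k \<cdot>\<^bsub>M\<^esub> (h \<cdot>\<^bsub>M\<^esub> u))
      = onA (R \<odot> I) k \<cdot>\<^bsub>M\<^esub> ((\<phi> a (onO I b) \<circ> onA I) h \<cdot>\<^bsub>M\<^esub> u)"
      using phi_nat[OF _ F.pres_hom F.pres_hom] by (auto simp: hom_iff)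
  qed (auto intro: is_functor_fid is_functor_fcomp F.fnctr G.fnctr F.dom.category_axioms)
qed

lemma terminal_unique:
  assumes "is_terminal A t" "f \<in> hom A a t" "g \<in> hom A a t" "a \<in> Obj A"
  shows "f = g"
  using assms by (auto simp: is_terminal_def)

lemma right_adjoint_terminal:
  assumes "adjoint A B F G" "is_terminal B t"
  shows "is_terminal A (onO G t)"
proof -
  obtain \<phi> \<psi> where "hom_adjn A B F G \<phi> \<psi>" using adjointE[OF assms(1)] .
  then interpret hom_adjn A B F G \<phi> \<psi> .
  have t: "t \<in> Obj B" using assms(2) by (simp add: is_terminal_def)
  have "\<exists>!h. h \<in> hom A a (onO G t)" if a: "a \<in> Obj A" for a
  proof (rule ex_ex1I)
    show "\<exists>h. h \<in> hom A a (onO G t)"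
      using assms(2) F.obj[OF a] phi_hom[OF a] unfolding is_terminal_def by blast
  next
    fix h h' assume h: "h \<in> hom A a (onO G t)" "h' \<in> hom A a (onO G t)"
    have "\<psi> a t h = \<psi> a t h'"
      using terminal_unique[OF assms(2) psi_hom[OF t h(1)] psi_hom[OF t h(2)]] a by simp
    then show "h = h'" using phi_psi[OF t h(1)] phi_psi[OF t h(2)] by metis
  qed
  then show ?thesis using t by (simp add: is_terminal_def)
qed

section \<open>Reflective subcategories\<close>

locale reflective = adjn +
  assumes ff: "fully_faithful B A G"
begin

lemma full:
  assumes "k \<in> hom A (onO G b) (onO G b')" "b \<in> Obj B" "b' \<in> Obj B"
  obtains h where "h \<in> hom B b b'" "onA G h = k"
proof -
  have "onA G ` hom B b b' = hom A (onO G b) (onO G b')"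
    using ff assms(2,3) by (simp add: fully_faithful_def bij_betw_def)
  then show ?thesis using assms(1) that by (metis imageE)
qed

lemma faithful:
  assumes "h \<in> hom B b b'" "h' \<in> hom B b b'" "onA G h = onA G h'"
  shows "h = h'"
proof -
  have "inj_on (onA G) (hom B b b')"
    using ff F.cod.hom_obj[OF assms(1)] by (simp add: fully_faithful_def bij_betw_def)
  then show ?thesis using assms by (auto dest: inj_onD)
qed

text \<open>A retraction r of the unit is already an inverse: by fullness \<eta> r is G k for some
  k, and G k \<eta> = \<eta> r \<eta> = \<eta> forces k to be the identity, by uniqueness of
  transposes.\<close>

lemma eta_iso:
  assumes a: "a \<in> Obj A" and r: "r \<in> hom A (onO G (onO F a)) a" "r \<cdot>\<^bsub>A\<^esub> \<eta> a = Ide A a"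
  shows "is_iso A (\<eta> a)"
proof -
  have "\<eta> a \<cdot>\<^bsub>A\<^esub> r \<in> hom A (onO G (onO F a)) (onO G (onO F a))"
    using a r(1) by (auto simp: hom_iff)
  then obtain k where k: "k \<in> hom B (onO F a) (onO F a)" "onA G k = \<eta> a \<cdot>\<^bsub>A\<^esub> r"
    using full a by (metis F.obj)
  have "onA G k \<cdot>\<^bsub>A\<^esub> \<eta> a = \<eta> a \<cdot>\<^bsub>A\<^esub> (r \<cdot>\<^bsub>A\<^esub> \<eta> a)"
    unfolding k(2) using r(1) a by (auto simp: hom_iff)
  also have "\<dots> = onA G (Ide B (onO F a)) \<cdot>\<^bsub>A\<^esub> \<eta> a" using r(2) a by simp
  finally have "k = Ide B (onO F a)"
    by (rule transpose_eqD[OF a k(1) F.cod.ide_in[OF F.obj[OF a]]])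
  then have "\<eta> a \<cdot>\<^bsub>A\<^esub> r = Ide A (onO G (onO F a))" using k(2) a by simp
  then show ?thesis using F.dom.isoI[OF _ r(1)] r(2) a by (simp add: hom_iff)
qed

text \<open>The unique map back to t is a retraction of the unit, so t is isomorphic to an object of
  the subcategory. This supplies the existence of terminal objects on which the choice in
  \<open>top_ob\<close> depends.\<close>

lemma reflector_terminal:
  assumes t: "is_terminal A t"
  shows "is_terminal B (onO F t)"
proof -
  have o: "t \<in> Obj A" using t by (simp add: is_terminal_def)
  then obtain r where r: "r \<in> hom A (onO G (onO F t)) t"
    using t unfolding is_terminal_def by (metis F.obj G.obj)
  have "r \<cdot>\<^bsub>A\<^esub> \<eta> t = Ide A t"
    by (rule terminal_unique[OF t _ F.dom.ide_in[OF o] o]) (use r o in \<open>simp add: hom_iff\<close>)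
  then have \<eta>: "is_iso A (\<eta> t)" by (rule eta_iso[OF o r])
  have "\<exists>!h. h \<in> hom B b (onO F t)" if b: "b \<in> Obj B" for b
  proof (rule ex_ex1I)
    obtain v where "v \<in> hom A (onO G b) t"
      using t b unfolding is_terminal_def by (metis G.obj)
    then have "\<eta> t \<cdot>\<^bsub>A\<^esub> v \<in> hom A (onO G b) (onO G (onO F t))"
      using o by (simp add: hom_iff)
    then show "\<exists>h. h \<in> hom B b (onO F t)" using full b o by (metis F.obj)
  next
    fix h h' assume h: "h \<in> hom B b (onO F t)" "h' \<in> hom B b (onO F t)"
    obtain s where s: "s \<in> hom A (onO G (onO F t)) t" "\<eta> t \<cdot>\<^bsub>A\<^esub> s = Ide A (onO G (onO F t))"
      using F.dom.isoE[OF \<eta>, of t "onO G (onO F t)"] o by (auto simp: hom_iff)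
    have "s \<cdot>\<^bsub>A\<^esub> onA G h = s \<cdot>\<^bsub>A\<^esub> onA G h'"
      by (rule terminal_unique[OF t, of _ "onO G b"]) (use s h b in \<open>auto simp: hom_iff\<close>)
    then have "(\<eta> t \<cdot>\<^bsub>A\<^esub> s) \<cdot>\<^bsub>A\<^esub> onA G h = (\<eta> t \<cdot>\<^bsub>A\<^esub> s) \<cdot>\<^bsub>A\<^esub> onA G h'"
      using s(1) h o by (auto simp: hom_iff)
    then have "onA G h = onA G h'" unfolding s(2) using h o by (auto simp: hom_iff)
    then show "h = h'" by (rule faithful[OF h])
  qed
  then show ?thesis using o by (simp add: is_terminal_def)
qed

end

section \<open>Cartesian closed categories\<close>

context cartesian_closed
begin

lemma proj_simps [simp]:
  assumes "a \<in> Obj A" "b \<in> Obj A"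
  shows "prd K a b \<in> Obj A" "xpn K a b \<in> Obj A"
    "prj1 K a b \<in> Arr A" "Dom A (prj1 K a b) = prd K a b" "Cod A (prj1 K a b) = a"
    "prj2 K a b \<in> Arr A" "Dom A (prj2 K a b) = prd K a b" "Cod A (prj2 K a b) = b"
    "evl K a b \<in> Arr A" "Dom A (evl K a b) = prd K (xpn K a b) a" "Cod A (evl K a b) = b"
  using prd_in prj1_in prj2_in xpn_in evl_in assms by (auto simp: hom_iff)

lemma prd_ext:
  assumes "h \<in> hom A c (prd K a b)" "h' \<in> hom A c (prd K a b)" "a \<in> Obj A" "b \<in> Obj A"
    and "prj1 K a b \<cdot> h = prj1 K a b \<cdot> h'" "prj2 K a b \<cdot> h = prj2 K a b \<cdot> h'"
  shows "h = h'"
proof -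
  have "prj1 K a b \<cdot> h \<in> hom A c a" "prj2 K a b \<cdot> h \<in> hom A c b"
    using assms(1,3,4) by (auto simp: hom_iff)
  from prd_universal[OF this] show ?thesis using assms by metis
qed

lemma tuple:
  assumes "u \<in> hom A c a" "v \<in> hom A c b"
  shows "tuple A K u v \<in> hom A c (prd K a b)"
    "prj1 K a b \<cdot> tuple A K u v = u" "prj2 K a b \<cdot> tuple A K u v = v"
proof -
  have "tuple A K u v = (THE h. h \<in> hom A c (prd K a b) \<and> prj1 K a b \<cdot> h = u \<and> prj2 K a b \<cdot> h = v)"
    using assms by (simp add: tuple_def hom_iff)
  with theI'[OF prd_universal[OF assms]] show "tuple A K u v \<in> hom A c (prd K a b)"
    "prj1 K a b \<cdot> tuple A K u v = u" "prj2 K a b \<cdot> tuple A K u v = v" by simp_all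
qed

lemma prd_arr:
  assumes "u \<in> hom A a a'" "v \<in> hom A b b'"
  shows "prd_arr A K u v \<in> hom A (prd K a b) (prd K a' b')"
    and "prj1 K a' b' \<cdot> prd_arr A K u v = u \<cdot> prj1 K a b"
    and "prj2 K a' b' \<cdot> prd_arr A K u v = v \<cdot> prj2 K a b"
proof -
  have "u \<cdot> prj1 K a b \<in> hom A (prd K a b) a'" "v \<cdot> prj2 K a b \<in> hom A (prd K a b) b'"
    using assms by (auto simp: hom_iff)
  from tuple[OF this] show "prd_arr A K u v \<in> hom A (prd K a b) (prd K a' b')"
    "prj1 K a' b' \<cdot> prd_arr A K u v = u \<cdot> prj1 K a b"
    "prj2 K a' b' \<cdot> prd_arr A K u v = v \<cdot> prj2 K a b"
    using assms by (simp_all add: prd_arr_def hom_iff)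
qed

lemma prd_arr_ide:
  assumes "a \<in> Obj A" "b \<in> Obj A"
  shows "prd_arr A K (Ide A a) (Ide A b) = Ide A (prd K a b)"
  by (rule prd_ext[OF prd_arr(1)[OF ide_in ide_in]])
    (use assms prd_arr[OF ide_in ide_in] in \<open>auto simp: hom_iff\<close>)

lemma prd_arr_comp:
  assumes "u \<in> hom A a a'" "v \<in> hom A b b'" "u' \<in> hom A a' a''" "v' \<in> hom A b' b''"
  shows "prd_arr A K (u' \<cdot> u) (v' \<cdot> v) = prd_arr A K u' v' \<cdot> prd_arr A K u v"
proof -
  have o: "a' \<in> Obj A" "a'' \<in> Obj A" "b' \<in> Obj A" "b'' \<in> Obj A" "a \<in> Obj A" "b \<in> Obj A"
    using assms by (auto simp: hom_iff)
  note p = prd_arr[OF assms(1,2)]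
  note p' = prd_arr[OF assms(3,4)]
  note p'' = prd_arr[OF comp_in[OF assms(1,3)] comp_in[OF assms(2,4)]]
  have "prj1 K a'' b'' \<cdot> (prd_arr A K u' v' \<cdot> prd_arr A K u v)
      = (prj1 K a'' b'' \<cdot> prd_arr A K u' v') \<cdot> prd_arr A K u v"
    using o p(1) p'(1) by (simp add: hom_iff)
  also have "\<dots> = u' \<cdot> (prj1 K a' b' \<cdot> prd_arr A K u v)"
    unfolding p'(2) using o p(1) assms by (simp add: hom_iff)
  also have "\<dots> = (u' \<cdot> u) \<cdot> prj1 K a b"
    unfolding p(2) using o assms by (simp add: hom_iff)
  finally have 1: "prj1 K a'' b'' \<cdot> (prd_arr A K u' v' \<cdot> prd_arr A K u v) = (u' \<cdot> u) \<cdot> prj1 K a b" .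
  have "prj2 K a'' b'' \<cdot> (prd_arr A K u' v' \<cdot> prd_arr A K u v)
      = (prj2 K a'' b'' \<cdot> prd_arr A K u' v') \<cdot> prd_arr A K u v"
    using o p(1) p'(1) by (simp add: hom_iff)
  also have "\<dots> = v' \<cdot> (prj2 K a' b' \<cdot> prd_arr A K u v)"
    unfolding p'(3) using o p(1) assms by (simp add: hom_iff)
  also have "\<dots> = (v' \<cdot> v) \<cdot> prj2 K a b"
    unfolding p(3) using o assms by (simp add: hom_iff)
  finally have 2: "prj2 K a'' b'' \<cdot> (prd_arr A K u' v' \<cdot> prd_arr A K u v) = (v' \<cdot> v) \<cdot> prj2 K a b" .
  show ?thesis
    by (rule prd_ext[OF p''(1) comp_in[OF p(1) p'(1)] o(2,4)]) (simp_all only: 1 2 p'')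
qed

section \<open>Products and exponentials as functors\<close>

lemma prd_left_simps [simp]:
  "onO (prd_left A K a) b = prd K a b" "onA (prd_left A K a) v = prd_arr A K (Ide A a) v"
  by (simp_all add: prd_left_def)

lemma prd_right_simps [simp]:
  "onO (prd_right A K b) a = prd K a b" "onA (prd_right A K b) u = prd_arr A K u (Ide A b)"
  by (simp_all add: prd_right_def)

lemma prd_left_functor:
  assumes a: "a \<in> Obj A"
  shows "is_functor A A (prd_left A K a)"
proof (rule is_functorI)
  fix f g assume fg: "f \<in> Arr A" "g \<in> Arr A" "Dom A g = Cod A f"
  show "onA (prd_left A K a) (g \<cdot> f) = onA (prd_left A K a) g \<cdot> onA (prd_left A K a) f"
    using prd_arr_comp[OF ide_in[OF a] in_hom[OF fg(1)] ide_in[OF a], of g "Cod A g"] a fg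
    by (simp add: hom_iff)
qed (use a in \<open>simp_all add: category_axioms prd_arr_ide prd_arr(1)[OF ide_in in_hom]\<close>)

lemma prd_right_functor:
  assumes b: "b \<in> Obj A"
  shows "is_functor A A (prd_right A K b)"
proof (rule is_functorI)
  fix f g assume fg: "f \<in> Arr A" "g \<in> Arr A" "Dom A g = Cod A f"
  show "onA (prd_right A K b) (g \<cdot> f) = onA (prd_right A K b) g \<cdot> onA (prd_right A K b) f"
    using prd_arr_comp[OF in_hom[OF fg(1)] ide_in[OF b] _ ide_in[OF b], of g "Cod A g"] b fg
    by (simp add: hom_iff)
qed (use b in \<open>simp_all add: category_axioms prd_arr_ide prd_arr(1)[OF in_hom ide_in]\<close>)

lemma curry:
  assumes "a \<in> Obj A" "c \<in> Obj A" "g \<in> hom A (prd K c a) b"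
  shows "\<exists>!h. h \<in> hom A c (xpn K a b) \<and> evl K a b \<cdot> prd_arr A K h (Ide A a) = g"
  using xpn_universal[OF assms(1) _ assms(2,3)] hom_obj(2)[OF assms(3)] by simp

lemma xpn_from_arr:
  assumes "a \<in> Obj A" "v \<in> hom A b b'"
  shows "onA (xpn_from A K a) v \<in> hom A (xpn K a b) (xpn K a b')"
    and "evl K a b' \<cdot> prd_arr A K (onA (xpn_from A K a) v) (Ide A a) = v \<cdot> evl K a b"
proof -
  have b: "b \<in> Obj A" using assms by (auto simp: hom_iff)
  have "v \<cdot> evl K a b \<in> hom A (prd K (xpn K a b) a) b'"
    using assms b by (auto simp: hom_iff)
  from theI'[OF curry[OF assms(1) _ this]] assms b
  show "onA (xpn_from A K a) v \<in> hom A (xpn K a b) (xpn K a b')"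
    "evl K a b' \<cdot> prd_arr A K (onA (xpn_from A K a) v) (Ide A a) = v \<cdot> evl K a b"
    by (auto simp: xpn_from_def hom_iff)
qed

lemma xpn_ext:
  assumes "a \<in> Obj A" "b \<in> Obj A" "h \<in> hom A c (xpn K a b)" "h' \<in> hom A c (xpn K a b)"
    and "evl K a b \<cdot> prd_arr A K h (Ide A a) = evl K a b \<cdot> prd_arr A K h' (Ide A a)"
  shows "h = h'"
proof -
  have c: "c \<in> Obj A" using assms(3) by (auto simp: hom_iff)
  have "evl K a b \<cdot> prd_arr A K h' (Ide A a) \<in> hom A (prd K c a) b"
    using prd_arr(1)[OF assms(4) ide_in[OF assms(1)]] assms(1,2) by (simp add: hom_iff)
  from curry[OF assms(1) c this] show ?thesis using assms(3-5) by metis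
qed

lemma evl_prd_arr_comp:
  assumes "a \<in> Obj A" "b \<in> Obj A" "u \<in> hom A c' c" "h \<in> hom A c (xpn K a b)"
  shows "evl K a b \<cdot> prd_arr A K (h \<cdot> u) (Ide A a)
    = (evl K a b \<cdot> prd_arr A K h (Ide A a)) \<cdot> prd_arr A K u (Ide A a)"
  using prd_arr_comp[OF assms(3) ide_in[OF assms(1)] assms(4) ide_in[OF assms(1)]]
    prd_arr(1)[OF assms(3) ide_in[OF assms(1)]] prd_arr(1)[OF assms(4) ide_in[OF assms(1)]] assms(1,2)
  by (simp add: hom_iff)

lemma evl_xpn_from_comp:
  assumes "a \<in> Obj A" "v \<in> hom A b b'" "h \<in> hom A c (xpn K a b)"
  shows "evl K a b' \<cdot> prd_arr A K (onA (xpn_from A K a) v \<cdot> h) (Ide A a)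
    = v \<cdot> (evl K a b \<cdot> prd_arr A K h (Ide A a))"
proof -
  have b: "b \<in> Obj A" "b' \<in> Obj A" using assms(2) by (auto simp: hom_iff)
  show ?thesis
    using evl_prd_arr_comp[OF assms(1) b(2) assms(3) xpn_from_arr(1)[OF assms(1,2)]]
      prd_arr(1)[OF assms(3) ide_in[OF assms(1)]] assms(1,2) b
    unfolding xpn_from_arr(2)[OF assms(1,2)] by (simp add: hom_iff)
qed

lemma xpn_from_obj [simp]: "onO (xpn_from A K a) b = xpn K a b"
  by (simp add: xpn_from_def)

lemma xpn_from_functor:
  assumes a: "a \<in> Obj A"
  shows "is_functor A A (xpn_from A K a)"
proof (rule is_functorI)
  fix b assume b: "b \<in> Obj A"
  show "onA (xpn_from A K a) (Ide A b) = Ide A (onO (xpn_from A K a) b)"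
    using xpn_ext[OF a b xpn_from_arr(1)[OF a ide_in[OF b]] ide_in]
      xpn_from_arr(2)[OF a ide_in[OF b]] a b by (simp add: prd_arr_ide)
next
  fix f g assume fg: "f \<in> Arr A" "g \<in> Arr A" "Dom A g = Cod A f"
  then have f: "f \<in> hom A (Dom A f) (Cod A f)" and g: "g \<in> hom A (Cod A f) (Cod A g)"
    and o: "Dom A f \<in> Obj A" "Cod A f \<in> Obj A" "Cod A g \<in> Obj A"
    by (auto simp: hom_iff)
  note xf = xpn_from_arr[OF a f] and xg = xpn_from_arr[OF a g]
    and xgf = xpn_from_arr[OF a comp_in[OF f g]]
  show "onA (xpn_from A K a) (g \<cdot> f) = onA (xpn_from A K a) g \<cdot> onA (xpn_from A K a) f"
    by (rule xpn_ext[OF a o(3) xgf(1) comp_in[OF xf(1) xg(1)]])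
      (unfold xgf(2) evl_xpn_from_comp[OF a g xf(1)] xf(2), use f g a o in \<open>simp add: hom_iff\<close>)
qed (use a in \<open>simp_all add: category_axioms xpn_from_arr(1)[OF _ in_hom]\<close>)

lemma xpn_adjoint:
  assumes a: "a \<in> Obj A"
  shows "adjoint A A (prd_right A K a) (xpn_from A K a)"
proof (rule adjointI_psi[OF prd_right_functor[OF a] xpn_from_functor[OF a],
      where \<psi> = "\<lambda>c b h. evl K a b \<cdot> prd_arr A K h (Ide A a)"])
  fix c b assume cb: "c \<in> Obj A" "b \<in> Obj A"
  have hom: "evl K a b \<cdot> prd_arr A K h (Ide A a) \<in> hom A (prd K c a) b"
    if "h \<in> hom A c (xpn K a b)" for h
    using prd_arr(1)[OF that ide_in[OF a]] a cb by (simp add: hom_iff)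
  have "\<exists>h \<in> hom A c (xpn K a b). g = evl K a b \<cdot> prd_arr A K h (Ide A a)"
    if "g \<in> hom A (prd K c a) b" for g
    using curry[OF a cb(1) that] by blast
  then have "(\<lambda>h. evl K a b \<cdot> prd_arr A K h (Ide A a)) ` hom A c (xpn K a b) = hom A (prd K c a) b"
    using hom by blast
  moreover have "inj_on (\<lambda>h. evl K a b \<cdot> prd_arr A K h (Ide A a)) (hom A c (xpn K a b))"
    using xpn_ext[OF a cb(2)] by (auto intro!: inj_onI)
  ultimately show "bij_betw (\<lambda>h. evl K a b \<cdot> prd_arr A K h (Ide A a))
      (hom A c (onO (xpn_from A K a) b)) (hom A (onO (prd_right A K a) c) b)"
    by (simp add: bij_betw_def)
next
  fix c c' b b' u k g
  assume u: "u \<in> hom A c' c" and k: "k \<in> hom A b b'" and g: "g \<in> hom A c (onO (xpn_from A K a) b)"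
  then have g: "g \<in> hom A c (xpn K a b)" and b: "b \<in> Obj A" by (auto simp: hom_iff)
  show "evl K a b' \<cdot> prd_arr A K (onA (xpn_from A K a) k \<cdot> (g \<cdot> u)) (Ide A a)
      = k \<cdot> ((evl K a b \<cdot> prd_arr A K g (Ide A a)) \<cdot> onA (prd_right A K a) u)"
    using evl_xpn_from_comp[OF a k comp_in[OF u g]] evl_prd_arr_comp[OF a b u g] by simp
qed

lemma swap_hom:
  assumes "a \<in> Obj A" "b \<in> Obj A"
  shows "tuple A K (prj2 K a b) (prj1 K a b) \<in> hom A (prd K a b) (prd K b a)"
    and "prj1 K b a \<cdot> tuple A K (prj2 K a b) (prj1 K a b) = prj2 K a b"
    and "prj2 K b a \<cdot> tuple A K (prj2 K a b) (prj1 K a b) = prj1 K a b"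
  using tuple[OF prj2_in prj1_in] assms by simp_all

lemma swap_swap:
  assumes "a \<in> Obj A" "b \<in> Obj A"
  shows "tuple A K (prj2 K b a) (prj1 K b a) \<cdot> tuple A K (prj2 K a b) (prj1 K a b) = Ide A (prd K a b)"
proof -
  note s = swap_hom[OF assms] and t = swap_hom[OF assms(2,1)]
  let ?s = "tuple A K (prj2 K a b) (prj1 K a b)" and ?t = "tuple A K (prj2 K b a) (prj1 K b a)"
  have "prj1 K a b \<cdot> (?t \<cdot> ?s) = (prj1 K a b \<cdot> ?t) \<cdot> ?s" "prj2 K a b \<cdot> (?t \<cdot> ?s) = (prj2 K a b \<cdot> ?t) \<cdot> ?s"
    using s(1) t(1) assms by (simp_all add: hom_iff)
  then show ?thesis
    by (intro prd_ext[OF comp_in[OF s(1) t(1)] ide_in]) (use s t assms in simp_all)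
qed

text \<open>Needed because the sides of the product matter: exponentials are right adjoint to
  \<open>prd_right\<close>, while the Frobenius law with fixed first argument, which introduces the
  slices, produces \<open>prd_left\<close>.\<close>

lemma prd_left_right:
  assumes a: "a \<in> Obj A"
  shows "naturally_isomorphic A A (prd_left A K a) (prd_right A K a)"
proof (rule naturally_isomorphicI[OF prd_left_functor[OF a] prd_right_functor[OF a],
      where \<tau> = "\<lambda>b. tuple A K (prj2 K a b) (prj1 K a b)"])
  fix b assume b: "b \<in> Obj A"
  show "is_iso A (tuple A K (prj2 K a b) (prj1 K a b))"
    using isoI[OF swap_hom(1)[OF a b] swap_hom(1)[OF b a]] swap_swap a b by simp
next
  fix b b' f assume f: "f \<in> hom A b b'"
  then have b: "b \<in> Obj A" "b' \<in> Obj A" by (auto simp: hom_iff)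
  let ?s = "\<lambda>b. tuple A K (prj2 K a b) (prj1 K a b)"
  note s = swap_hom[OF a b(1)] and s' = swap_hom[OF a b(2)]
    and l = prd_arr[OF ide_in[OF a] f] and r = prd_arr[OF f ide_in[OF a]]
  have "prj1 K b' a \<cdot> (?s b' \<cdot> prd_arr A K (Ide A a) f) = (prj1 K b' a \<cdot> ?s b') \<cdot> prd_arr A K (Ide A a) f"
    "prj2 K b' a \<cdot> (?s b' \<cdot> prd_arr A K (Ide A a) f) = (prj2 K b' a \<cdot> ?s b') \<cdot> prd_arr A K (Ide A a) f"
    using s'(1) l(1) a b by (simp_all add: hom_iff)
  moreover have "prj1 K b' a \<cdot> (prd_arr A K f (Ide A a) \<cdot> ?s b) = (prj1 K b' a \<cdot> prd_arr A K f (Ide A a)) \<cdot> ?s b"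
    "prj2 K b' a \<cdot> (prd_arr A K f (Ide A a) \<cdot> ?s b) = (prj2 K b' a \<cdot> prd_arr A K f (Ide A a)) \<cdot> ?s b"
    using s(1) r(1) a b by (simp_all add: hom_iff)
  moreover have "(f \<cdot> prj1 K b a) \<cdot> ?s b = f \<cdot> prj2 K a b" "(Ide A a \<cdot> prj2 K b a) \<cdot> ?s b = Ide A a \<cdot> prj1 K a b"
    using s f a b by (simp_all add: hom_iff)
  ultimately have "?s b' \<cdot> prd_arr A K (Ide A a) f = prd_arr A K f (Ide A a) \<cdot> ?s b"
    by (intro prd_ext[OF comp_in[OF l(1) s'(1)] comp_in[OF s(1) r(1)] b(2) a])
      (simp_all only: s' l r)
  then show "?s b' \<cdot> onA (prd_left A K a) f = onA (prd_right A K a) f \<cdot> ?s b" by simp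
qed (use swap_hom a in simp)

lemma prd_arr_iso:
  assumes "is_iso A u" "is_iso A v"
  shows "is_iso A (prd_arr A K u v)"
proof -
  have u: "u \<in> hom A (Dom A u) (Cod A u)" and v: "v \<in> hom A (Dom A v) (Cod A v)"
    using assms by (simp_all add: is_iso_def hom_iff)
  obtain u' where u': "u' \<in> hom A (Cod A u) (Dom A u)" "u' \<cdot> u = Ide A (Dom A u)" "u \<cdot> u' = Ide A (Cod A u)"
    using isoE[OF assms(1) u] .
  obtain v' where v': "v' \<in> hom A (Cod A v) (Dom A v)" "v' \<cdot> v = Ide A (Dom A v)" "v \<cdot> v' = Ide A (Cod A v)"
    using isoE[OF assms(2) v] .
  show ?thesis
    by (rule isoI[OF prd_arr(1)[OF u v] prd_arr(1)[OF u'(1) v'(1)]])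
      (use prd_arr_comp[OF u v u'(1) v'(1)] prd_arr_comp[OF u'(1) v'(1) u v] u' v' u v
        prd_arr_ide hom_obj[OF u] hom_obj[OF v] in simp_all)
qed

text \<open>Both composites equal \<open>prd_arr A K u f\<close>; this is the naturality of an arrow
  between the functors a \<times> - and a' \<times> -.\<close>

lemma prd_left_transf:
  assumes "u \<in> hom A a a'" "f \<in> hom A b b'"
  shows "prd_arr A K u (Ide A b') \<cdot> prd_arr A K (Ide A a) f = prd_arr A K (Ide A a') f \<cdot> prd_arr A K u (Ide A b)"
proof -
  have "prd_arr A K u (Ide A b') \<cdot> prd_arr A K (Ide A a) f = prd_arr A K u f"
    "prd_arr A K (Ide A a') f \<cdot> prd_arr A K u (Ide A b) = prd_arr A K u f"
    using prd_arr_comp[OF ide_in[of a] assms(2) assms(1) ide_in[of b']]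
      prd_arr_comp[OF assms(1) ide_in[of b] ide_in[of a'] assms(2)]
      hom_obj[OF assms(1)] hom_obj[OF assms(2)] comp_ide_right[OF assms(1)] comp_ide_left[OF assms(1)]
      comp_ide_left[OF assms(2)] comp_ide_right[OF assms(2)] by simp_all
  then show ?thesis by simp
qed

lemma prd_left_cong:
  assumes "is_iso A u" "u \<in> hom A a a'"
  shows "naturally_isomorphic A A (prd_left A K a) (prd_left A K a')"
proof (rule naturally_isomorphicI[where \<tau> = "\<lambda>b. prd_arr A K u (Ide A b)"])
  fix b assume "b \<in> Obj A"
  then show "prd_arr A K u (Ide A b) \<in> hom A (onO (prd_left A K a) b) (onO (prd_left A K a') b)"
    "is_iso A (prd_arr A K u (Ide A b))"
    using prd_arr(1)[OF assms(2) ide_in] prd_arr_iso[OF assms(1) iso_ide] by simp_all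
qed (use prd_left_functor hom_obj[OF assms(2)] prd_left_transf[OF assms(2)] in simp_all)

lemma prd_right_cong:
  assumes "is_iso A u" "u \<in> hom A a a'"
  shows "naturally_isomorphic A A (prd_right A K a) (prd_right A K a')"
  using natiso_trans[OF natiso_sym[OF prd_left_right] natiso_trans[OF prd_left_cong[OF assms] prd_left_right]]
    hom_obj[OF assms(2)] by simp

text \<open>The second projection is invertible: its inverse pairs the map to t with the identity.
  An arbitrary terminal object is allowed since the slices are built on the image of
  \<open>top_ob\<close> and not on \<open>trm K\<close>.\<close>

lemma prd_left_terminal:
  assumes t: "is_terminal A t"
  shows "naturally_isomorphic A A (prd_left A K t) fid"
proof -
  have o: "t \<in> Obj A" using t by (simp add: is_terminal_def)
  show ?thesis
  proof (rule naturally_isomorphicI[OF prd_left_functor[OF o] is_functor_fid, where \<tau> = "prj2 K t"])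
    fix b assume b: "b \<in> Obj A"
    obtain e where e: "e \<in> hom A b t" using t b by (auto simp: is_terminal_def)
    note s = tuple[OF e ide_in[OF b]]
    have "prj1 K t b \<cdot> (tuple A K e (Ide A b) \<cdot> prj2 K t b) = prj1 K t b \<cdot> Ide A (prd K t b)"
      by (rule terminal_unique[OF t, of _ "prd K t b"]) (use s(1) o b in \<open>auto simp: hom_iff\<close>)
    moreover have "prj2 K t b \<cdot> (tuple A K e (Ide A b) \<cdot> prj2 K t b)
        = (prj2 K t b \<cdot> tuple A K e (Ide A b)) \<cdot> prj2 K t b"
      using s(1) o b by (simp add: hom_iff)
    ultimately have "tuple A K e (Ide A b) \<cdot> prj2 K t b = Ide A (prd K t b)"
      by (intro prd_ext[OF comp_in[OF prj2_in[OF o b] s(1)] ide_in o b]) (use s(3) o b in simp_all)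
    then show "is_iso A (prj2 K t b)" using isoI[OF prj2_in[OF o b] s(1)] s(3) by simp
  next
    fix b b' f assume f: "f \<in> hom A b b'"
    show "prj2 K t b' \<cdot> onA (prd_left A K t) f = onA fid f \<cdot> prj2 K t b"
      using prd_arr(3)[OF ide_in[OF o] f] by simp
  qed (use prj2_in o in \<open>simp_all add: category_axioms\<close>)
qed

end

section \<open>Adjunctions between cartesian closed categories\<close>

locale ccc_adjn = adjn + dom_ccc: cartesian_closed A K + cod_ccc: cartesian_closed B K'
  for K K'
begin

text \<open>The canonical map from F (p \<times> G q) to F p \<times> q, written so that for F =
  \<open>Sig D f\<close> it is literally \<open>frobenius D f p q\<close> with its definition
  unfolded.\<close>

abbreviation frob where
  "frob p q \<equiv> tuple B K' (onA F (prj1 K p (onO G q))) (\<epsilon> q \<cdot>\<^bsub>B\<^esub> onA F (prj2 K p (onO G q)))"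

lemma frob:
  assumes "p \<in> Obj A" "q \<in> Obj B"
  shows "frob p q \<in> hom B (onO F (prd K p (onO G q))) (prd K' (onO F p) q)"
    and "prj1 K' (onO F p) q \<cdot>\<^bsub>B\<^esub> frob p q = onA F (prj1 K p (onO G q))"
    and "prj2 K' (onO F p) q \<cdot>\<^bsub>B\<^esub> frob p q = \<epsilon> q \<cdot>\<^bsub>B\<^esub> onA F (prj2 K p (onO G q))"
proof -
  have "onA F (prj1 K p (onO G q)) \<in> hom B (onO F (prd K p (onO G q))) (onO F p)"
    "\<epsilon> q \<cdot>\<^bsub>B\<^esub> onA F (prj2 K p (onO G q)) \<in> hom B (onO F (prd K p (onO G q))) q"
    using assms by (auto simp: hom_iff)
  from cod_ccc.tuple[OF this]
  show "frob p q \<in> hom B (onO F (prd K p (onO G q))) (prd K' (onO F p) q)"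
    "prj1 K' (onO F p) q \<cdot>\<^bsub>B\<^esub> frob p q = onA F (prj1 K p (onO G q))"
    "prj2 K' (onO F p) q \<cdot>\<^bsub>B\<^esub> frob p q = \<epsilon> q \<cdot>\<^bsub>B\<^esub> onA F (prj2 K p (onO G q))" .
qed

text \<open>Naturality in both arguments at once, so that putting an identity in either place yields
  the two functorial forms that follow.\<close>

lemma frob_natural:
  assumes u: "u \<in> hom A p p'" and w: "w \<in> hom B q q'"
  shows "frob p' q' \<cdot>\<^bsub>B\<^esub> onA F (prd_arr A K u (onA G w))
    = prd_arr B K' (onA F u) w \<cdot>\<^bsub>B\<^esub> frob p q"
proof -
  have o: "p \<in> Obj A" "p' \<in> Obj A" "q \<in> Obj B" "q' \<in> Obj B" using u w by (auto simp: hom_iff)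
  note fr = frob[OF o(1,3)] and fr' = frob[OF o(2,4)]
    and pa = dom_ccc.prd_arr[OF u G.pres_hom[OF w]] and pb = cod_ccc.prd_arr[OF F.pres_hom[OF u] w]
  let ?x = "prd_arr A K u (onA G w)" and ?y = "prd_arr B K' (onA F u) w"
  let ?l = "frob p' q' \<cdot>\<^bsub>B\<^esub> onA F ?x" and ?r = "?y \<cdot>\<^bsub>B\<^esub> frob p q"
  let ?p1 = "prj1 K' (onO F p') q'" and ?p2 = "prj2 K' (onO F p') q'"
  have "?p1 \<cdot>\<^bsub>B\<^esub> ?l = (?p1 \<cdot>\<^bsub>B\<^esub> frob p' q') \<cdot>\<^bsub>B\<^esub> onA F ?x"
    using fr'(1) pa(1) o by (simp add: hom_iff)
  also have "\<dots> = onA F (prj1 K p' (onO G q') \<cdot>\<^bsub>A\<^esub> ?x)"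
    unfolding fr'(2) using pa(1) o by (simp add: hom_iff)
  also have "\<dots> = onA F u \<cdot>\<^bsub>B\<^esub> onA F (prj1 K p (onO G q))"
    unfolding pa(2) using u o by (simp add: hom_iff)
  also have "\<dots> = onA F u \<cdot>\<^bsub>B\<^esub> (prj1 K' (onO F p) q \<cdot>\<^bsub>B\<^esub> frob p q)" unfolding fr(2) ..
  also have "\<dots> = (onA F u \<cdot>\<^bsub>B\<^esub> prj1 K' (onO F p) q) \<cdot>\<^bsub>B\<^esub> frob p q"
    using fr(1) u o by (simp add: hom_iff)
  also have "\<dots> = ?p1 \<cdot>\<^bsub>B\<^esub> ?r"
    unfolding pb(2)[symmetric] using fr(1) pb(1) o by (simp add: hom_iff)
  finally have 1: "?p1 \<cdot>\<^bsub>B\<^esub> ?l = ?p1 \<cdot>\<^bsub>B\<^esub> ?r" .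
  have "?p2 \<cdot>\<^bsub>B\<^esub> ?l = (?p2 \<cdot>\<^bsub>B\<^esub> frob p' q') \<cdot>\<^bsub>B\<^esub> onA F ?x"
    using fr'(1) pa(1) o by (simp add: hom_iff)
  also have "\<dots> = \<epsilon> q' \<cdot>\<^bsub>B\<^esub> onA F (prj2 K p' (onO G q') \<cdot>\<^bsub>A\<^esub> ?x)"
    unfolding fr'(3) using pa(1) o by (simp add: hom_iff)
  also have "\<dots> = (\<epsilon> q' \<cdot>\<^bsub>B\<^esub> onA F (onA G w)) \<cdot>\<^bsub>B\<^esub> onA F (prj2 K p (onO G q))"
    unfolding pa(3) using w o by (simp add: hom_iff)
  also have "\<dots> = w \<cdot>\<^bsub>B\<^esub> (prj2 K' (onO F p) q \<cdot>\<^bsub>B\<^esub> frob p q)"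
    unfolding eps_nat[OF w] fr(3) using w o by (simp add: hom_iff)
  also have "\<dots> = (w \<cdot>\<^bsub>B\<^esub> prj2 K' (onO F p) q) \<cdot>\<^bsub>B\<^esub> frob p q"
    using fr(1) w o by (simp add: hom_iff)
  also have "\<dots> = ?p2 \<cdot>\<^bsub>B\<^esub> ?r"
    unfolding pb(3)[symmetric] using fr(1) pb(1) o by (simp add: hom_iff)
  finally have 2: "?p2 \<cdot>\<^bsub>B\<^esub> ?l = ?p2 \<cdot>\<^bsub>B\<^esub> ?r" .
  show ?thesis
    by (rule cod_ccc.prd_ext[OF F.cod.comp_in[OF F.pres_hom[OF pa(1)] fr'(1)]
          F.cod.comp_in[OF fr(1) pb(1)] _ _ 1 2]) (use o in simp_all)
qed

lemma frob_prd_left: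
  assumes p: "p \<in> Obj A" and iso: "\<And>q. q \<in> Obj B \<Longrightarrow> is_iso B (frob p q)"
  shows "naturally_isomorphic B B (F \<odot> prd_left A K p \<odot> G) (prd_left B K' (onO F p))"
proof (rule naturally_isomorphicI[where \<tau> = "frob p"])
  fix q q' w assume w: "w \<in> hom B q q'"
  show "frob p q' \<cdot>\<^bsub>B\<^esub> onA (F \<odot> prd_left A K p \<odot> G) w
      = onA (prd_left B K' (onO F p)) w \<cdot>\<^bsub>B\<^esub> frob p q"
    using frob_natural[OF F.dom.ide_in[OF p] w] p by simp
next
  show "is_functor B B (F \<odot> prd_left A K p \<odot> G)"
    by (intro is_functor_fcomp[OF is_functor_fcomp[OF G.fnctr dom_ccc.prd_left_functor[OF p]] F.fnctr,
          unfolded fcomp_assoc])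
qed (use iso frob(1) p cod_ccc.prd_left_functor in simp_all)

lemma frob_prd_right:
  assumes q: "q \<in> Obj B" and iso: "\<And>p. p \<in> Obj A \<Longrightarrow> is_iso B (frob p q)"
  shows "naturally_isomorphic A B (F \<odot> prd_right A K (onO G q)) (prd_right B K' q \<odot> F)"
proof (rule naturally_isomorphicI[where \<tau> = "\<lambda>p. frob p q"])
  fix p p' u assume u: "u \<in> hom A p p'"
  show "frob p' q \<cdot>\<^bsub>B\<^esub> onA (F \<odot> prd_right A K (onO G q)) u
      = onA (prd_right B K' q \<odot> F) u \<cdot>\<^bsub>B\<^esub> frob p q"
    using frob_natural[OF u F.cod.ide_in[OF q]] q by simp
next
  show "is_functor A B (F \<odot> prd_right A K (onO G q))" "is_functor A B (prd_right B K' q \<odot> F)"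
    using is_functor_fcomp[OF dom_ccc.prd_right_functor F.fnctr]
      is_functor_fcomp[OF F.fnctr cod_ccc.prd_right_functor] q by simp_all
qed (use iso frob(1) q in simp_all)

abbreviation comparison where
  "comparison p q \<equiv> tuple A K (onA G (prj1 K' p q)) (onA G (prj2 K' p q))"

lemma comparison:
  assumes "p \<in> Obj B" "q \<in> Obj B"
  shows "comparison p q \<in> hom A (onO G (prd K' p q)) (prd K (onO G p) (onO G q))"
    and "prj1 K (onO G p) (onO G q) \<cdot>\<^bsub>A\<^esub> comparison p q = onA G (prj1 K' p q)"
    and "prj2 K (onO G p) (onO G q) \<cdot>\<^bsub>A\<^esub> comparison p q = onA G (prj2 K' p q)"
  using dom_ccc.tuple[OF G.pres_hom[OF cod_ccc.prj1_in[OF assms]] G.pres_hom[OF cod_ccc.prj2_in[OF assms]]] .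

text \<open>Transposition carries composition with G of a projection to composition with the
  projection itself, and in B the two projections are jointly monic.\<close>

lemma G_prd_ext:
  assumes o: "p \<in> Obj B" "q \<in> Obj B"
    and h: "h \<in> hom A c (onO G (prd K' p q))" "h' \<in> hom A c (onO G (prd K' p q))"
    and 1: "onA G (prj1 K' p q) \<cdot>\<^bsub>A\<^esub> h = onA G (prj1 K' p q) \<cdot>\<^bsub>A\<^esub> h'"
    and 2: "onA G (prj2 K' p q) \<cdot>\<^bsub>A\<^esub> h = onA G (prj2 K' p q) \<cdot>\<^bsub>A\<^esub> h'"
  shows "h = h'"
proof -
  interpret hom_adjn A B F G "\<lambda>a b h. onA G h \<cdot>\<^bsub>A\<^esub> \<eta> a" "\<lambda>a b g. \<epsilon> b \<cdot>\<^bsub>B\<^esub> onA F g"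
    by (rule hom_adjn)
  have pq: "prd K' p q \<in> Obj B" using o by simp
  note h1 = psi_hom[OF pq h(1)] and h2 = psi_hom[OF pq h(2)]
  have "\<epsilon> (prd K' p q) \<cdot>\<^bsub>B\<^esub> onA F h = \<epsilon> (prd K' p q) \<cdot>\<^bsub>B\<^esub> onA F h'"
    by (rule cod_ccc.prd_ext[OF h1 h2 o])
      (use psi_nat_cod[OF cod_ccc.prj1_in[OF o]] psi_nat_cod[OF cod_ccc.prj2_in[OF o]] h 1 2 in metis)+
  then show ?thesis using phi_psi[OF pq h(1)] phi_psi[OF pq h(2)] by metis
qed

lemma comparison_iso:
  assumes o: "p \<in> Obj B" "q \<in> Obj B"
  shows "is_iso A (comparison p q)"
proof -
  let ?a = "prd K (onO G p) (onO G q)"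
  have Go: "onO G p \<in> Obj A" "onO G q \<in> Obj A" "?a \<in> Obj A" using o by simp_all
  note pr = dom_ccc.prj1_in[OF Go(1,2)] dom_ccc.prj2_in[OF Go(1,2)]
  note t = cod_ccc.tuple[OF cotranspose_hom[OF o(1) pr(1)] cotranspose_hom[OF o(2) pr(2)]]
  \<comment> \<open>Right adjoints preserve products: the inverse of the comparison map is the
    transpose \<open>g\<close> of this s, which pairs the transposes of the two projections of G p
    \<times> G q.\<close>
  define s where "s = tuple B K' (\<epsilon> p \<cdot>\<^bsub>B\<^esub> onA F (prj1 K (onO G p) (onO G q)))
    (\<epsilon> q \<cdot>\<^bsub>B\<^esub> onA F (prj2 K (onO G p) (onO G q)))"
  note s = t[folded s_def]
  define g where "g = onA G s \<cdot>\<^bsub>A\<^esub> \<eta> ?a"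
  have g: "g \<in> hom A ?a (onO G (prd K' p q))"
    unfolding g_def using transpose_hom[OF Go(3) s(1)] .
  have "onA G (prj1 K' p q) \<cdot>\<^bsub>A\<^esub> g = onA G (prj1 K' p q \<cdot>\<^bsub>B\<^esub> s) \<cdot>\<^bsub>A\<^esub> \<eta> ?a"
    "onA G (prj2 K' p q) \<cdot>\<^bsub>A\<^esub> g = onA G (prj2 K' p q \<cdot>\<^bsub>B\<^esub> s) \<cdot>\<^bsub>A\<^esub> \<eta> ?a"
    unfolding g_def using s(1) o Go(3) by (simp_all add: hom_iff)
  then have g12: "onA G (prj1 K' p q) \<cdot>\<^bsub>A\<^esub> g = prj1 K (onO G p) (onO G q)"
    "onA G (prj2 K' p q) \<cdot>\<^bsub>A\<^esub> g = prj2 K (onO G p) (onO G q)"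
    unfolding s(2,3) using transpose_inverse_right[OF o(1) pr(1)] transpose_inverse_right[OF o(2) pr(2)]
    by simp_all
  note c = comparison[OF o]
  have "prj1 K (onO G p) (onO G q) \<cdot>\<^bsub>A\<^esub> (comparison p q \<cdot>\<^bsub>A\<^esub> g)
      = (prj1 K (onO G p) (onO G q) \<cdot>\<^bsub>A\<^esub> comparison p q) \<cdot>\<^bsub>A\<^esub> g"
    "prj2 K (onO G p) (onO G q) \<cdot>\<^bsub>A\<^esub> (comparison p q \<cdot>\<^bsub>A\<^esub> g)
      = (prj2 K (onO G p) (onO G q) \<cdot>\<^bsub>A\<^esub> comparison p q) \<cdot>\<^bsub>A\<^esub> g"
    using c(1) g Go by (simp_all add: hom_iff)
  then have cg: "comparison p q \<cdot>\<^bsub>A\<^esub> g = Ide A ?a"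
    by (intro dom_ccc.prd_ext[OF F.dom.comp_in[OF g c(1)] F.dom.ide_in[OF Go(3)] Go(1,2)])
      (use Go in \<open>simp_all add: c g12\<close>)
  have "onA G (prj1 K' p q) \<cdot>\<^bsub>A\<^esub> (g \<cdot>\<^bsub>A\<^esub> comparison p q)
      = (onA G (prj1 K' p q) \<cdot>\<^bsub>A\<^esub> g) \<cdot>\<^bsub>A\<^esub> comparison p q"
    "onA G (prj2 K' p q) \<cdot>\<^bsub>A\<^esub> (g \<cdot>\<^bsub>A\<^esub> comparison p q)
      = (onA G (prj2 K' p q) \<cdot>\<^bsub>A\<^esub> g) \<cdot>\<^bsub>A\<^esub> comparison p q"
    using c(1) g o by (simp_all add: hom_iff)
  then have "g \<cdot>\<^bsub>A\<^esub> comparison p q = Ide A (onO G (prd K' p q))"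
    by (intro G_prd_ext[OF o F.dom.comp_in[OF c(1) g] F.dom.ide_in]) (use o in \<open>simp_all add: c g12\<close>)
  then show ?thesis using F.dom.isoI[OF c(1) g] cg by simp
qed

lemma right_adjoint_prd:
  assumes q: "q \<in> Obj B"
  shows "naturally_isomorphic B A (G \<odot> prd_right B K' q) (prd_right A K (onO G q) \<odot> G)"
proof (rule naturally_isomorphicI[where \<tau> = "\<lambda>p. comparison p q"])
  fix p p' u assume u: "u \<in> hom B p p'"
  then have o: "p \<in> Obj B" "p' \<in> Obj B" by (auto simp: hom_iff)
  have Go: "onO G p' \<in> Obj A" "onO G q \<in> Obj A" "onO G p \<in> Obj A" using o q by simp_all
  note c = comparison[OF o(1) q] and c' = comparison[OF o(2) q]
    and pb = cod_ccc.prd_arr[OF u F.cod.ide_in[OF q]]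
    and pa = dom_ccc.prd_arr[OF G.pres_hom[OF u] F.dom.ide_in[OF Go(2)]]
  let ?y = "prd_arr B K' u (Ide B q)" and ?x = "prd_arr A K (onA G u) (Ide A (onO G q))"
  let ?p1 = "prj1 K (onO G p') (onO G q)" and ?p2 = "prj2 K (onO G p') (onO G q)"
  have "?p1 \<cdot>\<^bsub>A\<^esub> (comparison p' q \<cdot>\<^bsub>A\<^esub> onA G ?y) = (?p1 \<cdot>\<^bsub>A\<^esub> comparison p' q) \<cdot>\<^bsub>A\<^esub> onA G ?y"
    "?p2 \<cdot>\<^bsub>A\<^esub> (comparison p' q \<cdot>\<^bsub>A\<^esub> onA G ?y) = (?p2 \<cdot>\<^bsub>A\<^esub> comparison p' q) \<cdot>\<^bsub>A\<^esub> onA G ?y"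
    using c'(1) pb(1) o q by (simp_all add: hom_iff)
  moreover have "onA G (prj1 K' p' q) \<cdot>\<^bsub>A\<^esub> onA G ?y = onA G (prj1 K' p' q \<cdot>\<^bsub>B\<^esub> ?y)"
    "onA G (prj2 K' p' q) \<cdot>\<^bsub>A\<^esub> onA G ?y = onA G (prj2 K' p' q \<cdot>\<^bsub>B\<^esub> ?y)"
    using pb(1) o q by (simp_all add: hom_iff)
  ultimately have l: "?p1 \<cdot>\<^bsub>A\<^esub> (comparison p' q \<cdot>\<^bsub>A\<^esub> onA G ?y) = onA G u \<cdot>\<^bsub>A\<^esub> onA G (prj1 K' p q)"
    "?p2 \<cdot>\<^bsub>A\<^esub> (comparison p' q \<cdot>\<^bsub>A\<^esub> onA G ?y) = onA G (prj2 K' p q)"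
    using u o q by (simp_all add: c' pb hom_iff)
  have "?p1 \<cdot>\<^bsub>A\<^esub> (?x \<cdot>\<^bsub>A\<^esub> comparison p q) = (?p1 \<cdot>\<^bsub>A\<^esub> ?x) \<cdot>\<^bsub>A\<^esub> comparison p q"
    "?p2 \<cdot>\<^bsub>A\<^esub> (?x \<cdot>\<^bsub>A\<^esub> comparison p q) = (?p2 \<cdot>\<^bsub>A\<^esub> ?x) \<cdot>\<^bsub>A\<^esub> comparison p q"
    using c(1) pa(1) Go by (simp_all add: hom_iff)
  moreover have "(onA G u \<cdot>\<^bsub>A\<^esub> prj1 K (onO G p) (onO G q)) \<cdot>\<^bsub>A\<^esub> comparison p q
      = onA G u \<cdot>\<^bsub>A\<^esub> (prj1 K (onO G p) (onO G q) \<cdot>\<^bsub>A\<^esub> comparison p q)"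
    "(Ide A (onO G q) \<cdot>\<^bsub>A\<^esub> prj2 K (onO G p) (onO G q)) \<cdot>\<^bsub>A\<^esub> comparison p q
      = prj2 K (onO G p) (onO G q) \<cdot>\<^bsub>A\<^esub> comparison p q"
    using c(1) u Go o q by (simp_all add: hom_iff)
  ultimately have r: "?p1 \<cdot>\<^bsub>A\<^esub> (?x \<cdot>\<^bsub>A\<^esub> comparison p q) = onA G u \<cdot>\<^bsub>A\<^esub> onA G (prj1 K' p q)"
    "?p2 \<cdot>\<^bsub>A\<^esub> (?x \<cdot>\<^bsub>A\<^esub> comparison p q) = onA G (prj2 K' p q)"
    by (simp_all only: pa c)
  have "comparison p' q \<cdot>\<^bsub>A\<^esub> onA G ?y = ?x \<cdot>\<^bsub>A\<^esub> comparison p q"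
    by (rule dom_ccc.prd_ext[OF F.dom.comp_in[OF G.pres_hom[OF pb(1)] c'(1)]
          F.dom.comp_in[OF c(1) pa(1)] Go(1,2)]) (simp_all only: l r)
  then show "comparison p' q \<cdot>\<^bsub>A\<^esub> onA (G \<odot> prd_right B K' q) u
      = onA (prd_right A K (onO G q) \<odot> G) u \<cdot>\<^bsub>A\<^esub> comparison p q" by simp
next
  show "is_functor B A (G \<odot> prd_right B K' q)" "is_functor B A (prd_right A K (onO G q) \<odot> G)"
    using is_functor_fcomp[OF cod_ccc.prd_right_functor G.fnctr]
      is_functor_fcomp[OF G.fnctr dom_ccc.prd_right_functor] q by simp_all
qed (use q comparison(1) comparison_iso in simp_all)

end

locale reflective_ccc = reflective + cartesian_closed A K for K
begin

text \<open>A reflective subcategory is closed under products. By \<open>eta_iso\<close> a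
  retraction of the unit is enough.\<close>

lemma eta_prd_iso:
  assumes m: "m \<in> Obj B" "m' \<in> Obj B"
  shows "is_iso A (\<eta> (prd K (onO G m) (onO G m')))"
proof -
  let ?p = "prd K (onO G m) (onO G m')"
  let ?p1 = "prj1 K (onO G m) (onO G m')" and ?p2 = "prj2 K (onO G m) (onO G m')"
  have Go: "onO G m \<in> Obj A" "onO G m' \<in> Obj A" "?p \<in> Obj A" using m by simp_all
  note pr = prj1_in[OF Go(1,2)] prj2_in[OF Go(1,2)]
  note r = tuple[OF G.pres_hom[OF cotranspose_hom[OF m(1) pr(1)]]
      G.pres_hom[OF cotranspose_hom[OF m(2) pr(2)]]]
  \<comment> \<open>Each projection lands in the subcategory and so extends along the unit; the pair
    of these extensions is the retraction.\<close>
  define s where "s = tuple A K (onA G (\<epsilon> m \<cdot>\<^bsub>B\<^esub> onA F ?p1)) (onA G (\<epsilon> m' \<cdot>\<^bsub>B\<^esub> onA F ?p2))"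
  note s = r[folded s_def]
  have "?p1 \<cdot>\<^bsub>A\<^esub> (s \<cdot>\<^bsub>A\<^esub> \<eta> ?p) = (?p1 \<cdot>\<^bsub>A\<^esub> s) \<cdot>\<^bsub>A\<^esub> \<eta> ?p" "?p2 \<cdot>\<^bsub>A\<^esub> (s \<cdot>\<^bsub>A\<^esub> \<eta> ?p) = (?p2 \<cdot>\<^bsub>A\<^esub> s) \<cdot>\<^bsub>A\<^esub> \<eta> ?p"
    using s(1) Go by (simp_all add: hom_iff)
  then have "?p1 \<cdot>\<^bsub>A\<^esub> (s \<cdot>\<^bsub>A\<^esub> \<eta> ?p) = ?p1" "?p2 \<cdot>\<^bsub>A\<^esub> (s \<cdot>\<^bsub>A\<^esub> \<eta> ?p) = ?p2"
    unfolding s(2,3) transpose_inverse_right[OF m(1) pr(1)] transpose_inverse_right[OF m(2) pr(2)] .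
  moreover have "s \<cdot>\<^bsub>A\<^esub> \<eta> ?p \<in> hom A ?p ?p" using s(1) Go(3) by (simp add: hom_iff)
  ultimately have "s \<cdot>\<^bsub>A\<^esub> \<eta> ?p = Ide A ?p"
    by (intro prd_ext[OF _ F.dom.ide_in[OF Go(3)] Go(1,2)]) (use Go in simp_all)
  then show ?thesis by (rule eta_iso[OF Go(3) s(1)])
qed

lemma reflection_prd:
  assumes m: "m \<in> Obj B"
  shows "naturally_isomorphic B A (G \<odot> F \<odot> prd_left A K (onO G m) \<odot> G) (prd_left A K (onO G m) \<odot> G)"
proof (rule natiso_sym, rule naturally_isomorphicI[where \<tau> = "\<lambda>m'. \<eta> (prd K (onO G m) (onO G m'))"])
  have p: "is_functor A A (prd_left A K (onO G m))" using prd_left_functor m by simp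
  show pG: "is_functor B A (prd_left A K (onO G m) \<odot> G)" by (rule is_functor_fcomp[OF G.fnctr p])
  show "is_functor B A (G \<odot> F \<odot> prd_left A K (onO G m) \<odot> G)"
    by (rule is_functor_fcomp[OF is_functor_fcomp[OF pG F.fnctr] G.fnctr])
  fix a b f assume "f \<in> hom B a b"
  then have "onA (prd_left A K (onO G m) \<odot> G) f \<in> hom A (prd K (onO G m) (onO G a)) (prd K (onO G m) (onO G b))"
    using prd_arr(1)[OF F.dom.ide_in[of "onO G m"] G.pres_hom] m by simp
  from eta_nat[OF this]
  show "\<eta> (prd K (onO G m) (onO G b)) \<cdot>\<^bsub>A\<^esub> onA (prd_left A K (onO G m) \<odot> G) f
      = onA (G \<odot> F \<odot> prd_left A K (onO G m) \<odot> G) f \<cdot>\<^bsub>A\<^esub> \<eta> (prd K (onO G m) (onO G a))"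
    by simp
qed (use m eta_prd_iso in \<open>simp_all add: hom_iff\<close>)

end

section \<open>Multiplying by arrows that become invertible under a functor\<close>

context cartesian_closed
begin

text \<open>Invertibility is assumed only after applying H. With u a unit, H the reflector and I the
  other inclusion, the assumption is a mixed Frobenius law, and the conclusion is that law with its
  second factor varying.\<close>

lemma prd_left_natiso:
  assumes u: "u \<in> hom A a a'" and H: "is_functor A B H" and I: "is_functor N A I"
    and iso: "\<And>n. n \<in> Obj N \<Longrightarrow> is_iso B (onA H (prd_arr A K u (Ide A (onO I n))))"
  shows "naturally_isomorphic N B (H \<odot> prd_left A K a \<odot> I) (H \<odot> prd_left A K a' \<odot> I)"
proof -
  interpret H: fnctr A B H using H by (rule is_functor_fnctr)
  interpret I: fnctr N A I using I by (rule is_functor_fnctr)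
  have a: "a \<in> Obj A" "a' \<in> Obj A" using hom_obj[OF u] .
  show ?thesis
  proof (rule naturally_isomorphicI[where \<tau> = "\<lambda>n. onA H (prd_arr A K u (Ide A (onO I n)))"])
    show "is_functor N B (H \<odot> prd_left A K a \<odot> I)" "is_functor N B (H \<odot> prd_left A K a' \<odot> I)"
      using is_functor_fcomp[OF is_functor_fcomp[OF I prd_left_functor] H] a by simp_all
    fix n assume n: "n \<in> Obj N"
    then show "onA H (prd_arr A K u (Ide A (onO I n)))
        \<in> hom B (onO (H \<odot> prd_left A K a \<odot> I) n) (onO (H \<odot> prd_left A K a' \<odot> I) n)"
      using H.pres_hom[OF prd_arr(1)[OF u ide_in]] by simp
  next
    fix n n' f assume f: "f \<in> hom N n n'"
    then have n': "onO I n' \<in> Obj A" "onO I n \<in> Obj A" by (auto simp: hom_iff)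
    note p = prd_arr(1)[OF u ide_in[OF n'(1)]] prd_arr(1)[OF ide_in[OF a(1)] I.pres_hom[OF f]]
      prd_arr(1)[OF u ide_in[OF n'(2)]] prd_arr(1)[OF ide_in[OF a(2)] I.pres_hom[OF f]]
    have "onA H (prd_arr A K u (Ide A (onO I n')) \<cdot> prd_arr A K (Ide A a) (onA I f))
        = onA H (prd_arr A K (Ide A a') (onA I f) \<cdot> prd_arr A K u (Ide A (onO I n)))"
      unfolding prd_left_transf[OF u I.pres_hom[OF f]] ..
    then show "onA H (prd_arr A K u (Ide A (onO I n'))) \<cdot>\<^bsub>B\<^esub> onA (H \<odot> prd_left A K a \<odot> I) f
        = onA (H \<odot> prd_left A K a' \<odot> I) f \<cdot>\<^bsub>B\<^esub> onA H (prd_arr A K u (Ide A (onO I n)))"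
      using p by (simp add: hom_iff)
  qed (use iso in simp_all)
qed

text \<open>The same law with the roles exchanged: the factor carrying the unit varies and the other
  one is fixed.\<close>

lemma prd_right_natiso:
  assumes a: "a \<in> Obj A" and \<tau>: "nat_transf A A fid T \<tau>" and H: "is_functor A B H"
    and iso: "\<And>p. p \<in> Obj A \<Longrightarrow> is_iso B (onA H (prd_arr A K (\<tau> p) (Ide A a)))"
  shows "naturally_isomorphic A B (H \<odot> prd_right A K a) (H \<odot> prd_right A K a \<odot> T)"
proof -
  interpret H: fnctr A B H using H by (rule is_functor_fnctr)
  interpret \<tau>: ntransf A A fid T \<tau> using \<tau> by (rule nat_transf_ntransf)
  show ?thesis
  proof (rule naturally_isomorphicI[where \<tau> = "\<lambda>p. onA H (prd_arr A K (\<tau> p) (Ide A a))"])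
    show "is_functor A B (H \<odot> prd_right A K a)" "is_functor A B (H \<odot> prd_right A K a \<odot> T)"
      using is_functor_fcomp[OF prd_right_functor[OF a] H]
        is_functor_fcomp[OF is_functor_fcomp[OF \<tau>.G.fnctr prd_right_functor[OF a]] H] by simp_all
    fix p assume "p \<in> Obj A"
    then show "onA H (prd_arr A K (\<tau> p) (Ide A a))
        \<in> hom B (onO (H \<odot> prd_right A K a) p) (onO (H \<odot> prd_right A K a \<odot> T) p)"
      using H.pres_hom[OF prd_arr(1)[OF \<tau>.comp_hom ide_in[OF a]]] by simp
  next
    fix p p' f assume f: "f \<in> hom A p p'"
    then have o: "p \<in> Obj A" "p' \<in> Obj A" by (auto simp: hom_iff)
    have t: "\<tau> p \<in> hom A p (onO T p)" "\<tau> p' \<in> hom A p' (onO T p')"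
      using \<tau>.comp_hom o by simp_all
    note Tf = \<tau>.G.pres_hom[OF f] and i = ide_in[OF a]
    note c = prd_arr_comp[OF f i t(2) i] prd_arr_comp[OF t(1) i Tf i]
    have "onA H (prd_arr A K (\<tau> p') (Ide A a) \<cdot> prd_arr A K f (Ide A a))
        = onA H (prd_arr A K (onA T f) (Ide A a) \<cdot> prd_arr A K (\<tau> p) (Ide A a))"
      using c \<tau>.naturality[OF f] by simp
    then show "onA H (prd_arr A K (\<tau> p') (Ide A a)) \<cdot>\<^bsub>B\<^esub> onA (H \<odot> prd_right A K a) f
        = onA (H \<odot> prd_right A K a \<odot> T) f \<cdot>\<^bsub>B\<^esub> onA H (prd_arr A K (\<tau> p) (Ide A a))"
      using prd_arr(1)[OF f i] prd_arr(1)[OF t(2) i] prd_arr(1)[OF Tf i] prd_arr(1)[OF t(1) i]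
      by (simp add: hom_iff)
  qed (use iso in simp_all)
qed

end

section \<open>Pointwise formulas in a temporal doctrine\<close>

text \<open>\<open>B\<close>, \<open>J\<close>, \<open>J'\<close> and \<open>U\<close> stand for \<open>\<B> 1\<close>, \<open>j\<^sub>1\<close>, \<open>j'\<^sub>1\<close> and
  \<open>b\<^sub>1\<close>. Keeping them abstract makes the setting symmetric in \<open>\<M>\<close> and \<open>\<M>'\<close>, which the
  pseudo-pullback itself is not on the nose; the dual half is the instance with the two exchanged.\<close>

locale doctrine_with_truth_values =
  fixes D :: "('x, 'c, 'mo, 'ma, 'po, 'pa, 'no, 'na) doctrine"
    and B :: "('b, 'u) cat"
    and U :: "('b, 'u, 'po, 'pa) fctr"
    and J :: "('b, 'u, 'mo, 'ma) fctr"
    and J' :: "('b, 'u, 'no, 'na) fctr"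
    and G :: "('mo, 'ma, 'b, 'u) fctr"
  assumes base: "category (base D)"
    and i_ifun: "indexed_functor (base D) (mcat D) (pcat D) (incl D)"
    and i'_ifun: "indexed_functor (base D) (mcat' D) (pcat D) (incl' D)"
    and one: "is_terminal (base D) (one D)"
    and ccc: "X \<in> Obj (base D) \<Longrightarrow> cartesian_closed (PX D X) (pccc D X)"
    and Sig: "f \<in> hom (base D) X Y
      \<Longrightarrow> adjunction (PX D X) (PX D Y) (Sig D f) (subP D f) (SigUnit D f) (SigCounit D f)"
    and Pi: "f \<in> hom (base D) X Y \<Longrightarrow> adjoint (PX D Y) (PX D X) (subP D f) (Pi D f)"
    and Dia: "X \<in> Obj (base D)
      \<Longrightarrow> adjunction (PX D X) (MX D X) (Dia D X) (ii D X) (DiaUnit D X) (DiaCounit D X)"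
    and Box: "X \<in> Obj (base D) \<Longrightarrow> adjoint (MX D X) (PX D X) (ii D X) (Box D X)"
    and Dia': "X \<in> Obj (base D)
      \<Longrightarrow> adjunction (PX D X) (MX' D X) (Dia' D X) (ii' D X) (DiaUnit' D X) (DiaCounit' D X)"
    and Box': "X \<in> Obj (base D) \<Longrightarrow> adjoint (MX' D X) (PX D X) (ii' D X) (Box' D X)"
    and i_ff: "X \<in> Obj (base D) \<Longrightarrow> fully_faithful (MX D X) (PX D X) (ii D X)"
    and i'_ff: "X \<in> Obj (base D) \<Longrightarrow> fully_faithful (MX' D X) (PX D X) (ii' D X)"
    and frobenius: "f \<in> hom (base D) X Y \<Longrightarrow> P \<in> Obj (PX D X) \<Longrightarrow> Q \<in> Obj (PX D Y)
      \<Longrightarrow> is_iso (PX D Y) (frobenius D f P Q)"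
    and mixed: "X \<in> Obj (base D) \<Longrightarrow> P \<in> Obj (PX D X) \<Longrightarrow> N \<in> Obj (MX' D X)
      \<Longrightarrow> is_iso (MX D X) (onA (Dia D X)
            (prd_arr (PX D X) (pccc D X) (DiaUnit D X P) (Ide (PX D X) (onO (ii' D X) N))))"
    and mixed': "X \<in> Obj (base D) \<Longrightarrow> P \<in> Obj (PX D X) \<Longrightarrow> M \<in> Obj (MX D X)
      \<Longrightarrow> is_iso (MX' D X) (onA (Dia' D X)
            (prd_arr (PX D X) (pccc D X) (DiaUnit' D X P) (Ide (PX D X) (onO (ii D X) M))))"
    and J_G: "quasi_inverse B (MX D (one D)) J G"
    and J': "is_functor B (MX' D (one D)) J'"
    and iJ: "naturally_isomorphic B (PX D (one D)) (ii D (one D) \<odot> J) U"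
    and i'J': "naturally_isomorphic B (PX D (one D)) (ii' D (one D) \<odot> J') U"
begin

interpretation base: category "base D" by (rule base)
interpretation i: indexed_functor "base D" "mcat D" "pcat D" "incl D" by (rule i_ifun)
interpretation i': indexed_functor "base D" "mcat' D" "pcat D" "incl' D" by (rule i'_ifun)

text \<open>Despite its name this is not a point of X but the map from X to the terminal
  object.\<close>

definition point_of :: "'x \<Rightarrow> 'c" where
  "point_of X = the_arrow (base D) X (one D)"

text \<open>This is X^* b_1, the constant families of truth values; both instances identify it with
  \<open>const_sub\<close>.\<close>

definition const where
  "const X = subP D (point_of X) \<odot> U"

lemma one_obj: "one D \<in> Obj (base D)"
  using one by (simp add: is_terminal_def)

lemma point_of_hom: "X \<in> Obj (base D) \<Longrightarrow> point_of X \<in> hom (base D) X (one D)"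
  using one theI' unfolding point_of_def the_arrow_def is_terminal_def by metis

lemma J_functor: "is_functor B (MX D (one D)) J" and G_functor: "is_functor (MX D (one D)) B G"
  using J_G by (simp_all add: quasi_inverse_def)

lemma U_functor: "is_functor B (PX D (one D)) U"
  using natiso_functors[OF iJ] by simp

lemma const_functor: "X \<in> Obj (base D) \<Longrightarrow> is_functor B (PX D X) (const X)"
  unfolding const_def
  using is_functor_fcomp[OF U_functor i.target.sub_functor[OF point_of_hom]] .

lemma Dia_adjoint:
  assumes "X \<in> Obj (base D)"
  shows "adjoint (PX D X) (MX D X) (Dia D X) (ii D X)" "adjoint (PX D X) (MX' D X) (Dia' D X) (ii' D X)"
  using Dia[OF assms] Dia'[OF assms] by (auto simp: adjoint_def)

lemma Sig_adjoint: "f \<in> hom (base D) X Y \<Longrightarrow> adjoint (PX D X) (PX D Y) (Sig D f) (subP D f)"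
  unfolding adjoint_def using Sig by blast

lemma fibre_functors:
  assumes "X \<in> Obj (base D)"
  shows "is_functor (MX D X) (PX D X) (ii D X)" "is_functor (MX' D X) (PX D X) (ii' D X)"
    "is_functor (PX D X) (MX D X) (Dia D X)" "is_functor (PX D X) (MX' D X) (Dia' D X)"
    "is_functor (PX D X) (MX D X) (Box D X)"
  using adjoint_functors[OF Dia_adjoint(1)[OF assms]] adjoint_functors[OF Dia_adjoint(2)[OF assms]]
    adjoint_functors[OF Box[OF assms]] by simp_all

lemma arrow_functors:
  assumes "f \<in> hom (base D) X Y"
  shows "is_functor (PX D Y) (PX D X) (subP D f)" "is_functor (MX D Y) (MX D X) (subM D f)"
    "is_functor (MX' D Y) (MX' D X) (subM' D f)"
    "is_functor (PX D X) (PX D Y) (Sig D f)" "is_functor (PX D X) (PX D Y) (Pi D f)"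
  using i.source.sub_functor[OF assms] i'.source.sub_functor[OF assms]
    adjoint_functors[OF Sig_adjoint[OF assms]] adjoint_functors[OF Pi[OF assms]] by simp_all

text \<open>Composing f with the map from Y to 1 gives the map from X to 1, so the claim is the
  pseudofunctor comparison isomorphism.\<close>

lemma sub_const:
  assumes f: "f \<in> hom (base D) X Y"
  shows "naturally_isomorphic B (PX D X) (subP D f \<odot> const Y) (const X)"
proof -
  have o: "X \<in> Obj (base D)" "Y \<in> Obj (base D)" using base.hom_obj[OF f] .
  have "point_of Y \<cdot>\<^bsub>base D\<^esub> f = point_of X"
    by (rule terminal_unique[OF one base.comp_in[OF f point_of_hom[OF o(2)]] point_of_hom[OF o(1)] o(1)])
  then show ?thesis
    using natiso_whisker_right[OF nat_iso_naturally_isomorphic[OF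
          i.target.comp_iso[OF f point_of_hom[OF o(2)]]] U_functor]
    by (simp add: const_def fcomp_assoc)
qed

text \<open>A point followed by the map back to 1 is the identity of 1, so a constant family
  restricted to a point is its value.\<close>

lemma sub_const_point:
  assumes x: "x \<in> hom (base D) (one D) X"
  shows "naturally_isomorphic B (PX D (one D)) (subP D x \<odot> const X) U"
proof -
  have "point_of (one D) = Ide (base D) (one D)"
    by (rule terminal_unique[OF one point_of_hom[OF one_obj] base.ide_in[OF one_obj] one_obj])
  then have "naturally_isomorphic B (PX D (one D)) U (const (one D))"
    using natiso_whisker_right[OF nat_iso_naturally_isomorphic[OF
          i.target.unit_iso[OF one_obj]] U_functor]
    by (simp add: const_def)
  then show ?thesis by (rule natiso_trans[OF sub_const[OF x] natiso_sym])
qed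

lemma incl_sub:
  assumes "f \<in> hom (base D) X Y"
  shows "naturally_isomorphic (MX D Y) (PX D X) (ii D X \<odot> subM D f) (subP D f \<odot> ii D Y)"
    "naturally_isomorphic (MX' D Y) (PX D X) (ii' D X \<odot> subM' D f) (subP D f \<odot> ii' D Y)"
  by (rule nat_iso_naturally_isomorphic, rule i.fun_iso[OF assms])
    (rule nat_iso_naturally_isomorphic, rule i'.fun_iso[OF assms])

text \<open>Both inclusions commute with substitution along the map to 1, and b_1 factors through
  each of them. Constant families therefore lie in both subcategories, which lets either modality
  act on them.\<close>

lemma const_incl:
  assumes "X \<in> Obj (base D)"
  shows "naturally_isomorphic B (PX D X) (const X) (ii D X \<odot> subM D (point_of X) \<odot> J)"
    "naturally_isomorphic B (PX D X) (const X) (ii' D X \<odot> subM' D (point_of X) \<odot> J')"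
proof -
  note t = point_of_hom[OF assms]
  have "naturally_isomorphic B (PX D X) (ii D X \<odot> subM D (point_of X) \<odot> J) (subP D (point_of X) \<odot> U)"
    using natiso_trans[OF natiso_whisker_right[OF incl_sub(1)[OF t] J_functor, unfolded fcomp_assoc]
        natiso_whisker_left[OF iJ arrow_functors(1)[OF t]]] .
  moreover have "naturally_isomorphic B (PX D X) (ii' D X \<odot> subM' D (point_of X) \<odot> J')
      (subP D (point_of X) \<odot> U)"
    using natiso_trans[OF natiso_whisker_right[OF incl_sub(2)[OF t] J', unfolded fcomp_assoc]
        natiso_whisker_left[OF i'J' arrow_functors(1)[OF t]]] .
  ultimately show "naturally_isomorphic B (PX D X) (const X) (ii D X \<odot> subM D (point_of X) \<odot> J)"
    "naturally_isomorphic B (PX D X) (const X) (ii' D X \<odot> subM' D (point_of X) \<odot> J')"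
    unfolding const_def by (simp_all only: natiso_sym)
qed

lemma reflections:
  assumes "X \<in> Obj (base D)"
  shows "reflective_ccc (PX D X) (MX D X) (Dia D X) (ii D X) (DiaUnit D X) (DiaCounit D X) (pccc D X)"
    and "reflective_ccc (PX D X) (MX' D X) (Dia' D X) (ii' D X) (DiaUnit' D X) (DiaCounit' D X) (pccc D X)"
  using adjunction_adjn[OF Dia[OF assms]] adjunction_adjn[OF Dia'[OF assms]]
    i_ff[OF assms] i'_ff[OF assms] ccc[OF assms]
  by (simp_all add: reflective_ccc_def reflective_def reflective_axioms_def)

lemma Sig_ccc:
  assumes "f \<in> hom (base D) X Y"
  shows "ccc_adjn (PX D X) (PX D Y) (Sig D f) (subP D f) (SigUnit D f) (SigCounit D f)
    (pccc D X) (pccc D Y)"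
  using adjunction_adjn[OF Sig[OF assms]] ccc base.hom_obj[OF assms] by (simp add: ccc_adjn_def)

section \<open>The Frobenius laws as natural isomorphisms\<close>

lemma frobenius_left:
  assumes f: "f \<in> hom (base D) X Y" and p: "p \<in> Obj (PX D X)"
  shows "naturally_isomorphic (PX D Y) (PX D Y) (Sig D f \<odot> prd_left (PX D X) (pccc D X) p \<odot> subP D f)
    (prd_left (PX D Y) (pccc D Y) (onO (Sig D f) p))"
proof -
  interpret ccc_adjn "PX D X" "PX D Y" "Sig D f" "subP D f" "SigUnit D f" "SigCounit D f"
    "pccc D X" "pccc D Y" using Sig_ccc[OF f] .
  show ?thesis
    using frob_prd_left[OF p] frobenius[OF f p] f by (simp add: frobenius_def hom_iff Let_def)
qed

lemma frobenius_right:
  assumes f: "f \<in> hom (base D) X Y" and q: "q \<in> Obj (PX D Y)"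
  shows "naturally_isomorphic (PX D X) (PX D Y) (Sig D f \<odot> prd_right (PX D X) (pccc D X) (onO (subP D f) q))
    (prd_right (PX D Y) (pccc D Y) q \<odot> Sig D f)"
proof -
  interpret ccc_adjn "PX D X" "PX D Y" "Sig D f" "subP D f" "SigUnit D f" "SigCounit D f"
    "pccc D X" "pccc D Y" using Sig_ccc[OF f] .
  show ?thesis
    using frob_prd_right[OF q] frobenius[OF f _ q] f by (simp add: frobenius_def hom_iff Let_def)
qed

lemma sub_prd:
  assumes f: "f \<in> hom (base D) X Y" and q: "q \<in> Obj (PX D Y)"
  shows "naturally_isomorphic (PX D Y) (PX D X) (subP D f \<odot> prd_right (PX D Y) (pccc D Y) q)
    (prd_right (PX D X) (pccc D X) (onO (subP D f) q) \<odot> subP D f)"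
proof -
  interpret ccc_adjn "PX D X" "PX D Y" "Sig D f" "subP D f" "SigUnit D f" "SigCounit D f"
    "pccc D X" "pccc D Y" using Sig_ccc[OF f] .
  show ?thesis using right_adjoint_prd[OF q] .
qed

text \<open>\<open>top_ob\<close> is a choice, so a terminal object must first be exhibited: the
  reflection of the terminal object of the fibre. The inclusions preserve terminal objects because
  they are right adjoints.\<close>

lemma top_terminal:
  "is_terminal (PX D (one D)) (onO (ii D (one D)) (top_ob (MX D (one D))))"
  "is_terminal (PX D (one D)) (onO (ii' D (one D)) (top_ob (MX' D (one D))))"
proof -
  interpret r: reflective_ccc "PX D (one D)" "MX D (one D)" "Dia D (one D)" "ii D (one D)"
    "DiaUnit D (one D)" "DiaCounit D (one D)" "pccc D (one D)" using reflections(1)[OF one_obj] .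
  interpret r': reflective_ccc "PX D (one D)" "MX' D (one D)" "Dia' D (one D)" "ii' D (one D)"
    "DiaUnit' D (one D)" "DiaCounit' D (one D)" "pccc D (one D)" using reflections(2)[OF one_obj] .
  have "is_terminal (MX D (one D)) (top_ob (MX D (one D)))"
    unfolding top_ob_def using r.reflector_terminal[OF r.trm_terminal] by (rule someI)
  then show "is_terminal (PX D (one D)) (onO (ii D (one D)) (top_ob (MX D (one D))))"
    by (rule right_adjoint_terminal[OF Dia_adjoint(1)[OF one_obj]])
  have "is_terminal (MX' D (one D)) (top_ob (MX' D (one D)))"
    unfolding top_ob_def using r'.reflector_terminal[OF r.trm_terminal] by (rule someI)
  then show "is_terminal (PX D (one D)) (onO (ii' D (one D)) (top_ob (MX' D (one D))))"
    by (rule right_adjoint_terminal[OF Dia_adjoint(2)[OF one_obj]])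
qed

text \<open>The Frobenius law at a terminal object, where t \<times> x^* Q reduces to x^* Q.\<close>

lemma Sig_terminal:
  assumes x: "x \<in> hom (base D) (one D) X" and t: "is_terminal (PX D (one D)) t"
  shows "naturally_isomorphic (PX D X) (PX D X) (Sig D x \<odot> subP D x)
    (prd_left (PX D X) (pccc D X) (onO (Sig D x) t))"
proof -
  interpret cartesian_closed "PX D (one D)" "pccc D (one D)" using ccc[OF one_obj] .
  have o: "t \<in> Obj (PX D (one D))" using t by (simp add: is_terminal_def)
  \<comment> \<open>The written-out \<open>fid\<close> is the slot into which t \<times> - is
    substituted; simplification removes it afterwards.\<close>
  have "naturally_isomorphic (PX D X) (PX D X) (Sig D x \<odot> fid \<odot> subP D x)
      (Sig D x \<odot> prd_left (PX D (one D)) (pccc D (one D)) t \<odot> subP D x)"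
    by (rule natiso_sym[OF prd_left_terminal[OF t]] arrow_functors[OF x] natiso_fcomp natiso_refl)+
  then show ?thesis using natiso_trans[OF _ frobenius_left[OF x o]] by simp
qed

lemma mixed_natiso:
  assumes X: "X \<in> Obj (base D)" and q: "q \<in> Obj (PX D X)"
  shows "naturally_isomorphic (MX' D X) (MX D X)
    (Dia D X \<odot> prd_left (PX D X) (pccc D X) q \<odot> ii' D X)
    (Dia D X \<odot> prd_left (PX D X) (pccc D X) (onO (ii D X) (onO (Dia D X) q)) \<odot> ii' D X)"
proof -
  interpret reflective_ccc "PX D X" "MX D X" "Dia D X" "ii D X"
    "DiaUnit D X" "DiaCounit D X" "pccc D X" using reflections(1)[OF X] .
  show ?thesis
    by (rule prd_left_natiso[OF _ F.fnctr fibre_functors(2)[OF X] mixed[OF X q]])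
      (use q in \<open>simp_all add: hom_iff\<close>)
qed

lemma mixed'_natiso:
  assumes X: "X \<in> Obj (base D)" and q: "q \<in> Obj (PX D X)"
  shows "naturally_isomorphic (MX D X) (MX' D X)
    (Dia' D X \<odot> prd_left (PX D X) (pccc D X) q \<odot> ii D X)
    (Dia' D X \<odot> prd_left (PX D X) (pccc D X) (onO (ii' D X) (onO (Dia' D X) q)) \<odot> ii D X)"
proof -
  interpret reflective_ccc "PX D X" "MX' D X" "Dia' D X" "ii' D X"
    "DiaUnit' D X" "DiaCounit' D X" "pccc D X" using reflections(2)[OF X] .
  show ?thesis
    by (rule prd_left_natiso[OF _ F.fnctr fibre_functors(1)[OF X] mixed'[OF X q]])
      (use q in \<open>simp_all add: hom_iff\<close>)
qed

text \<open>Here the factor under the unit varies while the one from \<M>' stays fixed. This form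
  reflects the variable argument, whereas \<open>mixed_natiso\<close> reflects the slice.\<close>

lemma mixed_natiso_right:
  assumes X: "X \<in> Obj (base D)" and n: "n \<in> Obj (MX' D X)"
  shows "naturally_isomorphic (PX D X) (MX D X)
    (Dia D X \<odot> prd_right (PX D X) (pccc D X) (onO (ii' D X) n))
    (Dia D X \<odot> prd_right (PX D X) (pccc D X) (onO (ii' D X) n) \<odot> ii D X \<odot> Dia D X)"
proof -
  interpret reflective_ccc "PX D X" "MX D X" "Dia D X" "ii D X"
    "DiaUnit D X" "DiaCounit D X" "pccc D X" using reflections(1)[OF X] .
  interpret i': fnctr "MX' D X" "PX D X" "ii' D X" using fibre_functors(2)[OF X] by (rule is_functor_fnctr)
  show ?thesis
    by (rule prd_right_natiso[OF _ \<eta>.ntransf F.fnctr]) (use mixed[OF X _ n] n in auto)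
qed

lemma slice_obj:
  assumes "x \<in> hom (base D) (one D) X"
  shows "left_slice D x \<in> Obj (MX D X)" "right_slice D x \<in> Obj (MX' D X)"
proof -
  have X: "X \<in> Obj (base D)" and x: "Cod (base D) x = X" "Dom (base D) x = one D"
    using base.hom_obj[OF assms] assms by (simp_all add: hom_iff)
  interpret S: fnctr "PX D (one D)" "PX D X" "Sig D x"
    using arrow_functors(4)[OF assms] by (rule is_functor_fnctr)
  interpret D: fnctr "PX D X" "MX D X" "Dia D X"
    using fibre_functors(3)[OF X] by (rule is_functor_fnctr)
  interpret D': fnctr "PX D X" "MX' D X" "Dia' D X"
    using fibre_functors(4)[OF X] by (rule is_functor_fnctr)
  show "left_slice D x \<in> Obj (MX D X)" "right_slice D x \<in> Obj (MX' D X)"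
    unfolding left_slice_def right_slice_def existsM_def existsM'_def
    using top_terminal x by (simp_all add: is_terminal_def)
qed

text \<open>In words, including the existential image of a truth value along x amounts to
  multiplying the slice X/x by the corresponding constant family. The leading inclusion and
  reflector are kept because the right adjoint of the left side then ends in i \<box>, from which x
  \<cdot> \<box> is recovered.\<close>

lemma Sig_const:
  assumes x: "x \<in> hom (base D) (one D) X"
  shows "naturally_isomorphic B (PX D X) (ii D X \<odot> Dia D X \<odot> Sig D x \<odot> ii D (one D) \<odot> J)
    (prd_right (PX D X) (pccc D X) (onO (ii D X) (left_slice D x)) \<odot> const X)"
proof -
  have X: "X \<in> Obj (base D)" and x': "Cod (base D) x = X" "Dom (base D) x = one D"
    using base.hom_obj[OF x] x by (simp_all add: hom_iff)
  interpret reflective_ccc "PX D X" "MX D X" "Dia D X" "ii D X"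
    "DiaUnit D X" "DiaCounit D X" "pccc D X" using reflections(1)[OF X] .
  interpret S: fnctr "PX D (one D)" "PX D X" "Sig D x"
    using arrow_functors(4)[OF x] by (rule is_functor_fnctr)
  let ?T = "onO (ii D (one D)) (top_ob (MX D (one D)))"
  \<comment> \<open>The terminal object is taken to be the included \<open>top_ob\<close>, so that
    the reflection of q is \<open>left_slice D x\<close> by definition and not only up to
    isomorphism.\<close>
  define q where "q = onO (Sig D x) ?T"
  have slice: "left_slice D x = onO (Dia D X) q"
    by (simp add: left_slice_def existsM_def q_def x')
  have q: "q \<in> Obj (PX D X)" using top_terminal(1) by (simp add: q_def is_terminal_def)
  let ?m = "onO (Dia D X) q"
  let ?L = "prd_left (PX D X) (pccc D X)"
  let ?N = "subM' D (point_of X) \<odot> J'" and ?M = "subM D (point_of X) \<odot> J"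
  have M: "is_functor B (MX D X) ?M" and N: "is_functor B (MX' D X) ?N"
    by (rule is_functor_fcomp[OF J_functor arrow_functors(2)[OF point_of_hom[OF X]]],
        rule is_functor_fcomp[OF J' arrow_functors(3)[OF point_of_hom[OF X]]])
  have m: "onO (ii D X) ?m \<in> Obj (PX D X)" using q by simp
  \<comment> \<open>A stock of functoriality facts that discharges the unchanged factors when a
    string of functors is rewritten.\<close>
  note F = fibre_functors[OF X] fibre_functors[OF one_obj] arrow_functors[OF x] const_functor[OF X]
    prd_left_functor[OF q] prd_left_functor[OF m] J_functor
  have "naturally_isomorphic B (PX D X) (Sig D x \<odot> ii D (one D) \<odot> J) (Sig D x \<odot> subP D x \<odot> const X)"
    by (rule natiso_whisker_left[OF natiso_trans[OF iJ natiso_sym[OF sub_const_point[OF x]]] F(14)])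
  also have "naturally_isomorphic B (PX D X) \<dots> (?L q \<odot> const X)"
    using natiso_whisker_right[OF Sig_terminal[OF x top_terminal(1)] const_functor[OF X]]
    by (simp add: q_def fcomp_assoc)
  finally have "naturally_isomorphic B (MX D X) (Dia D X \<odot> Sig D x \<odot> ii D (one D) \<odot> J)
      (Dia D X \<odot> ?L q \<odot> const X)"
    by (rule natiso_whisker_left[OF _ F(3)])
  also have "naturally_isomorphic B (MX D X) \<dots> (Dia D X \<odot> ?L q \<odot> ii' D X \<odot> ?N)"
    by (rule F const_incl(2)[OF X] natiso_fcomp natiso_refl)+
  also have "naturally_isomorphic B (MX D X) \<dots> (Dia D X \<odot> ?L (onO (ii D X) ?m) \<odot> ii' D X \<odot> ?N)"
    using natiso_whisker_right[OF mixed_natiso[OF X q] N] by (simp add: fcomp_assoc)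
  also have "naturally_isomorphic B (MX D X) \<dots> (Dia D X \<odot> ?L (onO (ii D X) ?m) \<odot> const X)"
    by (rule F natiso_sym[OF const_incl(2)[OF X]] natiso_fcomp natiso_refl)+
  also have "naturally_isomorphic B (MX D X) \<dots> (Dia D X \<odot> ?L (onO (ii D X) ?m) \<odot> ii D X \<odot> ?M)"
    by (rule F const_incl(1)[OF X] natiso_fcomp natiso_refl)+
  finally have "naturally_isomorphic B (PX D X) (ii D X \<odot> Dia D X \<odot> Sig D x \<odot> ii D (one D) \<odot> J)
      (ii D X \<odot> Dia D X \<odot> ?L (onO (ii D X) ?m) \<odot> ii D X \<odot> ?M)"
    by (rule natiso_whisker_left[OF _ F(1)])
  also have "naturally_isomorphic B (PX D X) \<dots> (?L (onO (ii D X) ?m) \<odot> ii D X \<odot> ?M)"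
    using natiso_whisker_right[OF reflection_prd M] q by (simp add: fcomp_assoc)
  also have "naturally_isomorphic B (PX D X) \<dots> (?L (onO (ii D X) ?m) \<odot> const X)"
    by (rule F natiso_sym[OF const_incl(1)[OF X]] natiso_fcomp natiso_refl)+
  also have "naturally_isomorphic B (PX D X) \<dots>
      (prd_right (PX D X) (pccc D X) (onO (ii D X) ?m) \<odot> const X)"
    by (rule F prd_left_right m natiso_fcomp natiso_refl)+
  finally show ?thesis by (simp add: slice)
qed

lemma Box_Incl:
  assumes "X \<in> Obj (base D)"
  shows "naturally_isomorphic (MX D X) (MX D X) (Box D X \<odot> ii D X) fid"
    "naturally_isomorphic (MX' D X) (MX' D X) (Box' D X \<odot> ii' D X) fid"
  by (rule coreflection_natiso[OF Box[OF assms] i_ff[OF assms]],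
      rule coreflection_natiso[OF Box'[OF assms] i'_ff[OF assms]])

lemma Box_hom:
  assumes x: "x \<in> hom (base D) (one D) X" and R: "adjoint B (PX D X) (const X) R"
  shows "naturally_isomorphic (PX D X) B (G \<odot> subM D x \<odot> Box D X)
    (R \<odot> xpn_from (PX D X) (pccc D X) (onO (ii D X) (left_slice D x)))"
proof -
  have X: "X \<in> Obj (base D)" using base.hom_obj[OF x] by simp
  interpret cartesian_closed "PX D X" "pccc D X" using ccc[OF X] .
  interpret i: fnctr "MX D X" "PX D X" "ii D X" using fibre_functors(1)[OF X] by (rule is_functor_fnctr)
  note F = fibre_functors[OF X] fibre_functors[OF one_obj] arrow_functors[OF x] G_functor
  \<comment> \<open>Again \<open>fid\<close> only marks the place where box after inclusion is
    inserted.\<close>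
  have "naturally_isomorphic (PX D X) B (G \<odot> fid \<odot> subM D x \<odot> Box D X)
      (G \<odot> (Box D (one D) \<odot> ii D (one D)) \<odot> subM D x \<odot> Box D X)"
    by (rule F natiso_sym[OF Box_Incl(1)[OF one_obj]] natiso_fcomp natiso_refl)+
  moreover have "naturally_isomorphic (PX D X) B
      (G \<odot> Box D (one D) \<odot> (ii D (one D) \<odot> subM D x) \<odot> Box D X)
      (G \<odot> Box D (one D) \<odot> (subP D x \<odot> ii D X) \<odot> Box D X)"
    by (rule F incl_sub(1)[OF x] natiso_whisker_left natiso_whisker_right)+
  ultimately have "naturally_isomorphic (PX D X) B (G \<odot> subM D x \<odot> Box D X)
      (G \<odot> Box D (one D) \<odot> subP D x \<odot> ii D X \<odot> Box D X)"
    unfolding fcomp_assoc fcomp_fid by (rule natiso_trans)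
  moreover have "naturally_isomorphic (PX D X) B (G \<odot> Box D (one D) \<odot> subP D x \<odot> ii D X \<odot> Box D X)
      (R \<odot> xpn_from (PX D X) (pccc D X) (onO (ii D X) (left_slice D x)))"
  proof (rule right_adjoint_natiso[OF _ _ Sig_const[OF x]])
    show "adjoint B (PX D X) (ii D X \<odot> Dia D X \<odot> Sig D x \<odot> ii D (one D) \<odot> J)
        (G \<odot> Box D (one D) \<odot> subP D x \<odot> ii D X \<odot> Box D X)"
      using adjoint_fcomp[OF adjoint_fcomp[OF adjoint_fcomp[OF adjoint_fcomp[OF
              quasi_inverse_adjoint[OF J_G] Box[OF one_obj]] Sig_adjoint[OF x]]
            Dia_adjoint(1)[OF X]] Box[OF X]]
      by (simp add: fcomp_assoc)
    show "adjoint B (PX D X)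
        (prd_right (PX D X) (pccc D X) (onO (ii D X) (left_slice D x)) \<odot> const X)
        (R \<odot> xpn_from (PX D X) (pccc D X) (onO (ii D X) (left_slice D x)))"
      by (rule adjoint_fcomp[OF R xpn_adjoint]) (use slice_obj[OF x] in simp)
  qed
  ultimately show ?thesis by (rule natiso_trans)
qed

text \<open>The left adjoints to be compared are f^* applied to the product of constants with the
  slice, and the product of constants on X with the restricted slice. They agree because f^*
  preserves products and constants. The quantifier then arises by precomposing with the
  inclusion.\<close>

lemma forall_nat:
  assumes f: "f \<in> hom (base D) X Y" and y: "y \<in> hom (base D) (one D) Y"
    and R: "adjoint B (PX D X) (const X) R" and R': "adjoint B (PX D Y) (const Y) R'"
  shows "naturally_isomorphic (MX D X) B (G \<odot> subM D y \<odot> forallM D f)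
    (R \<odot> xpn_from (PX D X) (pccc D X) (onO (ii D X) (onO (subM D f) (left_slice D y))) \<odot> ii D X)"
proof -
  have X: "X \<in> Obj (base D)" and Y: "Y \<in> Obj (base D)" using base.hom_obj[OF f] .
  interpret X: cartesian_closed "PX D X" "pccc D X" using ccc[OF X] .
  interpret Y: cartesian_closed "PX D Y" "pccc D Y" using ccc[OF Y] .
  interpret i: fnctr "MX D Y" "PX D Y" "ii D Y" using fibre_functors(1)[OF Y] by (rule is_functor_fnctr)
  let ?q = "onO (ii D Y) (left_slice D y)" and ?q' = "onO (ii D X) (onO (subM D f) (left_slice D y))"
  have q: "?q \<in> Obj (PX D Y)" using slice_obj(1)[OF y] by simp
  \<comment> \<open>Substituting the included slice and including the substituted slice give objects
    that are isomorphic but not equal; u exchanges them inside the product.\<close>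
  obtain u where u: "is_iso (PX D X) u" "u \<in> hom (PX D X) (onO (subP D f) ?q) ?q'"
    using natiso_componentE[OF natiso_sym[OF incl_sub(1)[OF f]] slice_obj(1)[OF y]] by auto
  have q': "onO (subP D f) ?q \<in> Obj (PX D X)" "?q' \<in> Obj (PX D X)" using X.hom_obj[OF u(2)] .
  have "naturally_isomorphic B (PX D X) (subP D f \<odot> prd_right (PX D Y) (pccc D Y) ?q \<odot> const Y)
      (prd_right (PX D X) (pccc D X) (onO (subP D f) ?q) \<odot> subP D f \<odot> const Y)"
    using natiso_whisker_right[OF sub_prd[OF f q] const_functor[OF Y]] by (simp add: fcomp_assoc)
  also have "naturally_isomorphic B (PX D X) \<dots> (prd_right (PX D X) (pccc D X) ?q' \<odot> const X)"
    by (rule natiso_fcomp[OF sub_const[OF f] X.prd_right_cong[OF u]])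
  finally have "naturally_isomorphic (PX D X) B (R' \<odot> xpn_from (PX D Y) (pccc D Y) ?q \<odot> Pi D f)
      (R \<odot> xpn_from (PX D X) (pccc D X) ?q')"
    by (rule right_adjoint_natiso[rotated 2])
      (use adjoint_fcomp[OF adjoint_fcomp[OF R' Y.xpn_adjoint[OF q]] Pi[OF f]]
        adjoint_fcomp[OF R X.xpn_adjoint[OF q'(2)]] in \<open>simp_all add: fcomp_assoc\<close>)
  then have "naturally_isomorphic (PX D X) B (G \<odot> subM D y \<odot> Box D Y \<odot> Pi D f)
      (R \<odot> xpn_from (PX D X) (pccc D X) ?q')"
    using natiso_trans[OF natiso_whisker_right[OF Box_hom[OF y R'] arrow_functors(5)[OF f]]]
    by (simp add: fcomp_assoc)
  then show ?thesis
    using natiso_whisker_right[OF _ fibre_functors(1)[OF X]] f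
    by (fastforce simp: fcomp_assoc forallM_def hom_iff)
qed

text \<open>Since \<open>X\<^sup>* b\<^sub>1\<close> factors through \<open>\<M> X\<close> and through \<open>\<M>' X\<close>, its left adjoint inverts every
  transformation inverted by \<open>\<diamond>\<^sub>X\<close> or by \<open>\<diamond>'\<^sub>X\<close>.\<close>

lemma coend_reflect:
  assumes X: "X \<in> Obj (base D)" and L: "adjoint (PX D X) B L (const X)"
  shows "naturally_isomorphic (PX D X) B L (L \<odot> ii D X \<odot> Dia D X)"
    "naturally_isomorphic (PX D X) B L (L \<odot> ii' D X \<odot> Dia' D X)"
proof -
  have t: "point_of X \<in> hom (base D) X (one D)" using point_of_hom[OF X] .
  note F = fibre_functors[OF X] adjoint_functors[OF Box[OF X]] adjoint_functors[OF Box'[OF X]]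
    arrow_functors[OF t] J_functor J'
  \<comment> \<open>Constant families are fixed by i \<box>, since they factor through i and \<box>
    i is the identity. Taking left adjoints turns this into L being isomorphic to L i
    \<diamond>.\<close>
  have "naturally_isomorphic B (PX D X) (ii D X \<odot> Box D X \<odot> const X)
      (ii D X \<odot> Box D X \<odot> ii D X \<odot> subM D (point_of X) \<odot> J)"
    by (rule const_incl(1)[OF X] F natiso_whisker_left)+
  also have "naturally_isomorphic B (PX D X) (ii D X \<odot> (Box D X \<odot> ii D X) \<odot> subM D (point_of X) \<odot> J)
      (ii D X \<odot> fid \<odot> subM D (point_of X) \<odot> J)"
    by (rule Box_Incl[OF X] F natiso_fcomp natiso_refl)+
  then have "naturally_isomorphic B (PX D X) (ii D X \<odot> Box D X \<odot> ii D X \<odot> subM D (point_of X) \<odot> J) (const X)"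
    unfolding fcomp_assoc fcomp_fid by (rule natiso_trans[OF _ natiso_sym[OF const_incl(1)[OF X]]])
  finally have "naturally_isomorphic B (PX D X) (ii D X \<odot> Box D X \<odot> const X) (const X)" .
  from left_adjoint_natiso[OF L _ natiso_sym[OF this]]
  show "naturally_isomorphic (PX D X) B L (L \<odot> ii D X \<odot> Dia D X)"
    using adjoint_fcomp[OF adjoint_fcomp[OF Dia_adjoint(1)[OF X] Box[OF X]] L]
    by (simp add: fcomp_assoc)
  have "naturally_isomorphic B (PX D X) (ii' D X \<odot> Box' D X \<odot> const X)
      (ii' D X \<odot> Box' D X \<odot> ii' D X \<odot> subM' D (point_of X) \<odot> J')"
    by (rule const_incl(2)[OF X] F natiso_whisker_left)+
  also have "naturally_isomorphic B (PX D X) (ii' D X \<odot> (Box' D X \<odot> ii' D X) \<odot> subM' D (point_of X) \<odot> J')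
      (ii' D X \<odot> fid \<odot> subM' D (point_of X) \<odot> J')"
    by (rule Box_Incl[OF X] F natiso_fcomp natiso_refl)+
  then have "naturally_isomorphic B (PX D X) (ii' D X \<odot> Box' D X \<odot> ii' D X \<odot> subM' D (point_of X) \<odot> J') (const X)"
    unfolding fcomp_assoc fcomp_fid by (rule natiso_trans[OF _ natiso_sym[OF const_incl(2)[OF X]]])
  finally have "naturally_isomorphic B (PX D X) (ii' D X \<odot> Box' D X \<odot> const X) (const X)" .
  from left_adjoint_natiso[OF L _ natiso_sym[OF this]]
  show "naturally_isomorphic (PX D X) B L (L \<odot> ii' D X \<odot> Dia' D X)"
    using adjoint_fcomp[OF adjoint_fcomp[OF Dia_adjoint(2)[OF X] Box'[OF X]] L]
    by (simp add: fcomp_assoc)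
qed

text \<open>Any isomorphism between the reflections will do; it need not be induced by a
  transformation from H to H', because L is recovered from the reflector by
  \<open>coend_reflect\<close>.\<close>

lemma coend_natiso:
  assumes X: "X \<in> Obj (base D)" and L: "adjoint (PX D X) B L (const X)"
    and H: "is_functor A (PX D X) H" "is_functor A (PX D X) H'"
  shows "naturally_isomorphic A (MX D X) (Dia D X \<odot> H) (Dia D X \<odot> H')
      \<Longrightarrow> naturally_isomorphic A B (L \<odot> H) (L \<odot> H')"
    and "naturally_isomorphic A (MX' D X) (Dia' D X \<odot> H) (Dia' D X \<odot> H')
      \<Longrightarrow> naturally_isomorphic A B (L \<odot> H) (L \<odot> H')"
proof -
  note l = adjoint_functors(1)[OF L] and c = coend_reflect[OF X L]
  assume "naturally_isomorphic A (MX D X) (Dia D X \<odot> H) (Dia D X \<odot> H')"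
  then have "naturally_isomorphic A B (L \<odot> ii D X \<odot> Dia D X \<odot> H) (L \<odot> ii D X \<odot> Dia D X \<odot> H')"
    by (rule natiso_whisker_left[OF natiso_whisker_left[OF _ fibre_functors(1)[OF X]] l])
  then show "naturally_isomorphic A B (L \<odot> H) (L \<odot> H')"
    using natiso_whisker_right[OF c(1) H(1)] natiso_whisker_right[OF c(1) H(2)]
    unfolding fcomp_assoc by (metis natiso_trans natiso_sym)
next
  note l = adjoint_functors(1)[OF L] and c = coend_reflect[OF X L]
  assume "naturally_isomorphic A (MX' D X) (Dia' D X \<odot> H) (Dia' D X \<odot> H')"
  then have "naturally_isomorphic A B (L \<odot> ii' D X \<odot> Dia' D X \<odot> H) (L \<odot> ii' D X \<odot> Dia' D X \<odot> H')"
    by (rule natiso_whisker_left[OF natiso_whisker_left[OF _ fibre_functors(2)[OF X]] l])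
  then show "naturally_isomorphic A B (L \<odot> H) (L \<odot> H')"
    using natiso_whisker_right[OF c(2) H(1)] natiso_whisker_right[OF c(2) H(2)]
    unfolding fcomp_assoc by (metis natiso_trans natiso_sym)
qed

lemma coend_Sig_incl:
  assumes x: "x \<in> hom (base D) (one D) X" and L: "adjoint (PX D X) B L (const X)"
  shows "naturally_isomorphic (MX D (one D)) B (L \<odot> Sig D x \<odot> ii D (one D)) G"
proof (rule left_adjoint_natiso[OF _ quasi_inverse_adjoint[OF quasi_inverse_sym[OF J_G]]])
  show "adjoint (MX D (one D)) B (L \<odot> Sig D x \<odot> ii D (one D)) (Box D (one D) \<odot> subP D x \<odot> const X)"
    using adjoint_fcomp[OF adjoint_fcomp[OF Box[OF one_obj] Sig_adjoint[OF x]] L]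
    by (simp add: fcomp_assoc)
  have "naturally_isomorphic B (MX D (one D)) (Box D (one D) \<odot> subP D x \<odot> const X)
      (Box D (one D) \<odot> ii D (one D) \<odot> J)"
    by (rule natiso_whisker_left[OF natiso_trans[OF sub_const_point[OF x] natiso_sym[OF iJ]]])
      (rule fibre_functors[OF one_obj])
  then show "naturally_isomorphic B (MX D (one D)) (Box D (one D) \<odot> subP D x \<odot> const X) J"
    using natiso_trans natiso_whisker_right[OF Box_Incl(1)[OF one_obj] J_functor]
    by (fastforce simp: fcomp_assoc)
qed

lemma Dia_meets:
  assumes x: "x \<in> hom (base D) (one D) X" and L: "adjoint (PX D X) B L (const X)"
  shows "naturally_isomorphic (PX D X) B (G \<odot> subM D x \<odot> Dia D X)
    (L \<odot> prd_left (PX D X) (pccc D X) (onO (ii' D X) (right_slice D x)))"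
proof -
  have X: "X \<in> Obj (base D)" and x': "Cod (base D) x = X" "Dom (base D) x = one D"
    using base.hom_obj[OF x] x by (simp_all add: hom_iff)
  interpret cartesian_closed "PX D X" "pccc D X" using ccc[OF X] .
  interpret i': fnctr "MX' D X" "PX D X" "ii' D X" using fibre_functors(2)[OF X] by (rule is_functor_fnctr)
  interpret S: fnctr "PX D (one D)" "PX D X" "Sig D x"
    using arrow_functors(4)[OF x] by (rule is_functor_fnctr)
  \<comment> \<open>As in \<open>Sig_const\<close>, this choice makes the slice the reflection of q
    by definition, now under the primed reflector.\<close>
  define q where "q = onO (Sig D x) (onO (ii' D (one D)) (top_ob (MX' D (one D))))"
  have q: "q \<in> Obj (PX D X)" using top_terminal(2) by (simp add: q_def is_terminal_def)
  have slice: "right_slice D x = onO (Dia' D X) q"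
    by (simp add: right_slice_def existsM'_def q_def x')
  let ?n = "onO (ii' D X) (right_slice D x)"
  have n: "?n \<in> Obj (PX D X)" using slice_obj(2)[OF x] by simp
  let ?L = "prd_left (PX D X) (pccc D X)" and ?R = "prd_right (PX D X) (pccc D X)"
  note l = adjoint_functors(1)[OF L]
  note F = fibre_functors[OF X] fibre_functors[OF one_obj] arrow_functors[OF x]
    prd_left_functor[OF n] prd_left_functor[OF q] prd_right_functor[OF n] l
  have Dia: "is_functor (PX D X) (PX D X) (ii D X \<odot> Dia D X)"
    by (rule is_functor_fcomp[OF F(3) F(1)])
  have "naturally_isomorphic (PX D X) B (L \<odot> ?L ?n) (L \<odot> ?R ?n)"
    by (rule prd_left_right n l natiso_whisker_left)+
  \<comment> \<open>The order of the two mixed laws is forced. The slice comes from \<M>', so the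
    variable argument may be reflected into \<M>; only then does the law for \<diamond>' apply to
    the slice.\<close>
  also have "naturally_isomorphic (PX D X) B \<dots> (L \<odot> ?R ?n \<odot> ii D X \<odot> Dia D X)"
    by (rule coend_natiso(1)[OF X L _ _ mixed_natiso_right[OF X slice_obj(2)[OF x]]])
      (use is_functor_fcomp[OF Dia] F in simp_all)
  also have "naturally_isomorphic (PX D X) B \<dots> (L \<odot> ?L ?n \<odot> ii D X \<odot> Dia D X)"
    by (rule natiso_sym[OF prd_left_right] n F natiso_fcomp natiso_refl)+
  finally have 1: "naturally_isomorphic (PX D X) B (L \<odot> ?L ?n) (L \<odot> ?L ?n \<odot> ii D X \<odot> Dia D X)" .
  \<comment> \<open>The second law is read backwards: it strips the reflection off the slice and
    leaves q, to which \<open>Sig_terminal\<close> applies.\<close>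
  have "naturally_isomorphic (MX D X) B (L \<odot> ?L ?n \<odot> ii D X) (L \<odot> ?L q \<odot> ii D X)"
    by (rule natiso_sym, rule coend_natiso(2)[OF X L _ _ mixed'_natiso[OF X q, folded slice]])
      (rule is_functor_fcomp[OF F(1)] F)+
  also have "naturally_isomorphic (MX D X) B \<dots> (L \<odot> (Sig D x \<odot> subP D x) \<odot> ii D X)"
    by (rule natiso_sym[OF Sig_terminal[OF x top_terminal(2), folded q_def]] F natiso_whisker_left natiso_whisker_right)+
  also have "\<dots> = L \<odot> Sig D x \<odot> (subP D x \<odot> ii D X)" by (simp add: fcomp_assoc)
  also have "naturally_isomorphic (MX D X) B \<dots> (L \<odot> Sig D x \<odot> (ii D (one D) \<odot> subM D x))"
    by (rule natiso_sym[OF incl_sub(1)[OF x]] F natiso_whisker_left)+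
  also have "\<dots> = (L \<odot> Sig D x \<odot> ii D (one D)) \<odot> subM D x" by (simp add: fcomp_assoc)
  also have "naturally_isomorphic (MX D X) B \<dots> (G \<odot> subM D x)"
    by (rule natiso_whisker_right[OF coend_Sig_incl[OF x L] F(12)])
  finally have "naturally_isomorphic (PX D X) B ((L \<odot> ?L ?n \<odot> ii D X) \<odot> Dia D X) ((G \<odot> subM D x) \<odot> Dia D X)"
    by (rule natiso_whisker_right[OF _ F(3)])
  then show ?thesis
    using natiso_sym[OF natiso_trans[OF 1]] by (simp add: fcomp_assoc)
qed

text \<open>The Frobenius law moves the slice of Y under the direct image along f, where it becomes
  its substitution along f. What remains in front, the coend over Y after that direct image, is the
  coend over X.\<close>

lemma exists_ten:
  assumes f: "f \<in> hom (base D) X Y" and y: "y \<in> hom (base D) (one D) Y"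
    and L: "adjoint (PX D X) B L (const X)" and L': "adjoint (PX D Y) B L' (const Y)"
  shows "naturally_isomorphic (MX D X) B (G \<odot> subM D y \<odot> existsM D f)
    (L \<odot> prd_left (PX D X) (pccc D X) (onO (ii' D X) (onO (subM' D f) (right_slice D y))) \<odot> ii D X)"
proof -
  have X: "X \<in> Obj (base D)" and Y: "Y \<in> Obj (base D)" using base.hom_obj[OF f] .
  interpret X: cartesian_closed "PX D X" "pccc D X" using ccc[OF X] .
  interpret Y: cartesian_closed "PX D Y" "pccc D Y" using ccc[OF Y] .
  interpret i': fnctr "MX' D Y" "PX D Y" "ii' D Y" using fibre_functors(2)[OF Y] by (rule is_functor_fnctr)
  let ?q = "onO (ii' D Y) (right_slice D y)" and ?q' = "onO (ii' D X) (onO (subM' D f) (right_slice D y))"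
  have q: "?q \<in> Obj (PX D Y)" using slice_obj(2)[OF y] by simp
  obtain u where u: "is_iso (PX D X) u" "u \<in> hom (PX D X) (onO (subP D f) ?q) ?q'"
    using natiso_componentE[OF natiso_sym[OF incl_sub(2)[OF f]] slice_obj(2)[OF y]] by auto
  have q': "onO (subP D f) ?q \<in> Obj (PX D X)" "?q' \<in> Obj (PX D X)" using X.hom_obj[OF u(2)] .
  let ?LX = "prd_left (PX D X) (pccc D X)" and ?LY = "prd_left (PX D Y) (pccc D Y)"
  let ?RX = "prd_right (PX D X) (pccc D X)" and ?RY = "prd_right (PX D Y) (pccc D Y)"
  note l = adjoint_functors(1)[OF L] adjoint_functors(1)[OF L']
  have "naturally_isomorphic (PX D X) B (G \<odot> subM D y \<odot> Dia D Y \<odot> Sig D f) (L' \<odot> ?LY ?q \<odot> Sig D f)"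
    using natiso_whisker_right[OF Dia_meets[OF y L'] arrow_functors(4)[OF f]] by (simp add: fcomp_assoc)
  also have "naturally_isomorphic (PX D X) B \<dots> (L' \<odot> ?RY ?q \<odot> Sig D f)"
    by (rule Y.prd_left_right q l arrow_functors(4)[OF f] natiso_whisker_left natiso_whisker_right)+
  also have "naturally_isomorphic (PX D X) B \<dots> (L' \<odot> Sig D f \<odot> ?RX (onO (subP D f) ?q))"
    by (rule natiso_sym[OF frobenius_right[OF f q]] l natiso_whisker_left)+
  also have "\<dots> = (L' \<odot> Sig D f) \<odot> ?RX (onO (subP D f) ?q)" by (simp add: fcomp_assoc)
  also have "naturally_isomorphic (PX D X) B \<dots> (L \<odot> ?LX ?q')"
  proof (rule natiso_fcomp)
    \<comment> \<open>Both are left adjoint to the constant families on X, since substituting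
      constants of Y along f gives constants of X.\<close>
    show "naturally_isomorphic (PX D X) B (L' \<odot> Sig D f) L"
      by (rule left_adjoint_natiso[OF adjoint_fcomp[OF Sig_adjoint[OF f] L'] L sub_const[OF f]])
    show "naturally_isomorphic (PX D X) (PX D X) (?RX (onO (subP D f) ?q)) (?LX ?q')"
      by (rule natiso_trans[OF X.prd_right_cong[OF u] natiso_sym[OF X.prd_left_right[OF q'(2)]]])
  qed
  finally show ?thesis
    using natiso_whisker_right[OF _ fibre_functors(1)[OF X]] f
    by (fastforce simp: fcomp_assoc existsM_def hom_iff)
qed

end

section \<open>Exchange of the two modalities\<close>

definition swap_modalities ::
  "('x, 'c, 'mo, 'ma, 'po, 'pa, 'no, 'na) doctrine \<Rightarrow> ('x, 'c, 'no, 'na, 'po, 'pa, 'mo, 'ma) doctrine"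
  where
  "swap_modalities D =
     \<lparr>base = base D, one = one D, pcat = pcat D, mcat = mcat' D, mcat' = mcat D,
      incl = incl' D, incl' = incl D, pccc = pccc D,
      Sig = Sig D, SigUnit = SigUnit D, SigCounit = SigCounit D, Pi = Pi D,
      Dia = Dia' D, DiaUnit = DiaUnit' D, DiaCounit = DiaCounit' D, Box = Box' D,
      Dia' = Dia D, DiaUnit' = DiaUnit D, DiaCounit' = DiaCounit D, Box' = Box D, Ext = Ext D\<rparr>"

lemma swap_modalities_simps [simp]:
  "base (swap_modalities D) = base D" "one (swap_modalities D) = one D"
  "pcat (swap_modalities D) = pcat D" "mcat (swap_modalities D) = mcat' D"
  "mcat' (swap_modalities D) = mcat D" "incl (swap_modalities D) = incl' D"
  "incl' (swap_modalities D) = incl D" "pccc (swap_modalities D) = pccc D"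
  "Sig (swap_modalities D) = Sig D" "SigUnit (swap_modalities D) = SigUnit D"
  "SigCounit (swap_modalities D) = SigCounit D" "Pi (swap_modalities D) = Pi D"
  "Dia (swap_modalities D) = Dia' D" "DiaUnit (swap_modalities D) = DiaUnit' D"
  "DiaCounit (swap_modalities D) = DiaCounit' D" "Box (swap_modalities D) = Box' D"
  "Dia' (swap_modalities D) = Dia D" "DiaUnit' (swap_modalities D) = DiaUnit D"
  "DiaCounit' (swap_modalities D) = DiaCounit D" "Box' (swap_modalities D) = Box D"
  by (simp_all add: swap_modalities_def)

lemma swap_modalities_derived [simp]:
  "frobenius (swap_modalities D) = frobenius D"
  "existsM (swap_modalities D) = existsM' D" "forallM (swap_modalities D) = forallM' D"
  "left_slice (swap_modalities D) = right_slice D" "right_slice (swap_modalities D) = left_slice D"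
  by (simp_all add: fun_eq_iff frobenius_def existsM_def existsM'_def forallM_def forallM'_def
      left_slice_def right_slice_def)

text \<open>The component at an object is the isomorphism it carries, and the naturality square is
  the compatibility condition in the definition of arrows.\<close>

lemma pseudo_pullback_natiso:
  assumes p: "is_functor (pseudo_pullback A B P F G) A pb_proj1"
    and q: "is_functor (pseudo_pullback A B P F G) B pb_proj2"
    and F: "is_functor A P F" and G: "is_functor B P G"
  shows "naturally_isomorphic (pseudo_pullback A B P F G) P (F \<odot> pb_proj1) (G \<odot> pb_proj2)"
  by (rule naturally_isomorphicI[OF is_functor_fcomp[OF p F] is_functor_fcomp[OF q G],
        where \<tau> = "\<lambda>(a, b, \<phi>). \<phi>"])
    (auto simp: pseudo_pullback_def pb_proj1_def pb_proj2_def Let_def hom_def)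

section \<open>The two instances and the chosen adjoints\<close>

context temporal_doctrine
begin

lemma jinv: "quasi_inverse (BX D (one D)) (MX D (one D)) (jj D (one D)) (jinv D)"
  unfolding jinv_def using j_equivalence unfolding is_equivalence_def by (rule someI_ex)

lemma jinv': "quasi_inverse (BX D (one D)) (MX' D (one D)) (jj' D (one D)) (jinv' D)"
  unfolding jinv'_def using j'_equivalence unfolding is_equivalence_def by (rule someI_ex)

lemma jj_functor: "is_functor (BX D (one D)) (MX D (one D)) (jj D (one D))"
  and jj'_functor: "is_functor (BX D (one D)) (MX' D (one D)) (jj' D (one D))"
  using jinv jinv' by (simp_all add: quasi_inverse_def)

lemma one_obj: "one D \<in> Obj (base D)"
  using one_terminal by (simp add: is_terminal_def)

lemma incl_functor:
  assumes "X \<in> Obj (base D)"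
  shows "is_functor (MX D X) (PX D X) (ii D X)" "is_functor (MX' D X) (PX D X) (ii' D X)"
  using indexed_functor.fun_functor[OF i_indexed assms] indexed_functor.fun_functor[OF i'_indexed assms] .

lemma bb_natiso:
  "naturally_isomorphic (BX D (one D)) (PX D (one D)) (ii D (one D) \<odot> jj D (one D)) (bb D (one D))"
  "naturally_isomorphic (BX D (one D)) (PX D (one D)) (ii' D (one D) \<odot> jj' D (one D)) (bb D (one D))"
proof -
  show "naturally_isomorphic (BX D (one D)) (PX D (one D)) (ii D (one D) \<odot> jj D (one D)) (bb D (one D))"
    unfolding bb_def by (rule natiso_refl[OF is_functor_fcomp[OF jj_functor incl_functor(1)[OF one_obj]]])
  show "naturally_isomorphic (BX D (one D)) (PX D (one D)) (ii' D (one D) \<odot> jj' D (one D)) (bb D (one D))"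
    using pseudo_pullback_natiso[OF jj_functor[unfolded BX_def jj_def] jj'_functor[unfolded BX_def jj'_def]
        incl_functor[OF one_obj]]
    unfolding BX_def bb_def jj_def jj'_def by (rule natiso_sym)
qed

lemma truth_values:
  "doctrine_with_truth_values D (BX D (one D)) (bb D (one D)) (jj D (one D)) (jj' D (one D)) (jinv D)"
  by (rule doctrine_with_truth_values.intro)
    (rule base_category i_indexed i'_indexed one_terminal P_cartesian_closed Sig_adjunction Pi_adjoint
      Dia_adjunction Box_adjoint Dia'_adjunction Box'_adjoint i_fully_faithful i'_fully_faithful
      frobenius_law mixed_frobenius mixed_frobenius' jinv jj'_functor bb_natiso | assumption)+

text \<open>The truth values remain \<open>BX D (one D)\<close>, not the pullback of the exchanged
  doctrine, because the dual formulas take values in the same category as the original ones.\<close>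

lemma truth_values_swap:
  "doctrine_with_truth_values (swap_modalities D) (BX D (one D)) (bb D (one D)) (jj' D (one D))
    (jj D (one D)) (jinv' D)"
  by (rule doctrine_with_truth_values.intro,
      unfold swap_modalities_simps swap_modalities_derived)
    (rule base_category i_indexed i'_indexed one_terminal P_cartesian_closed Sig_adjunction Pi_adjoint
      Dia_adjunction Box_adjoint Dia'_adjunction Box'_adjoint i_fully_faithful i'_fully_faithful
      frobenius_law mixed_frobenius mixed_frobenius' jinv' jj_functor bb_natiso | assumption)+

interpretation t: doctrine_with_truth_values D "BX D (one D)" "bb D (one D)" "jj D (one D)"
  "jj' D (one D)" "jinv D" by (rule truth_values)

lemma const_eq: "t.const X = const_sub D X"
  by (simp add: t.const_def t.point_of_def const_sub_def)

interpretation t': doctrine_with_truth_values "swap_modalities D" "BX D (one D)" "bb D (one D)"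
  "jj' D (one D)" "jj D (one D)" "jinv' D" by (rule truth_values_swap)

lemma const_eq': "t'.const X = const_sub D X"
  by (simp add: t'.const_def t'.point_of_def const_sub_def)

text \<open>The choice is meaningful because a left adjoint of X^* i_1 j_1 exists: the direct image
  along the map to 1, then the diamond of 1, then the quasi-inverse of j_1.\<close>

lemma coendf_adjoint:
  assumes "X \<in> Obj (base D)"
  shows "adjoint (PX D X) (BX D (one D)) (coendf D X) (const_sub D X)"
  unfolding coendf_def const_sub_def bb_def
  by (rule someI, rule adjoint_fcomp[OF t.Sig_adjoint[OF t.point_of_hom[OF assms, unfolded t.point_of_def]]
        adjoint_fcomp[OF t.Dia_adjoint(1)[OF one_obj] quasi_inverse_adjoint[OF quasi_inverse_sym[OF jinv]]]])

text \<open>Likewise a right adjoint is given by \<open>Pi\<close> along the map to 1, then the box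
  of 1, then the same quasi-inverse.\<close>

lemma endf_adjoint:
  assumes "X \<in> Obj (base D)"
  shows "adjoint (BX D (one D)) (PX D X) (const_sub D X) (endf D X)"
  unfolding endf_def const_sub_def bb_def
  by (rule someI, rule adjoint_fcomp[OF adjoint_fcomp[OF quasi_inverse_adjoint[OF jinv] Box_adjoint[OF one_obj]]
        Pi_adjoint[OF t.point_of_hom[OF assms, unfolded t.point_of_def]]])

text \<open>The exchanged instance puts the slice in the first argument, while the dual formulas
  have it in the second; symmetry of the product reconciles the two.\<close>

lemma meets_right_natiso:
  assumes X: "X \<in> Obj (base D)" and q: "q \<in> Obj (PX D X)"
  shows "naturally_isomorphic (PX D X) (BX D (one D))
    (coendf D X \<odot> prd_left (PX D X) (pccc D X) q) (meets_right D X q)"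
  unfolding meets_right_def
  by (rule natiso_whisker_left[OF cartesian_closed.prd_left_right[OF P_cartesian_closed[OF X] q]
        adjoint_functors(1)[OF coendf_adjoint[OF X]]])

lemma pointwise_quantifiers:
  assumes f: "f \<in> hom (base D) X Y" and y: "y \<in> hom (base D) (one D) Y"
  shows "naturally_isomorphic (MX D X) (BX D (one D)) (jinv D \<odot> subM D y \<odot> forallM D f)
      (nat_from D X (onO (subM D f) (left_slice D y)))"
    and "naturally_isomorphic (MX D X) (BX D (one D)) (jinv D \<odot> subM D y \<odot> existsM D f)
      (ten_left D X (onO (subM' D f) (right_slice D y)))"
    and "naturally_isomorphic (MX' D X) (BX D (one D)) (jinv' D \<odot> subM' D y \<odot> forallM' D f)
      (nat_from' D X (onO (subM' D f) (right_slice D y)))"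
    and "naturally_isomorphic (MX' D X) (BX D (one D)) (jinv' D \<odot> subM' D y \<odot> existsM' D f)
      (ten_right D X (onO (subM D f) (left_slice D y)))"
proof -
  have X: "X \<in> Obj (base D)" and Y: "Y \<in> Obj (base D)"
    using category.hom_obj[OF base_category f] .
  note L = coendf_adjoint[OF X] coendf_adjoint[OF Y] and R = endf_adjoint[OF X] endf_adjoint[OF Y]
  show "naturally_isomorphic (MX D X) (BX D (one D)) (jinv D \<odot> subM D y \<odot> forallM D f)
      (nat_from D X (onO (subM D f) (left_slice D y)))"
    using t.forall_nat[OF f y] R by (simp add: const_eq nat_from_def hom_from_def fcomp_assoc)
  show "naturally_isomorphic (MX D X) (BX D (one D)) (jinv D \<odot> subM D y \<odot> existsM D f)
      (ten_left D X (onO (subM' D f) (right_slice D y)))"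
    using t.exists_ten[OF f y] L by (simp add: const_eq ten_left_def meets_left_def fcomp_assoc)
  show "naturally_isomorphic (MX' D X) (BX D (one D)) (jinv' D \<odot> subM' D y \<odot> forallM' D f)
      (nat_from' D X (onO (subM' D f) (right_slice D y)))"
    using t'.forall_nat[of f X Y y] f y R
    by (simp add: const_eq' nat_from'_def hom_from_def fcomp_assoc)
  have "naturally_isomorphic (MX' D X) (BX D (one D)) (jinv' D \<odot> subM' D y \<odot> existsM' D f)
      ((coendf D X \<odot> prd_left (PX D X) (pccc D X) (onO (ii D X) (onO (subM D f) (left_slice D y)))) \<odot> ii' D X)"
    using t'.exists_ten[of f X Y y] f y L by (simp add: const_eq' fcomp_assoc)
  moreover have "onO (ii D X) (onO (subM D f) (left_slice D y)) \<in> Obj (PX D X)"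
    using t.slice_obj(1)[OF y] incl_functor(1)[OF X] t.arrow_functors(2)[OF f]
    by (simp add: is_functor_def)
  ultimately show "naturally_isomorphic (MX' D X) (BX D (one D)) (jinv' D \<odot> subM' D y \<odot> existsM' D f)
      (ten_right D X (onO (subM D f) (left_slice D y)))"
    unfolding ten_right_def
    using natiso_trans natiso_whisker_right[OF meets_right_natiso[OF X] incl_functor(2)[OF X]] by blast
qed

lemma pointwise_modalities:
  assumes x: "x \<in> hom (base D) (one D) X"
  shows "naturally_isomorphic (PX D X) (BX D (one D)) (jinv D \<odot> subM D x \<odot> Box D X)
      (hom_from D X (onO (ii D X) (left_slice D x)))"
    and "naturally_isomorphic (PX D X) (BX D (one D)) (jinv D \<odot> subM D x \<odot> Dia D X)
      (meets_left D X (onO (ii' D X) (right_slice D x)))"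
    and "naturally_isomorphic (PX D X) (BX D (one D)) (jinv' D \<odot> subM' D x \<odot> Box' D X)
      (hom_from D X (onO (ii' D X) (right_slice D x)))"
    and "naturally_isomorphic (PX D X) (BX D (one D)) (jinv' D \<odot> subM' D x \<odot> Dia' D X)
      (meets_right D X (onO (ii D X) (left_slice D x)))"
proof -
  have X: "X \<in> Obj (base D)"
    using category.hom_obj[OF base_category x] by simp
  note L = coendf_adjoint[OF X] and R = endf_adjoint[OF X]
  show "naturally_isomorphic (PX D X) (BX D (one D)) (jinv D \<odot> subM D x \<odot> Box D X)
      (hom_from D X (onO (ii D X) (left_slice D x)))"
    using t.Box_hom[OF x] R by (simp add: const_eq hom_from_def)
  show "naturally_isomorphic (PX D X) (BX D (one D)) (jinv D \<odot> subM D x \<odot> Dia D X)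
      (meets_left D X (onO (ii' D X) (right_slice D x)))"
    using t.Dia_meets[OF x] L by (simp add: const_eq meets_left_def)
  show "naturally_isomorphic (PX D X) (BX D (one D)) (jinv' D \<odot> subM' D x \<odot> Box' D X)
      (hom_from D X (onO (ii' D X) (right_slice D x)))"
    using t'.Box_hom[of x X] x R by (simp add: const_eq' hom_from_def)
  have "naturally_isomorphic (PX D X) (BX D (one D)) (jinv' D \<odot> subM' D x \<odot> Dia' D X)
      (coendf D X \<odot> prd_left (PX D X) (pccc D X) (onO (ii D X) (left_slice D x)))"
    using t'.Dia_meets[of x X] x L by (simp add: const_eq')
  moreover have "onO (ii D X) (left_slice D x) \<in> Obj (PX D X)"
    using t.slice_obj(1)[OF x] incl_functor(1)[OF X] by (simp add: is_functor_def)
  ultimately show "naturally_isomorphic (PX D X) (BX D (one D)) (jinv' D \<odot> subM' D x \<odot> Dia' D X)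
      (meets_right D X (onO (ii D X) (left_slice D x)))"
    using natiso_trans[OF _ meets_right_natiso[OF X]] by blast
qed

end

theorem corollary7p3:
  fixes D :: "('x, 'c, 'mo, 'ma, 'po, 'pa, 'no, 'na) doctrine"
  assumes "temporal_doctrine D"
  shows
    "(\<forall>X Y f y. f \<in> hom (base D) X Y \<and> y \<in> hom (base D) (one D) Y \<longrightarrow>
        naturally_isomorphic (MX D X) (BX D (one D))
          (jinv D \<odot> subM D y \<odot> forallM D f)
          (nat_from D X (onO (subM D f) (left_slice D y))) \<and>
        naturally_isomorphic (MX D X) (BX D (one D))
          (jinv D \<odot> subM D y \<odot> existsM D f)
          (ten_left D X (onO (subM' D f) (right_slice D y))) \<and>
        naturally_isomorphic (MX' D X) (BX D (one D))
          (jinv' D \<odot> subM' D y \<odot> forallM' D f)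
          (nat_from' D X (onO (subM' D f) (right_slice D y))) \<and>
        naturally_isomorphic (MX' D X) (BX D (one D))
          (jinv' D \<odot> subM' D y \<odot> existsM' D f)
          (ten_right D X (onO (subM D f) (left_slice D y)))) \<and>
     (\<forall>X x. x \<in> hom (base D) (one D) X \<longrightarrow>
        naturally_isomorphic (PX D X) (BX D (one D))
          (jinv D \<odot> subM D x \<odot> Box D X)
          (hom_from D X (onO (ii D X) (left_slice D x))) \<and>
        naturally_isomorphic (PX D X) (BX D (one D))
          (jinv D \<odot> subM D x \<odot> Dia D X)
          (meets_left D X (onO (ii' D X) (right_slice D x))) \<and>
        naturally_isomorphic (PX D X) (BX D (one D))
          (jinv' D \<odot> subM' D x \<odot> Box' D X)
          (hom_from D X (onO (ii' D X) (right_slice D x))) \<and>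
        naturally_isomorphic (PX D X) (BX D (one D))
          (jinv' D \<odot> subM' D x \<odot> Dia' D X)
          (meets_right D X (onO (ii D X) (left_slice D x))))"
proof -
  interpret temporal_doctrine D by (rule assms)
  show ?thesis using pointwise_quantifiers pointwise_modalities by auto
qed

end
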